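(* Let $Y$ be a Hopf manifold, i.e. a compact complex manifold of dimension $n \geqslant 2$ whose universal cover is biholomorphic to $\mathbb{C}^n \setminus \{0\}$. Then the group $\mathrm{Aut}(Y)$ of biholomorphic automorphisms of $Y$ is Jordan.
   Context: A group $G$ is called Jordan if there exists a constant $C$ such that every finite subgroup $H \subset G$ contains an abelian subgroup whose index in $H$ is less than $C$. *)

theory Defs
  imports "HOL-Analysis.Analysis" "HOL-Algebra.Coset"
begin

definition holo_on :: "(complex^'n \<Rightarrow> complex^'m) \<Rightarrow> (complex^'n) set \<Rightarrow> bool" where
  "holo_on f S \<longleftrightarrow> open S \<and>
     (\<forall>x\<in>S. \<exists>L. (f has_derivative L) (at x) \<and> (\<forall>c v. L (c *s v) = c *s L v))"

definition complex_chart :: "'a topology \<Rightarrow> ('a \<Rightarrow> complex^'n) \<Rightarrow> 'a set \<Rightarrow> bool" where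
  "complex_chart X \<phi> U \<longleftrightarrow> openin X U \<and> open (\<phi> ` U) \<and>
     homeomorphic_map (subtopology X U) (top_of_set (\<phi> ` U)) \<phi>"

definition complex_manifold :: "'a topology \<Rightarrow> (('a \<Rightarrow> complex^'n) \<times> 'a set) set \<Rightarrow> bool" where
  "complex_manifold X A \<longleftrightarrow> Hausdorff_space X \<and> second_countable X \<and>
     (\<forall>(\<phi>,U)\<in>A. complex_chart X \<phi> U) \<and>
     \<Union>(snd ` A) = topspace X \<and>
     (\<forall>(\<phi>,U)\<in>A. \<forall>(\<psi>,V)\<in>A. holo_on (\<psi> \<circ> inv_into U \<phi>) (\<phi> ` (U \<inter> V)))"

definition holo_map :: "'a topology \<Rightarrow> (('a \<Rightarrow> complex^'n) \<times> 'a set) set \<Rightarrow>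
    'b topology \<Rightarrow> (('b \<Rightarrow> complex^'m) \<times> 'b set) set \<Rightarrow> ('a \<Rightarrow> 'b) \<Rightarrow> bool" where
  "holo_map X A Y B f \<longleftrightarrow> continuous_map X Y f \<and>
     (\<forall>(\<phi>,U)\<in>A. \<forall>(\<psi>,V)\<in>B.
        holo_on (\<psi> \<circ> f \<circ> inv_into U \<phi>) (\<phi> ` {x\<in>U. f x \<in> V}))"

definition biholo_auto :: "'a topology \<Rightarrow> (('a \<Rightarrow> complex^'n) \<times> 'a set) set \<Rightarrow> ('a \<Rightarrow> 'a) \<Rightarrow> bool" where
  "biholo_auto X A f \<longleftrightarrow> bij_betw f (topspace X) (topspace X) \<and>
     holo_map X A X A f \<and> holo_map X A X A (inv_into (topspace X) f)"

text \<open>The group Aut(Y) under composition; automorphisms are normalised to be the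
  identity outside the carrier so that they are determined by their action on Y.\<close>
definition aut_group :: "'a topology \<Rightarrow> (('a \<Rightarrow> complex^'n) \<times> 'a set) set \<Rightarrow> ('a \<Rightarrow> 'a) monoid" where
  "aut_group X A = \<lparr> carrier = {f. biholo_auto X A f \<and> (\<forall>x. x \<notin> topspace X \<longrightarrow> f x = x)},
                     mult = (\<circ>), one = id \<rparr>"

text \<open>Covering maps between abstract topological spaces (mirrors covering_space).\<close>
definition covering_map :: "'a topology \<Rightarrow> 'b topology \<Rightarrow> ('a \<Rightarrow> 'b) \<Rightarrow> bool" where
  "covering_map E X p \<longleftrightarrow> continuous_map E X p \<and> p ` topspace E = topspace X \<and>
     (\<forall>x\<in>topspace X. \<exists>T. x \<in> T \<and> openin X T \<and>
        (\<exists>v. \<Union>v = {e\<in>topspace E. p e \<in> T} \<and> (\<forall>u\<in>v. openin E u) \<and> pairwise disjnt v \<and>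
             (\<forall>u\<in>v. homeomorphic_map (subtopology E u) (subtopology X T) p)))"

definition punctured_space :: "(complex^'n) topology" where
  "punctured_space = top_of_set (- {0})"

definition punctured_atlas :: "((complex^'n \<Rightarrow> complex^'n) \<times> (complex^'n) set) set" where
  "punctured_atlas = {(id, - {0})}"

text \<open>Hopf manifold: compact complex manifold of dimension n = CARD('n) \<ge> 2 whose universal
  cover is biholomorphic to C^n minus 0, i.e. there is a holomorphic covering map from
  C^n minus 0 (simply connected for n \<ge> 2, hence the universal cover) onto it.\<close>
definition hopf_manifold :: "'a topology \<Rightarrow> (('a \<Rightarrow> complex^'n) \<times> 'a set) set \<Rightarrow> bool" where
  "hopf_manifold Y A \<longleftrightarrow> CARD('n) \<ge> 2 \<and> complex_manifold Y A \<and> compact_space Y \<and>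
     (\<exists>p :: complex^'n \<Rightarrow> 'a. covering_map punctured_space Y p \<and>
        holo_map punctured_space punctured_atlas Y A p)"

definition jordan_group :: "('g, 'm) monoid_scheme \<Rightarrow> bool" where
  "jordan_group G \<longleftrightarrow> (\<exists>C::nat. \<forall>H. subgroup H G \<and> finite H \<longrightarrow>
     (\<exists>B. subgroup B G \<and> B \<subseteq> H \<and> (\<forall>a\<in>B. \<forall>b\<in>B. a \<otimes>\<^bsub>G\<^esub> b = b \<otimes>\<^bsub>G\<^esub> a) \<and>
          card (rcosets\<^bsub>G\<lparr>carrier := H\<rparr>\<^esub> B) < C))"

end

theory Submission
  imports Defs "HOL-Complex_Analysis.Complex_Analysis" "HOL-Algebra.Generated_Groups"
    "HOL-Computational_Algebra.Fundamental_Theorem_Algebra"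
begin

text \<open>
  The lifts of a finite group of automorphisms to \<open>\<complex>\<^sup>n - {0}\<close> form a group \<open>G\<close> that acts properly
  discontinuously and cocompactly. Each lift extends continuously by \<open>0 \<mapsto> 0\<close> and has a derivative at the
  origin. Cocompactness yields a contraction in \<open>G\<close>; its powers have finite index, and since the determinant at
  the origin separates them, some power \<open>b\<close> is central. By Cartan's uniqueness argument an element of finite order
  with trivial derivative at the origin is trivial, whence two elements with commuting derivatives commute. Twisting
  the derivative by powers of a matrix root of the derivative of \<open>b\<close> gives a homomorphism from \<open>G\<close> to a finite linear group
  that still detects commutation. Jordan's theorem for finite linear groups then applies, with a bound that
  depends only on \<open>n\<close>; it is proved with Frobenius' argument on commutators of elements near the identity
  and a volume packing. Lifts are holomorphic because injective holomorphic maps between open sets of equal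
  dimension are immersive.
\<close>

no_notation fps_nth (infixl \<open>$\<close> 75)

section \<open>Finite groups of complex matrices\<close>

text \<open>The derivative at the origin is a homomorphism on \<open>G\<close>, but two obstacles
  separate it from a finite linear group. A contraction need not be linearizable because of
  resonances, so commuting derivatives do not by themselves give commuting maps. Here the
  determinant helps: a commutator has determinant one at the origin, so in a relation between its
  powers and powers of the contraction the latter cancel; the commutator has finite order, which is
  what Cartan's argument requires. The second obstacle is that the image is infinite. The exponent
  of an element of \<open>G\<close> relative to \<open>b\<close> is in general only a fraction of
  bounded denominator, so dividing out \<open>b\<close> calls for fractional powers of its
  derivative. The root is taken as a polynomial in that derivative and so commutes with all
  derivatives of elements of \<open>G\<close>. The abelian part is carried along as a commuting set
  \<open>S\<close> with a bound on families that are pairwise incongruent modulo \<open>S\<close>;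
  this form passes through a homomorphism with a kernel, and a subgroup is generated only at the
  end.\<close>

primrec mpow :: "complex^'n^'n \<Rightarrow> nat \<Rightarrow> complex^'n^'n" where
  "mpow A 0 = mat 1"
| "mpow A (Suc k) = A ** mpow A k"

lemma mpow_add: "mpow A (i + j) = mpow A i ** mpow A j"
  by (induction i) (auto simp: matrix_mul_assoc)

lemma mpow_commute:
  assumes "A ** B = B ** A" shows "mpow A k ** B = B ** mpow A k"
proof (induction k)
  case (Suc k)
  have "mpow A (Suc k) ** B = A ** (mpow A k ** B)" by (simp add: matrix_mul_assoc)
  also have "\<dots> = (A ** B) ** mpow A k" by (simp add: Suc matrix_mul_assoc)
  finally show ?case by (simp add: assms matrix_mul_assoc)
qed simp

section \<open>Linear algebra with complex scalars\<close>

lemma vec_mult_sum: "A *v (\<Sum>i\<in>I. f i) = (\<Sum>i\<in>I. A *v f i)" for A :: "complex^'n^'m"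
  by (induction I rule: infinite_finite_induct) (auto simp: matrix_vector_right_distrib)

lemma vec_mult_cscale: "A *v (c *s x) = c *s (A *v x)" for A :: "complex^'n^'m"
  by (simp add: vec_eq_iff matrix_vector_mult_def sum_distrib_left mult_ac)

lemma sum_mult_vec: "(\<Sum>i\<in>I. f i) *v x = (\<Sum>i\<in>I. f i *v x)" for f :: "'i \<Rightarrow> complex^'n^'m"
  by (induction I rule: infinite_finite_induct) (auto simp: matrix_vector_mult_add_rdistrib)

lemma mat_mult_vec: "mat c *v x = c *s x" for x :: "complex^'n"
proof -
  have "(\<Sum>j\<in>UNIV. (if i = j then c else 0) * x $ j) = c * x $ i" for i
  proof -
    have "(\<Sum>j\<in>UNIV. (if i = j then c else 0) * x $ j) = (\<Sum>j\<in>UNIV. if i = j then c * x $ j else 0)"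
      by (intro sum.cong) auto
    then show ?thesis by simp
  qed
  then show ?thesis by (simp add: vec_eq_iff matrix_vector_mult_def mat_def)
qed

lemma mat_commute: "mat c ** A = A ** mat c" for A :: "complex^'n^'n"
  by (simp add: matrix_eq mat_mult_vec vec_mult_cscale flip: matrix_vector_mul_assoc)

lemma matrix_sum_left: "(\<Sum>i\<in>I. f i) ** B = (\<Sum>i\<in>I. f i ** B)" for B :: "complex^'n^'n"
  by (induction I rule: infinite_finite_induct) (auto simp: matrix_matrix_mult_def vec_eq_iff sum.distrib algebra_simps)

lemma matrix_sum_right: "B ** (\<Sum>i\<in>I. f i) = (\<Sum>i\<in>I. B ** f i)" for B :: "complex^'n^'n"
  by (induction I rule: infinite_finite_induct) (auto simp: matrix_add_ldistrib)

lemma vec_cscale_sum: "(c::complex) *s (\<Sum>i\<in>I. f i) = (\<Sum>i\<in>I. c *s f i)"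
  by (induction I rule: infinite_finite_induct) (auto simp: vector_add_ldistrib)

text \<open>\<open>A\<close> is diagonalizable because \<open>X ^ m - 1\<close> has distinct roots.
  \<open>P j\<close> is the Fourier average of the powers of \<open>A\<close>, the projection onto
  the eigenspace of \<open>w ^ j\<close> for a primitive root of unity \<open>w\<close>. As a
  polynomial in \<open>A\<close> it commutes with whatever commutes with \<open>A\<close>.\<close>

lemma eigenspace_projections:
  fixes A :: "complex^'n^'n"
  assumes "mpow A m = mat 1" "m > 0"
  obtains P :: "nat \<Rightarrow> complex^'n^'n" and \<mu> :: "nat \<Rightarrow> complex" where
    "\<And>x. x = (\<Sum>j<m. P j *v x)" "\<And>j x. A *v (P j *v x) = \<mu> j *s (P j *v x)"
    "\<And>j B. A ** B = B ** A \<Longrightarrow> P j ** B = B ** P j"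
proof -
  define w where "w = cis (2 * pi / m)"
  have wm: "w ^ m = 1"
    using assms(2) by (simp add: w_def Complex.DeMoivre)
  have w0: "w \<noteq> 0" by (simp add: w_def)
  have wk: "w ^ k \<noteq> 1" if "0 < k" "k < m" for k
  proof
    assume "w ^ k = 1"
    then have "cis (2 * pi * k / m) = 1" by (simp add: w_def Complex.DeMoivre mult_ac)
    then have "cos (2 * pi * k / m) = 1" by (metis cis.simps(1) one_complex.simps(1))
    then obtain l :: int where "2 * pi * k / m = l * 2 * pi" using cos_one_2pi_int by auto
    then have "real k = l * m" using assms by (simp add: field_simps)
    then have "int k = l * int m" by (metis of_int_eq_iff of_int_mult of_int_of_nat_eq)
    then show False using that
      by (metis dvd_triv_right int_dvd_int_iff nat_dvd_not_less)
  qed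
  define P where "P j = (\<Sum>k<m. mat (inverse (w ^ (j * k)) / m) ** mpow A k)" for j
  have Pv: "P j *v x = (\<Sum>k<m. (inverse (w ^ (j * k)) / m) *s (mpow A k *v x))" for j x
    by (simp add: P_def sum_mult_vec mat_mult_vec flip: matrix_vector_mul_assoc)
  have 1: "x = (\<Sum>j<m. P j *v x)" for x
  proof -
    have "(\<Sum>j<m. P j *v x) = (\<Sum>k<m. \<Sum>j<m. (inverse (w ^ (j * k)) / m) *s (mpow A k *v x))"
      by (simp add: Pv) (rule sum.swap)
    also have "\<dots> = (\<Sum>k<m. (\<Sum>j<m. inverse (w ^ (j * k)) / m) *s (mpow A k *v x))"
      by (simp add: vec_eq_iff sum_distrib_right)
    also have "\<dots> = (\<Sum>k<m. if k = 0 then x else 0)"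
    proof (rule sum.cong)
      fix k assume k: "k \<in> {..<m}"
      show "(\<Sum>j<m. inverse (w ^ (j * k)) / m) *s (mpow A k *v x) = (if k = 0 then x else 0)"
      proof (cases "k = 0")
        case False
        have "inverse (w ^ (j * k)) = inverse (w ^ k) ^ j" for j
          by (simp add: power_inverse power_mult[symmetric] mult.commute)
        then have "(\<Sum>j<m. inverse (w ^ (j * k))) = (\<Sum>j<m. inverse (w ^ k) ^ j)" by simp
        also have "\<dots> = 0"
        proof -
          have "inverse (w ^ k) \<noteq> 1" using wk[of k] False k by auto
          moreover have "inverse (w ^ k) ^ m = 1"
            using wm by (metis inverse_1 mult.commute power_inverse power_mult power_one)
          ultimately show ?thesis by (subst geometric_sum) auto
        qed
        finally show ?thesis using False by (simp flip: sum_divide_distrib)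
      qed (use assms in simp)
    qed simp
    also have "\<dots> = x" using assms(2) by (simp add: sum.delta')
    finally show ?thesis by simp
  qed
  have 2: "A *v (P j *v x) = w ^ j *s (P j *v x)" for j x
  proof -
    define g where "g k = (inverse (w ^ (j * k)) / m) *s (mpow A k *v x)" for k
    have A: "A *v g k = w ^ j *s g (Suc k)" for k
    proof -
      have "w ^ j * inverse (w ^ (j * Suc k)) = inverse (w ^ (j * k))"
        using w0 by (simp add: power_add)
      then show ?thesis
        by (simp add: g_def vec_mult_cscale matrix_vector_mul_assoc)
    qed
    \<comment> \<open>The sum runs over a full period, so multiplication by \<open>A\<close> only
      shifts it cyclically, up to the factor \<open>w ^ j\<close>.\<close>
    have "g m = g 0"
    proof -
      have "w ^ (j * m) = 1" using wm by (metis mult.commute power_mult power_one)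
      then show ?thesis by (simp add: g_def assms)
    qed
    then have "(\<Sum>k<m. g (Suc k)) = (\<Sum>k<m. g k)"
      using sum.lessThan_Suc[of g m] sum.lessThan_Suc_shift[of g m] by simp
    moreover have "P j *v x = (\<Sum>k<m. g k)" by (simp add: Pv g_def)
    ultimately show ?thesis by (simp add: vec_mult_sum A flip: vec_cscale_sum)
  qed
  have 3: "P j ** B = B ** P j" if "A ** B = B ** A" for j B
    unfolding P_def matrix_sum_left matrix_sum_right
  proof (rule sum.cong)
    fix k assume "k \<in> {..<m}"
    show "mat (inverse (w ^ (j * k)) / of_nat m) ** mpow A k ** B = B ** (mat (inverse (w ^ (j * k)) / of_nat m) ** mpow A k)"
      by (metis mpow_commute[OF that] mat_commute matrix_mul_assoc)
  qed simp
  show thesis using that[OF 1 2 3] .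
qed

section \<open>The hermitian inner product and norm bounds\<close>

definition herm :: "complex^'n \<Rightarrow> complex^'n \<Rightarrow> complex" where
  "herm x y = (\<Sum>i\<in>UNIV. x $ i * cnj (y $ i))"

lemma herm_diff_left: "herm (x - y) z = herm x z - herm y z"
  and herm_diff_right: "herm z (x - y) = herm z x - herm z y"
  and herm_scale_left: "herm (c *s x) y = c * herm x y"
  and herm_scale_right: "herm x (c *s y) = cnj c * herm x y"
  by (simp_all add: herm_def sum.distrib sum_subtractf algebra_simps sum_distrib_left)

lemma Re_herm: "Re (herm x y) = x \<bullet> y"
  by (simp add: herm_def inner_vec_def inner_complex_def)

lemma herm_self: "herm x x = of_real ((norm x)\<^sup>2)"
proof -
  have "herm x x = (\<Sum>i\<in>UNIV. of_real ((cmod (x $ i))\<^sup>2))"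
    by (simp add: herm_def complex_norm_square[symmetric])
  also have "\<dots> = of_real (\<Sum>i\<in>UNIV. (cmod (x $ i))\<^sup>2)" by simp
  also have "(\<Sum>i\<in>UNIV. (cmod (x $ i))\<^sup>2) = (norm x)\<^sup>2"
    by (simp add: norm_vec_def L2_set_def sum_nonneg)
  finally show ?thesis .
qed

lemma herm_commute: "herm y x = cnj (herm x y)"
  by (simp add: herm_def mult.commute)

lemma cmod_herm_le: "cmod (herm x y) \<le> norm x * norm y"
proof -
  have "cmod (herm x y) \<le> (\<Sum>i\<in>UNIV. \<bar>norm (x $ i)\<bar> * \<bar>norm (y $ i)\<bar>)"
    unfolding herm_def by (rule order_trans[OF norm_sum]) (simp add: norm_mult)
  also have "\<dots> \<le> norm x * norm y"
    unfolding norm_vec_def by (rule L2_set_mult_ineq)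
  finally show ?thesis .
qed

lemma norm_cscale: "norm (c *s x) = cmod c * norm x" for x :: "complex^'n"
  by (simp add: norm_vec_def norm_mult L2_set_left_distrib L2_set_right_distrib)

lemma norm_vec_le_sum: "norm x \<le> (\<Sum>i\<in>UNIV. norm (x $ i))"
  unfolding norm_vec_def by (rule L2_set_le_sum) auto

lemma norm_mult_vec_le:
  fixes M :: "complex^'n^'n"
  shows "norm (M *v x) \<le> (real CARD('n))\<^sup>2 * norm M * norm x"
proof -
  have "norm ((M *v x) $ i) \<le> real CARD('n) * (norm M * norm x)" for i
  proof -
    have "norm ((M *v x) $ i) \<le> (\<Sum>j\<in>UNIV. norm (M $ i $ j * x $ j))"
      unfolding matrix_vector_mult_def by (simp add: norm_sum)
    also have "\<dots> \<le> (\<Sum>j\<in>(UNIV::'n set). norm M * norm x)"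
    proof (rule sum_mono)
      fix j
      have "norm (M $ i $ j) \<le> norm M"
        by (meson Finite_Cartesian_Product.norm_nth_le order_trans)
      then show "norm (M $ i $ j * x $ j) \<le> norm M * norm x"
        by (simp add: norm_mult mult_mono Finite_Cartesian_Product.norm_nth_le)
    qed
    finally show ?thesis by simp
  qed
  then have "(\<Sum>i\<in>UNIV. norm ((M *v x) $ i)) \<le> (\<Sum>i\<in>(UNIV::'n set). real CARD('n) * (norm M * norm x))"
    by (intro sum_mono)
  then show ?thesis using norm_vec_le_sum[of "M *v x"] by (simp add: power2_eq_square mult_ac)
qed

lemma mult_axis: "(M *v axis j 1) $ i = M $ i $ j" for M :: "complex^'n^'m"
  by (simp add: matrix_vector_mult_def axis_def if_distrib cong: if_cong)

lemma matrix_inv_eq: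
  fixes A :: "complex^'n^'n"
  assumes "A ** B = mat 1"
  shows "matrix_inv A = B"
proof -
  have BA: "B ** A = mat 1" using assms matrix_left_right_inverse by blast
  with assms have "A ** matrix_inv A = mat 1 \<and> matrix_inv A ** A = mat 1"
    unfolding matrix_inv_def by (rule someI2[of "\<lambda>A'. A ** A' = mat 1 \<and> A' ** A = mat 1", OF conjI])
  then have "matrix_inv A = (B ** A) ** matrix_inv A" "B ** (A ** matrix_inv A) = B"
    by (simp_all add: BA)
  then show ?thesis by (simp add: matrix_mul_assoc)
qed

locale finite_matrix_group =
  fixes Q :: "(complex^'n^'n) set"
  assumes fin: "finite Q" and one: "mat 1 \<in> Q"
    and mult: "A \<in> Q \<Longrightarrow> B \<in> Q \<Longrightarrow> A ** B \<in> Q"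
    and inverse_ex: "A \<in> Q \<Longrightarrow> \<exists>B\<in>Q. A ** B = mat 1"
begin

lemma inv_right: "A ** matrix_inv A = mat 1" and inv_left: "matrix_inv A ** A = mat 1"
  and inv_in: "matrix_inv A \<in> Q" if A: "A \<in> Q"
proof -
  obtain B where B: "B \<in> Q" "A ** B = mat 1" using inverse_ex[OF A] by blast
  then have "B ** A = mat 1" using matrix_left_right_inverse by blast
  have "matrix_inv A = B" using B(2) by (rule matrix_inv_eq)
  with B \<open>B ** A = mat 1\<close> show "A ** matrix_inv A = mat 1" "matrix_inv A ** A = mat 1" "matrix_inv A \<in> Q"
    by auto
qed

lemma cancel_left: "A \<in> Q \<Longrightarrow> A ** X = A ** Y \<Longrightarrow> X = Y"
  by (metis inv_left matrix_mul_assoc matrix_mul_lid)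

lemma mpow_in: "A \<in> Q \<Longrightarrow> mpow A k \<in> Q"
  by (induction k) (auto intro: one mult)

lemma finite_order: 
  assumes A: "A \<in> Q" obtains m where "m > 0" "mpow A m = mat 1"
proof -
  have "\<not> inj (mpow A)"
    using finite_imageD[of "mpow A" UNIV] mpow_in[OF A] fin
    by (metis finite_subset image_subsetI infinite_UNIV_nat)
  then obtain i j where ij: "mpow A i = mpow A j" "i < j"
    unfolding inj_def by (metis linorder_neqE_nat)
  then have "mpow A i ** mpow A (j - i) = mpow A i ** mat 1"
    by (subst mpow_add[symmetric]) simp
  then have "mpow A (j - i) = mat 1" using cancel_left[OF mpow_in[OF A]] by blast
  then show thesis using that[of "j - i"] ij by auto
qed

text \<open>Weyl's averaging: \<open>N\<close> is the norm of the hermitian form \<open>h\<close>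
  summed over \<open>Q\<close>, and every element of \<open>Q\<close> is an isometry of it.\<close>

definition N :: "complex^'n \<Rightarrow> real" where
  "N x = L2_set (\<lambda>q. norm (q *v x)) Q"

definition h :: "complex^'n \<Rightarrow> complex^'n \<Rightarrow> complex" where
  "h x y = (\<Sum>q\<in>Q. herm (q *v x) (q *v y))"

lemma N_nonneg [simp]: "N x \<ge> 0" by (simp add: N_def)

lemma N_sq: "(N x)\<^sup>2 = Re (h x x)"
  by (simp add: N_def h_def L2_set_def sum_nonneg herm_self)

lemma N_triangle: "N (x + y) \<le> N x + N y"
proof -
  have "N (x + y) \<le> L2_set (\<lambda>q. norm (q *v x) + norm (q *v y)) Q"
    unfolding N_def by (intro L2_set_mono) (auto simp: matrix_vector_right_distrib norm_triangle_ineq)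
  also have "\<dots> \<le> N x + N y" unfolding N_def by (rule L2_set_triangle_ineq)
  finally show ?thesis .
qed

lemma N_scale: "N (c *s x) = cmod c * N x"
  by (simp add: N_def vec_mult_cscale norm_cscale L2_set_right_distrib)

lemma N_minus: "N (x - y) = N (y - x)"
  by (simp add: N_def matrix_vector_mult_diff_distrib norm_minus_commute)

lemma N_ge_norm: "norm x \<le> N x"
proof -
  have "norm (mat 1 *v x) \<le> N x" unfolding N_def using fin one by (intro member_le_L2_set)
  then show ?thesis by simp
qed

lemma N_le: obtains K where "K > 0" "\<And>x. N x \<le> K * norm x"
proof -
  define K where "K = 1 + (\<Sum>q\<in>Q. (real CARD('n))\<^sup>2 * norm q)"
  have "N x \<le> K * norm x" for x
  proof -
    have "N x \<le> (\<Sum>q\<in>Q. norm (q *v x))" unfolding N_def by (rule L2_set_le_sum) auto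
    also have "\<dots> \<le> (\<Sum>q\<in>Q. (real CARD('n))\<^sup>2 * norm q * norm x)"
      by (intro sum_mono norm_mult_vec_le)
    also have "\<dots> \<le> K * norm x"
      by (simp add: K_def ring_distribs sum_distrib_right)
    finally show ?thesis .
  qed
  moreover have "K > 0" unfolding K_def by (intro add_pos_nonneg sum_nonneg) auto
  ultimately show thesis using that by blast
qed

lemma h_invariant: "h (A *v x) (A *v y) = h x y" if A: "A \<in> Q"
proof -
  have inj: "inj_on (\<lambda>q. q ** A) Q"
    by (rule inj_onI) (metis inv_right[OF A] matrix_mul_assoc matrix_mul_rid)
  have "(\<lambda>q. q ** A) ` Q = Q"
    using inj fin mult[OF _ A] by (intro card_subset_eq) (auto simp: card_image)
  then have "h x y = (\<Sum>q\<in>(\<lambda>q. q ** A) ` Q. herm (q *v x) (q *v y))"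
    by (simp add: h_def)
  also have "\<dots> = h (A *v x) (A *v y)"
    by (simp add: sum.reindex[OF inj] h_def matrix_vector_mul_assoc)
  finally show ?thesis by simp
qed

lemma N_invariant: "A \<in> Q \<Longrightarrow> N (A *v x) = N x"
  by (rule power2_eq_imp_eq) (auto simp: N_sq h_invariant)

lemma h_diff_left: "h (x - y) z = h x z - h y z"
  and h_diff_right: "h z (x - y) = h z x - h z y"
  and h_scale: "h (c *s x) (d *s y) = c * cnj d * h x y"
  by (simp_all add: h_def matrix_vector_mult_diff_distrib herm_diff_left herm_diff_right
      vec_mult_cscale herm_scale_left herm_scale_right sum_subtractf sum_distrib_left mult_ac)

lemma h_commute: "h y x = cnj (h x y)"
  unfolding h_def cnj_sum by (intro sum.cong refl herm_commute)

text \<open>An operator norm bound for the invariant norm. The constant may be 1 or more;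
  \<open>contracts 1\<close> is the closed unit ball.\<close>

definition contracts :: "real \<Rightarrow> complex^'n^'n \<Rightarrow> bool" where
  "contracts c M \<longleftrightarrow> (\<forall>x. N (M *v x) \<le> c * N x)"

text \<open>Two eigenvectors of the isometry \<open>A\<close> with distinct eigenvalues are orthogonal, whereas
  \<open>B\<close> moves no vector to an orthogonal one; so \<open>B\<close> preserves the eigenspaces of \<open>A\<close>.\<close>
lemma frobenius:
  assumes A: "A \<in> Q" and B: "B \<in> Q" and c: "contracts c (B - mat 1)" "c \<le> 1"
    and comm: "A ** (B ** A ** matrix_inv B) = (B ** A ** matrix_inv B) ** A"
  shows "A ** B = B ** A"
proof -
  obtain m where m: "m > 0" "mpow A m = mat 1" using finite_order[OF A] .
  obtain P \<mu> where P: "\<And>x. x = (\<Sum>j<m. P j *v x)" "\<And>j x. A *v (P j *v x) = \<mu> j *s (P j *v x)"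
    "\<And>j B. A ** B = B ** A \<Longrightarrow> P j ** B = B ** P j"
    using eigenspace_projections[OF m(2,1)] by metis
  have eig: "A *v (B *v x) = B *v (A *v x)" if x: "A *v x = l *s x" for x l
  proof -
    define y where "y = B *v x"
    have Py: "A *v (P j *v y) = l *s (P j *v y)" for j
    proof (cases "\<mu> j = l")
      case False
      \<comment> \<open>Since \<open>A\<close> commutes with its conjugate by \<open>B\<close>, the
        component \<open>P j *v y\<close> is still an eigenvector of that conjugate for the value
        \<open>l\<close>. Pulled back by \<open>B\<close> it becomes an eigenvector \<open>z\<close>
        of \<open>A\<close> for \<open>l\<close>, while \<open>B *v z\<close> is one for
        \<open>\<mu> j\<close>.\<close>
      define z where "z = matrix_inv B *v (P j *v y)"
      have Bz: "B *v z = P j *v y"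
        by (simp add: z_def matrix_vector_mul_assoc matrix_mul_assoc inv_right[OF B])
      have "(B ** A ** matrix_inv B) *v (P j *v y) = P j *v ((B ** A ** matrix_inv B) *v y)"
        using P(3)[OF comm, of j] by (simp add: matrix_vector_mul_assoc)
      also have "(B ** A ** matrix_inv B) *v y = l *s y"
      proof -
        have "(B ** A ** matrix_inv B) *v y = (B ** A ** (matrix_inv B ** B)) *v x"
          by (simp add: y_def matrix_vector_mul_assoc matrix_mul_assoc)
        then show ?thesis
          by (simp add: inv_left[OF B] x y_def vec_mult_cscale flip: matrix_vector_mul_assoc)
      qed
      finally have "B *v (A *v z) = B *v (l *s z)"
        unfolding z_def Bz[unfolded z_def]
        by (simp add: matrix_vector_mul_assoc[symmetric] vec_mult_cscale Bz[unfolded z_def])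
      then have Az: "A *v z = l *s z"
        by (metis B inv_left matrix_vector_mul_assoc matrix_vector_mul_lid)
      have ABz: "A *v (B *v z) = \<mu> j *s (B *v z)" by (simp add: Bz P(2))
      have "z = 0"
      proof (rule ccontr)
        assume "z \<noteq> 0"
        then have Nz: "N z > 0" using N_ge_norm[of z] zero_less_norm_iff order_less_le_trans by blast
        have "cmod l * N z = N z" using N_invariant[OF A, of z] by (simp add: Az N_scale)
        then have l1: "cmod l = 1" using Nz by simp
        have "h (B *v z) z = h (A *v (B *v z)) (A *v z)" by (simp add: h_invariant[OF A])
        also have "\<dots> = \<mu> j * cnj l * h (B *v z) z" by (simp add: Az ABz h_scale)
        finally have "(l - \<mu> j * (l * cnj l)) * h (B *v z) z = 0"
          by (simp add: algebra_simps)
        moreover have "l * cnj l = 1" using l1 complex_norm_square[of l] by simp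
        ultimately have h0: "h (B *v z) z = 0" using False by auto
        then have "h z (B *v z) = 0" by (simp add: h_commute[of z])
        with h0 have "(N (B *v z - z))\<^sup>2 = 2 * (N z)\<^sup>2"
          by (simp add: N_sq h_diff_left h_diff_right h_invariant[OF B])
        moreover have "N (B *v z - z) \<le> N z"
        proof -
          have "N ((B - mat 1) *v z) \<le> c * N z" using c by (simp add: contracts_def)
          also have "\<dots> \<le> 1 * N z" using c(2) by (intro mult_right_mono) auto
          finally show ?thesis by (simp add: matrix_vector_mult_diff_rdistrib)
        qed
        then have "(N (B *v z - z))\<^sup>2 \<le> (N z)\<^sup>2" by (intro power_mono) auto
        ultimately show False using Nz by simp
      qed
      then show ?thesis by (simp flip: Bz)
    qed (use P(2) in simp)
    have "A *v y = (\<Sum>j<m. A *v (P j *v y))" by (subst P(1)) (simp add: vec_mult_sum)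
    also have "\<dots> = l *s y" by (simp add: Py flip: vec_cscale_sum P(1))
    finally show ?thesis by (simp add: y_def x vec_mult_cscale)
  qed
  have "A *v (B *v x) = B *v (A *v x)" for x
  proof -
    have "A *v (B *v x) = (\<Sum>j<m. A *v (B *v (P j *v x)))" by (subst P(1)[of x]) (simp add: vec_mult_sum)
    also have "\<dots> = (\<Sum>j<m. B *v (A *v (P j *v x)))" using eig[OF P(2)] by simp
    also have "\<dots> = B *v (A *v x)" by (subst (2) P(1)[of x]) (simp add: vec_mult_sum)
    finally show ?thesis .
  qed
  then show ?thesis by (simp add: matrix_eq flip: matrix_vector_mul_assoc)
qed

text \<open>\<open>A B - B A\<close> equals \<open>(A - 1) (B - 1) - (B - 1) (A - 1)\<close>, and
  the inverse factors are isometries; so the distance of the commutator to the identity is bounded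
  by twice the product of the two distances.\<close>

lemma contracts_commutator:
  assumes A: "A \<in> Q" and B: "B \<in> Q" and a: "contracts a (A - mat 1)" and b: "contracts b (B - mat 1)"
    and "a \<ge> 0" "b \<ge> 0"
  shows "contracts (2 * a * b) (A ** B ** matrix_inv A ** matrix_inv B - mat 1)"
  unfolding contracts_def
proof
  fix x
  define y where "y = matrix_inv A *v (matrix_inv B *v x)"
  have Ny: "N y = N x" using A B by (simp add: y_def N_invariant inv_in)
  have xy: "x = B *v (A *v y)"
  proof -
    have "A *v y = matrix_inv B *v x"
      by (simp add: y_def matrix_vector_mul_assoc matrix_mul_assoc inv_right A)
    then show ?thesis by (simp add: matrix_vector_mul_assoc inv_right B)
  qed
  have "(A ** B ** matrix_inv A ** matrix_inv B - mat 1) *v x = A *v (B *v y) - B *v (A *v y)"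
    using xy by (simp add: y_def matrix_vector_mult_diff_rdistrib matrix_vector_mul_assoc matrix_mul_assoc)
  also have "\<dots> = (A - mat 1) *v ((B - mat 1) *v y) - (B - mat 1) *v ((A - mat 1) *v y)"
    by (simp add: matrix_vector_mult_diff_rdistrib matrix_vector_mult_diff_distrib algebra_simps)
  finally have eq: "(A ** B ** matrix_inv A ** matrix_inv B - mat 1) *v x =
    (A - mat 1) *v ((B - mat 1) *v y) + (-1) *s ((B - mat 1) *v ((A - mat 1) *v y))" by simp
  have "N ((A - mat 1) *v ((B - mat 1) *v y)) \<le> a * (b * N y)"
    using a b assms unfolding contracts_def by (meson mult_left_mono order_trans)
  moreover have "N ((B - mat 1) *v ((A - mat 1) *v y)) \<le> b * (a * N y)"
    using a b assms unfolding contracts_def by (meson mult_left_mono order_trans)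
  ultimately show "N ((A ** B ** matrix_inv A ** matrix_inv B - mat 1) *v x) \<le> 2 * a * b * N x"
    unfolding eq using N_triangle[of "(A - mat 1) *v ((B - mat 1) *v y)" "(-1) *s ((B - mat 1) *v ((A - mat 1) *v y))"]
      N_scale[of "-1" "(B - mat 1) *v ((A - mat 1) *v y)"]
    by (simp add: Ny mult_ac del: vector_sneg_minus1)
qed

text \<open>The iterated commutators \<open>C k\<close> of \<open>B\<close> with \<open>A\<close>
  approach the identity, the bound being multiplied by \<open>2 * (1/4) = 1/2\<close> each time. A
  finite group contains no arbitrarily small nontrivial elements, so the sequence reaches the
  identity; \<open>frobenius\<close> then lets the triviality of \<open>C k\<close> descend to
  smaller \<open>k\<close>.\<close>

lemma near_identity_commute:
  assumes A: "A \<in> Q" and B: "B \<in> Q" and a: "contracts (1/4) (A - mat 1)" and b: "contracts (1/4) (B - mat 1)"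
  shows "A ** B = B ** A"
proof -
  define C where "C = rec_nat B (\<lambda>_ X. A ** X ** matrix_inv A ** matrix_inv X)"
  have C0: "C 0 = B" and CS: "\<And>k. C (Suc k) = A ** C k ** matrix_inv A ** matrix_inv (C k)"
    by (simp_all add: C_def)
  have CQ: "C k \<in> Q" for k by (induction k) (auto simp: C0 CS intro!: B A mult inv_in)
  have Cc: "contracts ((1/4) * (1/2) ^ k) (C k - mat 1)" for k
  proof (induction k)
    case (Suc k)
    show ?case using contracts_commutator[OF A CQ a Suc] by (simp add: CS)
  qed (use b C0 in simp)
  have "\<exists>k. C k = mat 1"
  proof -
    have "finite (range C)" using CQ fin by (meson finite_subset image_subsetI)
    then obtain j where "infinite {k \<in> UNIV. C k = C j}"
      using pigeonhole_infinite[of UNIV C] by auto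
    \<comment> \<open>A value taken infinitely often is closer to the identity than every bound of
      the sequence.\<close>
    then obtain g where g: "infinite {k. C k = g}" by auto
    have "g *v x = x" for x
    proof -
      have "N (g *v x - x) \<le> (1/2) ^ k * N x" for k
      proof -
        obtain k' where k': "k' \<ge> k" "C k' = g" using g unfolding infinite_nat_iff_unbounded_le by auto
        have "N ((g - mat 1) *v x) \<le> (1/4) * (1/2) ^ k' * N x" using Cc[of k'] k' by (simp add: contracts_def)
        also have "\<dots> \<le> 1 * (1/2) ^ k * N x"
          using k' by (intro mult_right_mono mult_mono power_decreasing) auto
        finally show ?thesis by (simp add: matrix_vector_mult_diff_rdistrib)
      qed
      moreover have "(\<lambda>k. (1/2) ^ k * N x) \<longlonglongrightarrow> 0 * N x"
        by (intro tendsto_mult LIMSEQ_realpow_zero tendsto_const) auto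
      ultimately have "N (g *v x - x) \<le> 0" by (intro LIMSEQ_le_const) auto
      then have "norm (g *v x - x) \<le> 0" using N_ge_norm[of "g *v x - x"] by linarith
      then show ?thesis by simp
    qed
    then have "g = mat 1" by (simp add: matrix_eq)
    then show ?thesis using g not_finite_existsD by auto
  qed
  then obtain k where "C k = mat 1" by blast
  \<comment> \<open>Induction on the index at which the commutator becomes trivial: if
    \<open>C (Suc k)\<close> is the identity, then \<open>A\<close> commutes with
    \<open>C k\<close>, and for \<open>k > 0\<close> this is shown to force \<open>C k\<close>
    itself to be the identity.\<close>
  then show ?thesis
  proof (induction k)
    case (Suc k)
    have com: "A ** C k = C k ** A"
    proof -
      have "A ** C k ** matrix_inv A ** (matrix_inv (C k) ** C k) = C k"
        using Suc.prems by (simp add: CS matrix_mul_assoc)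
      then have "A ** C k ** (matrix_inv A ** A) = C k ** A"
        by (simp add: inv_left CQ matrix_mul_assoc)
      then show ?thesis by (simp add: inv_left A)
    qed
    show ?case
    proof (cases k)
      case 0
      then show ?thesis using com by (simp add: C0)
    next
      case (Suc j)
      \<comment> \<open>\<open>C k\<close> is \<open>A ** X\<close>. As \<open>A\<close> commutes
        with \<open>C k\<close>, it commutes with \<open>X\<close> and with the inverse
        \<open>X'\<close>, the conjugate of \<open>A\<close> by \<open>C j\<close>; this is the
        hypothesis of \<open>frobenius\<close>.\<close>
      define X where "X = C j ** matrix_inv A ** matrix_inv (C j)"
      define X' where "X' = C j ** A ** matrix_inv (C j)"
      have XX': "X ** X' = mat 1" "X' ** X = mat 1"
      proof -
        have "X ** X' = C j ** matrix_inv A ** (matrix_inv (C j) ** C j) ** A ** matrix_inv (C j)"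
          by (simp add: X_def X'_def matrix_mul_assoc)
        also have "\<dots> = C j ** (matrix_inv A ** A) ** matrix_inv (C j)"
          by (simp add: inv_left CQ matrix_mul_assoc)
        finally show "X ** X' = mat 1" by (simp add: inv_left inv_right A CQ)
        then show "X' ** X = mat 1" using matrix_left_right_inverse by blast
      qed
      have "A ** (A ** X) = (A ** X) ** A"
        using com by (simp add: Suc CS X_def matrix_mul_assoc)
      then have AX: "A ** X = X ** A"
        using cancel_left[OF A, of "A ** X" "X ** A"] by (simp add: matrix_mul_assoc)
      have "A ** X' = X' ** (X ** A) ** X'" by (simp add: matrix_mul_assoc XX')
      also have "\<dots> = X' ** A ** (X ** X')" by (simp add: matrix_mul_assoc flip: AX)
      also have "\<dots> = X' ** A" by (simp add: XX')
      finally have "A ** X' = X' ** A" .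
      moreover have "(1/4) * (1/2) ^ j \<le> (1::real)"
        by (rule order_trans[OF mult_mono[of "1/4" 1 _ 1]]) (auto simp: power_le_one)
      ultimately have AC: "A ** C j = C j ** A"
        using frobenius[OF A CQ Cc[of j]] by (simp add: X'_def)
      have "C j ** (A ** matrix_inv A) ** matrix_inv (C j) = mat 1"
        by (simp add: inv_right A CQ)
      then have "C k = mat 1" by (simp add: Suc CS AC matrix_mul_assoc)
      then show ?thesis by (rule Suc.IH)
    qed
  qed (simp add: C0)
qed

text \<open>A packing estimate for the operator norm of \<open>N\<close>: balls of radius 1/8 around
  the elements of \<open>F\<close> are disjoint, since the centres are more than 1/4 apart, and they
  lie in the ball of radius 2, since isometries have norm at most one. The norm depends on
  \<open>Q\<close>, but the volume ratio \<open>(2 / (1/8)) ^ d\<close> depends on the dimension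
  alone.\<close>

lemma separated_card:
  assumes F: "F \<subseteq> Q" and sep: "\<And>A B. A \<in> F \<Longrightarrow> B \<in> F \<Longrightarrow> A \<noteq> B \<Longrightarrow> \<not> contracts (1/4) (A - B)"
  shows "card F \<le> 16 ^ DIM(complex^'n^'n)"
proof -
  define U where "U = {M. contracts 1 M}"
  obtain K where K: "K > 0" "\<And>x. N x \<le> K * norm x" using N_le by blast
  have contN: "continuous_on UNIV N"
  proof -
    have "\<bar>N x - N y\<bar> \<le> K * norm (x - y)" for x y
      using N_triangle[of "x - y" y] N_triangle[of "y - x" x] K(2)[of "x - y"] N_minus[of x y] by simp
    then have "K-lipschitz_on UNIV N"
      using K by (auto simp: lipschitz_on_def dist_norm)
    then show ?thesis by (rule lipschitz_on_continuous_on)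
  qed
  have "closed U"
  proof -
    have cont: "continuous_on UNIV (\<lambda>M::complex^'n^'n. N (M *v x))" for x
    proof -
      have "linear (\<lambda>M::complex^'n^'n. M *v x)"
        by (rule linearI)
          (auto simp: matrix_vector_mult_def vec_eq_iff scaleR_sum_right sum.distrib algebra_simps)
      then have "continuous_on UNIV (\<lambda>M::complex^'n^'n. M *v x)" by (rule linear_continuous_on[OF linear_conv_bounded_linear[THEN iffD1]])
      from continuous_on_compose2[OF contN this] show ?thesis by auto
    qed
    have "U = (\<Inter>x. {M. N (M *v x) \<le> N x})" by (auto simp: U_def contracts_def)
    then show ?thesis using cont by (auto intro!: closed_INT closed_Collect_le)
  qed
  have "bounded U"
  proof -
    have "norm M \<le> (\<Sum>i\<in>(UNIV::'n set). \<Sum>j\<in>(UNIV::'n set). K * norm (axis j 1 :: complex^'n))" if M: "M \<in> U" for M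
    proof -
      have "norm M \<le> (\<Sum>i\<in>UNIV. \<Sum>j\<in>UNIV. norm (M $ i $ j))"
        by (rule order_trans[OF norm_vec_le_sum]) (intro sum_mono norm_vec_le_sum)
      also have "\<dots> \<le> (\<Sum>i\<in>(UNIV::'n set). \<Sum>j\<in>(UNIV::'n set). K * norm (axis j 1 :: complex^'n))"
      proof (intro sum_mono)
        fix i j
        have "norm (M $ i $ j) = norm ((M *v axis j 1) $ i)"
          by (simp add: mult_axis)
        also have "\<dots> \<le> norm (M *v axis j 1)" by (rule Finite_Cartesian_Product.norm_nth_le)
        also have "\<dots> \<le> N (M *v axis j 1)" by (rule N_ge_norm)
        also have "\<dots> \<le> N (axis j 1)" using M by (simp add: U_def contracts_def)
        also have "\<dots> \<le> K * norm (axis j 1 :: complex^'n)" by (rule K(2))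
        finally show "norm (M $ i $ j) \<le> K * norm (axis j 1 :: complex^'n)" .
      qed
      finally show ?thesis .
    qed
    then show ?thesis unfolding bounded_iff by blast
  qed
  have lm: "U \<in> lmeasurable"
    using \<open>closed U\<close> \<open>bounded U\<close> by (intro lmeasurable_compact) (simp add: compact_eq_bounded_closed)
  define d where "d = DIM(complex^'n^'n)"
  have pos: "measure lebesgue U > 0"
  proof -
    \<comment> \<open>Chosen so that \<open>K * (real CARD('n))\<^sup>2 * e = 1\<close>: a small
      enough euclidean ball lies in the unit ball of the operator norm, which therefore has positive
      volume.\<close>
    define e where "e = 1 / (K * (real CARD('n))\<^sup>2)"
    have e: "e > 0" using K by (simp add: e_def)
    have "ball 0 e \<subseteq> U"
    proof
      fix M :: "complex^'n^'n" assume "M \<in> ball 0 e"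
      then have M: "norm M \<le> e" by simp
      have "N (M *v x) \<le> N x" for x
      proof -
        have "N (M *v x) \<le> K * norm (M *v x)" by (rule K(2))
        also have "\<dots> \<le> K * ((real CARD('n))\<^sup>2 * norm M * norm x)"
          using K by (intro mult_left_mono norm_mult_vec_le) auto
        also have "\<dots> \<le> K * ((real CARD('n))\<^sup>2 * e * norm x)"
          using K M by (intro mult_left_mono mult_right_mono) auto
        also have "\<dots> = norm x" using K by (simp add: e_def)
        also have "\<dots> \<le> N x" by (rule N_ge_norm)
        finally show ?thesis .
      qed
      then show "M \<in> U" by (simp add: U_def contracts_def)
    qed
    then have "\<not> negligible U" using e
      by (meson negligible_subset open_ball open_not_negligible ball_eq_empty not_le)
    then show ?thesis using lm
      by (metis negligible_iff_measure order_le_less zero_less_measure_iff)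
  qed
  have fF: "finite F" using F fin finite_subset by blast
  define T where "T M = (\<lambda>X. (1/8) *\<^sub>R X + M) ` U" for M
  have Tm: "T M \<in> lmeasurable" for M
  proof -
    have "T M = (+) M ` ((\<lambda>X. (1/8) *\<^sub>R X) ` U)" by (auto simp: T_def image_image add.commute)
    then show ?thesis using lm by (metis measurable_translation lmeasurable_compact compact_scaling
        \<open>closed U\<close> \<open>bounded U\<close> compact_eq_bounded_closed)
  qed
  have mT: "measure lebesgue (T M) = (1/8) ^ d * measure lebesgue U" for M
    using measure_lebesgue_affine[of "1/8" M U] by (simp add: T_def d_def power_one_over add.commute)
  have cv: "X *v x = (c::real) *\<^sub>R (Y *v x) \<Longrightarrow> contracts 1 Y \<Longrightarrow> c \<ge> 0 \<Longrightarrow> N (X *v x) \<le> c * N x" for X Y c x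
  proof -
    assume a: "X *v x = c *\<^sub>R (Y *v x)" "contracts 1 Y" "c \<ge> 0"
    have "c *\<^sub>R (Y *v x) = of_real c *s (Y *v x)" by (simp add: vec_eq_iff) (simp add: scaleR_conv_of_real)
    then have "N (X *v x) = c * N (Y *v x)" using a by (simp add: N_scale)
    then show ?thesis using a by (simp add: contracts_def mult_left_mono)
  qed
  have scl: "((c::real) *\<^sub>R X) *v x = c *\<^sub>R (X *v x)" for c X and x :: "complex^'n"
    by (simp add: matrix_vector_mult_def vec_eq_iff scaleR_sum_right)
  have disj: "disjoint_family_on T F"
    unfolding disjoint_family_on_def
  proof (intro ballI impI)
    fix A B assume AB: "A \<in> F" "B \<in> F" "A \<noteq> B"
    show "T A \<inter> T B = {}"
    proof (rule ccontr)
      assume "T A \<inter> T B \<noteq> {}"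
      then obtain X Y where XY: "X \<in> U" "Y \<in> U" "(1/8) *\<^sub>R X + A = (1/8) *\<^sub>R Y + B"
        by (auto simp: T_def)
      then have AB': "A - B = (1/8) *\<^sub>R Y + (-1/8) *\<^sub>R X" by (simp add: algebra_simps)
      have "contracts (1/4) (A - B)"
        unfolding contracts_def
      proof
        fix x
        have "(A - B) *v x = ((1/8) *\<^sub>R Y) *v x + (-1) *s (((1/8) *\<^sub>R X) *v x)"
          by (simp add: AB' matrix_vector_mult_diff_rdistrib scl)
        then have "N ((A - B) *v x) \<le> N (((1/8) *\<^sub>R Y) *v x) + N (((1/8) *\<^sub>R X) *v x)"
          using N_triangle[of "((1/8) *\<^sub>R Y) *v x" "(-1) *s (((1/8) *\<^sub>R X) *v x)"]
            N_scale[of "-1" "((1/8) *\<^sub>R X) *v x"] by (simp del: vector_sneg_minus1)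
        also have "\<dots> \<le> (1/8) * N x + (1/8) * N x"
          using XY cv[OF scl, of Y "1/8" x] cv[OF scl, of X "1/8" x] by (simp add: U_def)
        finally show "N ((A - B) *v x) \<le> (1/4) * N x" by simp
      qed
      then show False using sep AB by blast
    qed
  qed
  have sub: "(\<Union>M\<in>F. T M) \<subseteq> (\<lambda>X. 2 *\<^sub>R X + 0) ` U"
  proof
    fix Z assume "Z \<in> (\<Union>M\<in>F. T M)"
    then obtain M X where M: "M \<in> F" "X \<in> U" "Z = (1/8) *\<^sub>R X + M" by (auto simp: T_def)
    have "contracts 1 ((1/2) *\<^sub>R Z)"
      unfolding contracts_def
    proof
      fix x
      have "((1/2) *\<^sub>R Z) *v x = (((1/16) *\<^sub>R X) *v x) + (((1/2) *\<^sub>R M) *v x)"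
        by (simp add: M(3) scl matrix_vector_mult_add_rdistrib algebra_simps)
      then have "N (((1/2) *\<^sub>R Z) *v x) \<le> N (((1/16) *\<^sub>R X) *v x) + N (((1/2) *\<^sub>R M) *v x)"
        using N_triangle by metis
      also have "\<dots> \<le> (1/16) * N x + (1/2) * N x"
      proof (intro add_mono cv[OF scl])
        show "contracts 1 X" using M by (simp add: U_def)
        show "contracts 1 M" using M F by (auto simp: contracts_def N_invariant)
      qed auto
      finally show "N (((1/2) *\<^sub>R Z) *v x) \<le> 1 * N x" using N_nonneg[of x] by linarith
    qed
    then have "(1/2) *\<^sub>R Z \<in> U" by (simp add: U_def)
    then show "Z \<in> (\<lambda>X. 2 *\<^sub>R X + 0) ` U" by (intro image_eqI[of _ _ "(1/2) *\<^sub>R Z"]) auto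
  qed
  have "real (card F) * ((1/8) ^ d * measure lebesgue U) = (\<Sum>M\<in>F. measure lebesgue (T M))"
    by (simp add: mT)
  also have "\<dots> = measure lebesgue (\<Union>M\<in>F. T M)"
    using fF disj Tm by (intro measure_UNION'[symmetric]) (auto simp: disjoint_family_on_def pairwise_def disjnt_def)
  also have "\<dots> \<le> measure lebesgue ((\<lambda>X. 2 *\<^sub>R X + 0) ` U)"
  proof (rule measure_mono_fmeasurable[OF sub])
    show "(\<Union>M\<in>F. T M) \<in> sets lebesgue" using Tm fF by (intro sets.finite_UN) auto
    show "(\<lambda>X. 2 *\<^sub>R X + 0) ` U \<in> lmeasurable"
      using lmeasurable_compact[OF compact_scaling[of U 2]] \<open>closed U\<close> \<open>bounded U\<close>
      by (simp add: compact_eq_bounded_closed)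
  qed
  also have "\<dots> = 2 ^ d * measure lebesgue U"
    using measure_lebesgue_affine[of 2 0 U] by (simp add: d_def)
  finally have "real (card F) * (1/8) ^ d \<le> 2 ^ d" using pos by simp
  then have "real (card F) \<le> 2 ^ d * 8 ^ d" by (simp add: power_one_over field_simps)
  also have "\<dots> = 16 ^ d" by (simp flip: power_mult_distrib)
  finally have "real (card F) \<le> real (16 ^ d)" by simp
  then show ?thesis unfolding d_def of_nat_le_iff .
qed

text \<open>\<open>S\<close> consists of the elements near the identity. Multiplication by an
  isometry preserves distances, so elements that are incongruent modulo \<open>S\<close> are
  separated and the packing bound applies to them.\<close>

theorem jordan:
  obtains S where "S \<subseteq> Q" "\<And>A B. A \<in> S \<Longrightarrow> B \<in> S \<Longrightarrow> A ** B = B ** A" "mat 1 \<in> S"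
    "\<And>F. F \<subseteq> Q \<Longrightarrow> (\<And>A B. A \<in> F \<Longrightarrow> B \<in> F \<Longrightarrow> A \<noteq> B \<Longrightarrow> matrix_inv A ** B \<notin> S)
      \<Longrightarrow> card F \<le> 16 ^ DIM(complex^'n^'n)"
proof (rule that)
  define S where "S = {A\<in>Q. contracts (1/4) (A - mat 1)}"
  show "S \<subseteq> Q" by (auto simp: S_def)
  show "A ** B = B ** A" if "A \<in> S" "B \<in> S" for A B
    using near_identity_commute that by (auto simp: S_def)
  show "mat 1 \<in> S" using one by (simp add: S_def contracts_def N_def L2_set_def sum_nonneg)
  fix F assume F: "F \<subseteq> Q" and sep: "\<And>A B. A \<in> F \<Longrightarrow> B \<in> F \<Longrightarrow> A \<noteq> B \<Longrightarrow> matrix_inv A ** B \<notin> S"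
  show "card F \<le> 16 ^ DIM(complex^'n^'n)"
  proof (rule separated_card[OF F])
    fix A B assume AB: "A \<in> F" "B \<in> F" "A \<noteq> B"
    show "\<not> contracts (1/4) (A - B)"
    proof
      assume c: "contracts (1/4) (A - B)"
      have AQ: "A \<in> Q" "B \<in> Q" using AB F by auto
      have "contracts (1/4) (matrix_inv B ** A - mat 1)"
        unfolding contracts_def
      proof
        fix x
        have "(matrix_inv B ** A - mat 1) *v x = matrix_inv B *v ((A - B) *v x)"
          by (simp add: matrix_vector_mult_diff_rdistrib matrix_vector_mult_diff_distrib
              matrix_vector_mul_assoc inv_left AQ)
        then show "N ((matrix_inv B ** A - mat 1) *v x) \<le> (1/4) * N x"
          using c AQ by (simp add: N_invariant inv_in contracts_def)
      qed
      then show False using sep[OF AB(2,1)] AB AQ by (auto simp: S_def mult inv_in)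
    qed
  qed
qed

end

section \<open>Roots of invertible complex matrices\<close>

definition mpoly :: "complex poly \<Rightarrow> complex^'n^'n \<Rightarrow> complex^'n^'n" where
  "mpoly p A = (\<Sum>i\<le>degree p. mat (coeff p i) ** mpow A i)"

lemma mpoly_altdef:
  assumes "degree p \<le> n" shows "mpoly p A = (\<Sum>i\<le>n. mat (coeff p i) ** mpow A i)"
  unfolding mpoly_def
  by (rule sum.mono_neutral_left) (use assms in \<open>auto simp: coeff_eq_0 not_le mat_0\<close>)

lemma mat_plus: "mat (a + b) = mat a + (mat b :: complex^'n^'n)"
  by (simp add: mat_def vec_eq_iff)

lemma mat_times: "mat (a * b) = mat a ** (mat b :: complex^'n^'n)"
  by (simp add: matrix_eq mat_mult_vec flip: matrix_vector_mul_assoc)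

lemma matrix_add_right_distrib: "(A + B) ** C = A ** C + B ** C" for A :: "complex^'n^'n"
  by (simp add: matrix_matrix_mult_def vec_eq_iff sum.distrib algebra_simps)

lemma mpoly_0 [simp]: "mpoly 0 A = 0"
  by (simp add: mpoly_def mat_0)

lemma mpoly_add: "mpoly (p + q) A = mpoly p A + mpoly q A"
proof -
  define n where "n = max (degree p) (degree q)"
  have "degree (p + q) \<le> n" "degree p \<le> n" "degree q \<le> n"
    by (auto simp: n_def intro: degree_add_le)
  then show ?thesis
    by (simp add: mpoly_altdef[where n = n] mat_plus matrix_add_right_distrib sum.distrib)
qed

lemma mpoly_pCons: "mpoly (pCons a p) A = mat a + A ** mpoly p A"
proof -
  have "mpoly (pCons a p) A = (\<Sum>i\<le>Suc (degree p). mat (coeff (pCons a p) i) ** mpow A i)"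
    by (rule mpoly_altdef) (simp add: degree_pCons_le)
  also have "\<dots> = mat a + (\<Sum>i\<le>degree p. mat (coeff p i) ** (A ** mpow A i))"
    by (subst sum.atMost_Suc_shift) simp
  also have "(\<Sum>i\<le>degree p. mat (coeff p i) ** (A ** mpow A i)) = A ** mpoly p A"
    unfolding mpoly_def matrix_sum_right by (simp add: matrix_mul_assoc mat_commute[of _ A])
  finally show ?thesis .
qed

lemma mpoly_smult: "mpoly (smult c p) A = mat c ** mpoly p A"
  by (induction p)
    (auto simp: mpoly_pCons mat_times matrix_add_ldistrib matrix_mul_assoc mat_commute[of c A])

lemma mpoly_mult: "mpoly (p * q) A = mpoly p A ** mpoly q A"
  by (induction p) (auto simp: mpoly_add mpoly_smult mpoly_pCons matrix_add_right_distrib mat_0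
      simp flip: matrix_mul_assoc)

lemma mpoly_one: "mpoly 1 A = mat 1"
  by (simp add: one_pCons mpoly_pCons)

lemma mpoly_power: "mpoly (p ^ k) A = mpow (mpoly p A) k"
  by (induction k) (auto simp: mpoly_one mpoly_mult)

lemma mpoly_commute:
  assumes "A ** B = B ** A" shows "mpoly p A ** B = B ** mpoly p A"
proof (induction p)
  case (pCons a p)
  have "A ** mpoly p A ** B = B ** (A ** mpoly p A)"
    by (metis assms pCons.IH matrix_mul_assoc)
  then show ?case
    by (simp add: mpoly_pCons matrix_add_right_distrib matrix_add_ldistrib mat_commute[of a B])
qed simp

text \<open>One power more than the real dimension of the matrix space must be linearly dependent.
  Dependence is a property of the set of powers, which says nothing about a coincidence of two of
  them; hence the case distinction on injectivity.\<close>

lemma annihilating_poly: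
  fixes A :: "complex^'n^'n"
  obtains p where "p \<noteq> 0" "mpoly p A = 0"
proof -
  define d where "d = DIM(complex^'n^'n)"
  show thesis
  proof (cases "inj_on (mpow A) {..d}")
    case False
    then obtain i j where ij: "mpow A i = mpow A j" "i \<noteq> j" unfolding inj_on_def by blast
    define p :: "complex poly" where "p = monom 1 i + smult (-1) (monom 1 j)"
    have "coeff p i = 1" using ij by (simp add: p_def)
    then have "p \<noteq> 0" by auto
    have x: "mpoly [:0, 1:] A = A" by (simp add: mpoly_pCons mat_0)
    have "mpoly (monom 1 k) A = mpow A k" for k
      by (simp add: monom_altdef mpoly_power x)
    then have "mpoly p A = mpow A i + mat (-1) ** mpow A j"
      by (simp add: p_def mpoly_add mpoly_smult del: smult_minus_left)
    also have "mat (-1) ** mpow A j = - mpow A j"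
      by (simp add: matrix_eq mat_mult_vec flip: matrix_vector_mul_assoc)
        (simp add: vec_eq_iff matrix_vector_mult_def sum_negf)
    finally show thesis using that[OF \<open>p \<noteq> 0\<close>] ij by simp
  next
    case True
    then have "card (mpow A ` {..d}) > d" by (simp add: card_image)
    then have "dependent (mpow A ` {..d})"
      unfolding d_def by (intro dependent_biggerset) auto
    then obtain u v where u: "v \<in> mpow A ` {..d}" "u v \<noteq> 0" "(\<Sum>v\<in>mpow A ` {..d}. u v *\<^sub>R v) = 0"
      by (auto simp: dependent_finite)
    have s: "(\<Sum>i\<le>d. u (mpow A i) *\<^sub>R mpow A i) = 0"
      using u(3) True by (simp add: sum.reindex)
    define p where "p = (\<Sum>i\<le>d. monom (complex_of_real (u (mpow A i))) i)"
    have c: "coeff p i = (if i \<le> d then of_real (u (mpow A i)) else 0)" for i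
      by (simp add: p_def coeff_sum if_distrib cong: if_cong)
    obtain i where "i \<le> d" "v = mpow A i" using u by auto
    then have "coeff p i \<noteq> 0" using u c by simp
    then have "p \<noteq> 0" by auto
    have "degree p \<le> d" by (rule degree_le) (simp add: c)
    then have "mpoly p A = (\<Sum>i\<le>d. mat (of_real (u (mpow A i))) ** mpow A i)"
      by (simp add: mpoly_altdef c)
    also have "\<dots> = (\<Sum>i\<le>d. u (mpow A i) *\<^sub>R mpow A i)"
    proof (rule sum.cong)
      fix i
      have "(mat (of_real r) ** B) *v x = (r *\<^sub>R B) *v x" for r and B :: "complex^'n^'n" and x
        by (simp add: mat_mult_vec flip: matrix_vector_mul_assoc)
          (simp add: vec_eq_iff matrix_vector_mult_def sum_distrib_left mult_ac,
            simp add: scaleR_conv_of_real mult_ac)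
      then show "mat (of_real (u (mpow A i))) ** mpow A i = u (mpow A i) *\<^sub>R mpow A i"
        by (simp add: matrix_eq)
    qed simp
    finally show thesis using s that \<open>p \<noteq> 0\<close> by simp
  qed
qed

lemma complex_root_exists:
  assumes "N > 0" obtains w :: complex where "w ^ N = z"
proof (cases "z = 0")
  case True
  then show thesis using that[of 0] assms by auto
next
  case False
  then show thesis using that[of "exp (ln z / N)"] assms by (simp flip: exp_of_nat_mult)
qed

text \<open>An \<open>N\<close>-th root of \<open>X\<close> modulo \<open>p\<close>, found one
  linear factor at a time in the manner of Hensel and the Chinese remainder theorem. A solution
  \<open>r\<close> modulo \<open>q\<close> is changed to \<open>r + c q\<close>, and the constant
  \<open>c\<close> is chosen so that the new quotient also vanishes at the root
  \<open>l\<close>.\<close>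

lemma poly_root_mod:
  fixes p :: "complex poly"
  assumes N: "N > 0" and "p \<noteq> 0" "poly p 0 \<noteq> 0"
  shows "\<exists>r. p dvd r ^ N - [:0, 1:]"
  using assms(2,3)
proof (induction "degree p" arbitrary: p)
  case 0
  then have "p dvd 1" by (simp add: is_unit_iff_degree)
  then show ?case by (meson dvd_trans one_dvd)
next
  case (Suc d)
  then obtain l where l: "poly p l = 0"
    using fundamental_theorem_of_algebra[of p] by (auto simp: constant_degree)
  then obtain q where q: "p = [:-l, 1:] * q" by (metis dvdE poly_eq_0_iff_dvd)
  have l0: "l \<noteq> 0" using l Suc by auto
  have q0: "q \<noteq> 0" "poly q 0 \<noteq> 0" using Suc q by auto
  have "degree p = Suc (degree q)" using q0 unfolding q by (subst degree_mult_eq) auto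
  then obtain r where "q dvd r ^ N - [:0, 1:]" using Suc q0 by auto
  then obtain s where s: "r ^ N - [:0, 1:] = q * s" by (auto elim: dvdE)
  have key: "\<exists>t. (r + [:c:] * q) ^ N - [:0, 1:] = q * t \<and>
      poly t l = poly s l + c * (\<Sum>i<N. poly (r + [:c:] * q) l ^ i * poly r l ^ (N - Suc i))" for c
  proof -
    define r' where "r' = r + [:c:] * q"
    define t where "t = s + [:c:] * (\<Sum>i<N. r' ^ i * r ^ (N - Suc i))"
    have "r' ^ N - r ^ N = ([:c:] * q) * (\<Sum>i<N. r' ^ i * r ^ (N - Suc i))"
      unfolding power_diff_sumr2 by (simp add: r'_def mult.commute sum_distrib_right flip: mult.assoc)
    then have "r' ^ N - [:0, 1:] = q * t"
      using s by (simp add: t_def algebra_simps)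
    moreover have "poly t l = poly s l + c * (\<Sum>i<N. poly r' l ^ i * poly r l ^ (N - Suc i))"
      by (simp add: t_def poly_sum poly_power)
    ultimately show ?thesis unfolding r'_def by blast
  qed
  have "\<exists>c t. (r + [:c:] * q) ^ N - [:0, 1:] = q * t \<and> poly t l = 0"
  proof (cases "poly q l = 0")
    case True
    have rl: "poly r l ^ N = l"
      using arg_cong[OF s, of "\<lambda>p. poly p l"] True by (simp add: poly_power)
    then have r0: "poly r l \<noteq> 0" using l0 N by auto
    \<comment> \<open>A repeated root: the Newton step, whose denominator is the derivative of
      \<open>r ^ N\<close>. It is nonzero because \<open>l\<close> is nonzero.\<close>
    define c where "c = - poly s l / (of_nat N * poly r l ^ (N - 1))"
    have "(\<Sum>i<N. poly (r + [:c:] * q) l ^ i * poly r l ^ (N - Suc i)) = (\<Sum>i<N. poly r l ^ (N - 1))"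
      using True by (intro sum.cong) (auto simp flip: power_add)
    then have "poly s l + c * (\<Sum>i<N. poly (r + [:c:] * q) l ^ i * poly r l ^ (N - Suc i)) = 0"
      using r0 N by (simp add: c_def)
    then show ?thesis using key[of c] by auto
  next
    case False
    obtain w where w: "w ^ N = l" using complex_root_exists[OF N] by blast
    \<comment> \<open>A new root: the value of \<open>r\<close> at \<open>l\<close> is moved to an
      \<open>N\<close>-th root \<open>w\<close> of \<open>l\<close>.\<close>
    define c where "c = (w - poly r l) / poly q l"
    obtain t where t: "(r + [:c:] * q) ^ N - [:0, 1:] = q * t" using key[of c] by blast
    have "poly (r + [:c:] * q) l = w" using False by (simp add: c_def)
    then have "poly ((r + [:c:] * q) ^ N - [:0, 1:]) l = 0"
      by (simp only: poly_power poly_diff w) (simp add: w)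
    then have "poly t l = 0" using False unfolding t by simp
    then show ?thesis using t by blast
  qed
  then obtain c t where t: "(r + [:c:] * q) ^ N - [:0, 1:] = q * t" "poly t l = 0" by blast
  then obtain t' where "t = [:-l, 1:] * t'" by (metis dvdE poly_eq_0_iff_dvd)
  then have "(r + [:c:] * q) ^ N - [:0, 1:] = p * t'" unfolding t q by (simp only: mult_ac)
  then show ?case by (metis dvd_triv_left)
qed

text \<open>An annihilating polynomial of least degree does not vanish at 0, since otherwise the
  invertible factor \<open>A\<close> could be cancelled. A root of \<open>X\<close> modulo this
  polynomial, evaluated at \<open>A\<close>, is a root of \<open>A\<close>.\<close>

theorem matrix_root:
  fixes A :: "complex^'n^'n"
  assumes N: "N > 0" and A: "invertible A"
  obtains R where "mpow R N = A" "\<And>B. A ** B = B ** A \<Longrightarrow> R ** B = B ** R"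
proof -
  obtain A' where A': "A' ** A = mat 1" using A by (auto simp: invertible_def)
  have "\<exists>p. p \<noteq> 0 \<and> mpoly p A = 0" using annihilating_poly by metis
  then obtain p where p: "p \<noteq> 0" "mpoly p A = 0" "\<And>q. q \<noteq> 0 \<Longrightarrow> mpoly q A = 0 \<Longrightarrow> degree p \<le> degree q"
    using ex_has_least_nat[of "\<lambda>p. p \<noteq> 0 \<and> mpoly p A = 0" _ degree] by metis
  have "poly p 0 \<noteq> 0"
  proof
    assume "poly p 0 = 0"
    then obtain q where q: "p = pCons 0 q" by (cases p) auto
    then have "A ** mpoly q A = 0" using p by (simp add: mpoly_pCons mat_0)
    then have "(A' ** A) ** mpoly q A = 0" by (simp flip: matrix_mul_assoc)
    then have "mpoly q A = 0" by (simp add: A')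
    moreover have "q \<noteq> 0" using q p by auto
    ultimately show False using p(3)[of q] q by simp
  qed
  then obtain r s where r: "r ^ N - [:0, 1:] = p * s" using poly_root_mod[OF N p(1)] by (auto elim: dvdE)
  have "r ^ N = [:0, 1:] + p * s" using r by (simp add: algebra_simps)
  then have "mpow (mpoly r A) N = A"
    by (simp add: mpoly_add mpoly_mult p mpoly_pCons mat_0 flip: mpoly_power)
  then show thesis using that mpoly_commute by blast
qed

section \<open>Integer powers of an invertible matrix\<close>

lemma mpow_inverse:
  assumes "R ** R' = mat 1" shows "mpow R k ** mpow R' k = mat 1"
proof (induction k)
  case (Suc k)
  have "mpow R (Suc k) ** mpow R' (Suc k) = mpow R k ** (R ** R') ** mpow R' k"
    using mpow_commute[of R R k] by (simp add: matrix_mul_assoc)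
  then show ?case by (simp add: assms Suc)
qed simp

lemma integer_matrix_powers:
  fixes R :: "complex^'n^'n"
  assumes R: "R ** R' = mat 1"
  obtains E :: "int \<Rightarrow> complex^'n^'n" where "E 0 = mat 1" "\<And>k l. E (k + l) = E k ** E l"
    "\<And>n. E (int n) = mpow R n" "\<And>X k. R ** X = X ** R \<Longrightarrow> E k ** X = X ** E k"
proof -
  have R': "R' ** R = mat 1" using R matrix_left_right_inverse by blast
  \<comment> \<open>\<open>nat\<close> sends negative integers to 0, so at least one of the two
    factors is the identity.\<close>
  define E where "E k = mpow R (nat k) ** mpow R' (nat (- k))" for k :: int
  have E: "E (int a - int b) = mpow R a ** mpow R' b" for a b
  proof (cases "b \<le> a")
    case True
    then obtain c where a: "a = c + b" by (metis le_add_diff_inverse2)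
    have "mpow R a ** mpow R' b = mpow R c ** (mpow R b ** mpow R' b)" unfolding a by (simp add: mpow_add matrix_mul_assoc)
    then show ?thesis by (simp add: mpow_inverse[OF R] E_def a)
  next
    case False
    then obtain c where b: "b = a + c" by (metis le_add_diff_inverse nat_le_linear)
    have "mpow R a ** mpow R' b = (mpow R a ** mpow R' a) ** mpow R' c" unfolding b by (simp add: mpow_add matrix_mul_assoc)
    then show ?thesis by (simp add: mpow_inverse[OF R] E_def b)
  qed
  have com: "mpow R a ** mpow R' b = mpow R' b ** mpow R a" for a b
  proof -
    have "R' ** R = R ** R'" by (simp add: R R')
    then have "R ** mpow R' b = mpow R' b ** R" by (simp add: mpow_commute)
    then show ?thesis by (rule mpow_commute)
  qed
  have "E (k + l) = E k ** E l" for k l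
  proof -
    have "k + l = int (nat k + nat l) - int (nat (- k) + nat (- l))" by simp
    then have "E (k + l) = mpow R (nat k + nat l) ** mpow R' (nat (- k) + nat (- l))" by (simp only: E)
    also have "\<dots> = mpow R (nat k) ** (mpow R (nat l) ** mpow R' (nat (- k))) ** mpow R' (nat (- l))"
      by (simp add: mpow_add matrix_mul_assoc)
    also have "\<dots> = E k ** E l" unfolding com[of "nat l"] by (simp add: E_def matrix_mul_assoc)
    finally show ?thesis .
  qed
  note add = this
  have "E k ** X = X ** E k" if X: "R ** X = X ** R" for X k
  proof -
    have "R' ** X = R' ** (X ** R) ** R'" by (simp add: R flip: matrix_mul_assoc)
    also have "\<dots> = (R' ** R) ** X ** R'" by (simp only: X[symmetric] matrix_mul_assoc)
    finally have X': "R' ** X = X ** R'" by (simp add: R')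
    have "E k ** X = mpow R (nat k) ** (mpow R' (nat (- k)) ** X)" by (simp add: E_def matrix_mul_assoc)
    also have "\<dots> = (mpow R (nat k) ** X) ** mpow R' (nat (- k))" by (simp only: mpow_commute[OF X'] matrix_mul_assoc)
    also have "\<dots> = X ** E k" by (simp only: mpow_commute[OF X] matrix_mul_assoc E_def)
    finally show ?thesis .
  qed
  from that[of E, OF _ add _ this] show thesis by (simp add: E_def)
qed

section \<open>Functions holomorphic along complex lines\<close>

lemma bounded_linear_cscale: "bounded_linear (\<lambda>t::complex. t *s (v::complex^'n))"
proof -
  have "linear (\<lambda>t::complex. t *s v)"
    by (rule linearI) (auto simp: vec_eq_iff algebra_simps)
  then show ?thesis by (simp add: linear_conv_bounded_linear)
qed

lemma bounded_linear_cscale_right: "bounded_linear (\<lambda>v::complex^'n. (t::complex) *s v)"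
proof -
  have "linear (\<lambda>v::complex^'n. t *s v)"
    by (rule linearI) (auto simp: vec_eq_iff algebra_simps)
  then show ?thesis by (simp add: linear_conv_bounded_linear)
qed

lemmas continuous_on_cscale [continuous_intros] =
  bounded_linear.continuous_on[OF bounded_linear_cscale]
  bounded_linear.continuous_on[OF bounded_linear_cscale_right]

lemma open_line: "open U \<Longrightarrow> open {t. z + t *s (v::complex^'n) \<in> U}"
  using open_vimage[of U "\<lambda>t. z + t *s v", OF _ continuous_on_add[OF continuous_on_const]]
  by (simp add: vimage_def continuous_intros)

text \<open>\<open>holo_on\<close> asks only for a complex derivative at each point and says nothing
  about its continuity. Continuity together with holomorphy on all complex lines is a class that
  one-variable theory shows to be closed under directional derivatives, and it still makes sense at
  the puncture.\<close>

definition lineholo :: "(complex^'n \<Rightarrow> complex) \<Rightarrow> (complex^'n) set \<Rightarrow> bool" where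
  "lineholo H U \<longleftrightarrow> open U \<and> continuous_on U H \<and>
     (\<forall>z v. (\<lambda>t. H (z + t *s v)) holomorphic_on {t. z + t *s v \<in> U})"

definition ddir :: "complex^'n \<Rightarrow> (complex^'n \<Rightarrow> complex) \<Rightarrow> complex^'n \<Rightarrow> complex" where
  "ddir v H z = deriv (\<lambda>t. H (z + t *s v)) 0"

lemma lineholo_line: "lineholo H U \<Longrightarrow> (\<And>t. t \<in> T \<Longrightarrow> z + t *s v \<in> U) \<Longrightarrow> (\<lambda>t. H (z + t *s v)) holomorphic_on T"
  unfolding lineholo_def by (auto intro: holomorphic_on_subset)

lemma deriv_line: "deriv (\<lambda>t. H (z + t *s v)) t = ddir v H (z + t *s v)"
  by (subst deriv_shift_0) (simp add: ddir_def o_def add.assoc vector_sadd_rdistrib)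

lemma higher_deriv_line: "(deriv ^^ k) (\<lambda>t. H (z + t *s v)) = (\<lambda>t. (ddir v ^^ k) H (z + t *s v))"
  by (induction k) (auto simp: deriv_line)

lemma lineholo_has_derivative:
  assumes "lineholo H U" "z + t *s v \<in> U"
  shows "((\<lambda>t. H (z + t *s v)) has_field_derivative ddir v H (z + t *s v)) (at t)"
proof -
  have "(\<lambda>t. H (z + t *s v)) holomorphic_on {t. z + t *s v \<in> U}" "open {t. z + t *s v \<in> U}"
    using assms open_line unfolding lineholo_def by auto
  then have "((\<lambda>t. H (z + t *s v)) has_field_derivative deriv (\<lambda>t. H (z + t *s v)) t) (at t)"
    using assms(2) by (intro holomorphic_derivI) auto
  then show ?thesis by (simp only: deriv_line)
qed

text \<open>Each point of the smaller disc is the centre of a disc of radius \<open>r\<close> inside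
  the larger one, so Cauchy's estimate bounds the second derivative by
  \<open>2 * B / r^2\<close>.\<close>

lemma taylor2:
  assumes hol: "h holomorphic_on S" "open S" "cball w (2 * r) \<subseteq> S" "r > 0"
    and B: "\<And>x. x \<in> cball w (2 * r) \<Longrightarrow> cmod (h x) \<le> B" and z: "cmod (z - w) \<le> r"
  shows "cmod (h z - h w - deriv h w * (z - w)) \<le> 2 * B / r^2 * cmod (z - w)^2"
proof -
  have bd: "cmod ((deriv ^^ 2) h x) \<le> 2 * B / r^2" if x: "x \<in> cball w r" for x
  proof -
    have sub: "cball x r \<subseteq> cball w (2 * r)"
    proof
      fix y assume "y \<in> cball x r"
      then show "y \<in> cball w (2 * r)" using x dist_triangle[of w y x] by simp
    qed
    have "cmod ((deriv ^^ 2) h x) \<le> fact 2 * B / r ^ 2"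
    proof (rule Cauchy_inequality)
      show "h holomorphic_on ball x r"
        using sub hol(3) by (intro holomorphic_on_subset[OF hol(1)]) force
      show "continuous_on (cball x r) h"
        using sub hol(3) by (intro continuous_on_subset[OF holomorphic_on_imp_continuous_on[OF hol(1)]]) force
      show "cmod (h y) \<le> B" if "cmod (x - y) = r" for y
        using sub that by (intro B) (auto simp: dist_norm)
    qed fact
    then show ?thesis by (simp add: numeral_2_eq_2)
  qed
  have "cmod ((deriv ^^ 0) h z - (\<Sum>i\<le>1. (deriv ^^ i) h w * (z-w) ^ i / (fact i)))
      \<le> 2 * B / r^2 * cmod(z - w)^(Suc 1) / fact 1"
  proof (rule complex_Taylor[of "cball w r" 1 "\<lambda>i. (deriv ^^ i) h"])
    fix i x assume x: "x \<in> cball w r"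
    then have "x \<in> S" using hol by force
    then show "((deriv ^^ i) h has_field_derivative (deriv ^^ Suc i) h x) (at x within cball w r)"
      using has_field_derivative_higher_deriv hol(1,2) has_field_derivative_at_within by blast
    show "cmod ((deriv ^^ Suc 1) h x) \<le> 2 * B / r^2" using bd[OF x] by (simp add: numeral_2_eq_2)
  qed (use z \<open>r > 0\<close> in \<open>auto simp: dist_norm norm_minus_commute\<close>)
  then show ?thesis by (simp add: numeral_2_eq_2 algebra_simps)
qed

text \<open>A form of Goursat's theorem. Cauchy's estimate on parallel discs turns the uniform
  continuity of \<open>H\<close> into continuity of the derivative. Along any other direction the
  derivative is a locally uniform limit of difference quotients, each of which is holomorphic
  there.\<close>

lemma lineholo_ddir:
  assumes H: "lineholo H U" shows "lineholo (ddir v H) U"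
  unfolding lineholo_def
proof (intro conjI allI)
  have oU: "open U" and cH: "continuous_on U H" using H by (auto simp: lineholo_def)
  show "open U" by fact
  have radius: "\<exists>r>0. \<exists>\<rho>>0. cball p r \<subseteq> U \<and> (\<forall>q\<in>ball p (r/2). \<forall>t. cmod t \<le> 2 * \<rho> \<longrightarrow> q + t *s v \<in> cball p r)"
    if p: "p \<in> U" for p
  proof -
    obtain r where r: "r > 0" "cball p r \<subseteq> U" using oU p open_contains_cball by blast
    \<comment> \<open>Discs of radius \<open>2 * \<rho>\<close> in direction \<open>v\<close> have
      extent at most \<open>r / 2\<close>; the summand 1 covers \<open>v = 0\<close>.\<close>
    define \<rho> where "\<rho> = r / (4 * (norm v + 1))"
    have n1: "norm v + 1 > 0" by (simp add: add_nonneg_pos)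
    have \<rho>: "\<rho> > 0" using r n1 by (simp add: \<rho>_def)
    have "q + t *s v \<in> cball p r" if q: "q \<in> ball p (r/2)" and t: "cmod t \<le> 2 * \<rho>" for q t
    proof -
      have "norm (t *s v) \<le> 2 * \<rho> * norm v" using t by (simp add: norm_cscale mult_right_mono)
      also have "\<dots> \<le> 2 * \<rho> * (norm v + 1)" using \<rho> by simp
      also have "\<dots> = r / 2" using n1 by (simp add: \<rho>_def field_simps)
      finally have "norm (t *s v) \<le> r / 2" .
      moreover have "norm (p - q) < r/2" using q by (simp add: dist_norm)
      moreover have "norm (p - (q + t *s v)) \<le> norm (p - q) + norm (t *s v)"
        using norm_triangle_ineq4[of "p - q" "t *s v"] by (simp add: algebra_simps)
      ultimately show ?thesis by (simp add: dist_norm)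
    qed
    then show ?thesis using r \<rho> by blast
  qed
  show "continuous_on U (ddir v H)"
    unfolding continuous_on_iff
  proof (intro ballI allI impI)
    fix p and e :: real assume p: "p \<in> U" and e: "0 < e"
    obtain r \<rho> where r: "r > 0" "\<rho> > 0" "cball p r \<subseteq> U"
      "\<And>q t. q \<in> ball p (r/2) \<Longrightarrow> cmod t \<le> 2 * \<rho> \<Longrightarrow> q + t *s v \<in> cball p r" using radius[OF p] by metis
    have "uniformly_continuous_on (cball p r) H"
      using cH r by (intro compact_uniformly_continuous) (auto intro: continuous_on_subset)
    then obtain d where d: "d > 0" "\<And>x y. x \<in> cball p r \<Longrightarrow> y \<in> cball p r \<Longrightarrow> dist x y < d \<Longrightarrow> dist (H x) (H y) < e * \<rho> / 2"
      unfolding uniformly_continuous_on_def using e r(2)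
      by (drule_tac x = "e * \<rho> / 2" in spec) (auto simp: dist_commute)
    have "dist (ddir v H q) (ddir v H p) < e" if q: "dist q p < min d (r/2)" for q
    proof -
      have qp: "q \<in> ball p (r/2)" "p \<in> ball p (r/2)" using q r by (auto simp: dist_commute)
      define f where "f t = H (q + t *s v) - H (p + t *s v)" for t
      have hol: "(\<lambda>t. H (x + t *s v)) holomorphic_on ball 0 (2*\<rho>)" if "x \<in> ball p (r/2)" for x
        using r(3) r(4)[OF that] by (intro lineholo_line[OF H]) auto
      have holf: "f holomorphic_on ball 0 (2 * \<rho>)" unfolding f_def
        by (intro holomorphic_intros hol qp)
      have "cmod ((deriv ^^ 1) f 0) \<le> fact 1 * (e * \<rho> / 2) / \<rho> ^ 1"
      proof (rule Cauchy_inequality)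
        show "f holomorphic_on ball 0 \<rho>" "continuous_on (cball 0 \<rho>) f"
          using holf r(2) by (auto intro!: holomorphic_on_subset[OF holf] continuous_on_subset[OF holomorphic_on_imp_continuous_on[OF holf]])
        fix t assume t: "cmod (0 - t) = \<rho>"
        have "dist (H (q + t *s v)) (H (p + t *s v)) < e * \<rho> / 2"
          using q r t by (intro d(2) r(4) qp) (auto simp: dist_norm)
        then show "cmod (f t) \<le> e * \<rho> / 2" by (simp add: f_def dist_norm)
      qed (use r in auto)
      moreover have "deriv f 0 = ddir v H q - ddir v H p"
        unfolding f_def ddir_def
        using hol[OF qp(1)] hol[OF qp(2)] r(2)
        by (intro deriv_diff) (auto simp: holomorphic_on_imp_differentiable_at)
      ultimately show ?thesis using e r(2) by (simp add: dist_norm)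
    qed
    then show "\<exists>d>0. \<forall>x'\<in>U. dist x' p < d \<longrightarrow> dist (ddir v H x') (ddir v H p) < e"
      using d(1) r(1) by (intro exI[of _ "min d (r/2)"]) auto
  qed
  fix z w
  define T where "T = {t. z + t *s w \<in> U}"
  have oT: "open T" unfolding T_def by (rule open_line[OF oU])
  have "\<exists>D. open D \<and> t0 \<in> D \<and> (\<lambda>t. ddir v H (z + t *s w)) holomorphic_on D" if t0: "t0 \<in> T" for t0
  proof -
    define p where "p = z + t0 *s w"
    have p: "p \<in> U" using t0 by (simp add: p_def T_def)
    obtain r \<rho> where r: "r > 0" "\<rho> > 0" "cball p r \<subseteq> U"
      "\<And>q t. q \<in> ball p (r/2) \<Longrightarrow> cmod t \<le> 2 * \<rho> \<Longrightarrow> q + t *s v \<in> cball p r" using radius[OF p] by metis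
    have "compact (H ` cball p r)" using cH r by (intro compact_continuous_image) (auto intro: continuous_on_subset)
    then have "\<exists>B. \<forall>x\<in>cball p r. cmod (H x) \<le> B"
      using compact_imp_bounded[of "H ` cball p r"] unfolding bounded_iff by simp
    then obtain B where B: "\<And>x. x \<in> cball p r \<Longrightarrow> cmod (H x) \<le> B" by blast
    define D where "D = {t. z + t *s w \<in> ball p (r/2)}"
    have oD: "open D" unfolding D_def by (rule open_line) simp
    have pD: "z + t *s w \<in> ball p (r/2)" if "t \<in> D" for t using that by (simp add: D_def)
    \<comment> \<open>Step sizes of the difference quotients: nonzero, at most \<open>\<rho>\<close>
      and tending to 0.\<close>
    define h :: "nat \<Rightarrow> complex" where "h n = of_real (\<rho> / (real n + 1))" for n
    have h: "h n \<noteq> 0" "cmod (h n) \<le> \<rho>" "cmod (h n) = \<rho> / (real n + 1)" for n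
      using r(2) by (auto simp: h_def norm_divide divide_le_eq simp del: of_real_divide)
    define q where "q n t = (H (z + t *s w + h n *s v) - H (z + t *s w)) / h n" for n t
    have "(\<lambda>t. ddir v H (z + t *s w)) holomorphic_on D"
    proof (rule holomorphic_uniform_sequence[OF oD])
      fix n
      have "(\<lambda>t. H ((z + h n *s v) + t *s w)) holomorphic_on D"
      proof (rule lineholo_line[OF H])
        fix t assume "t \<in> D"
        then have "z + t *s w + h n *s v \<in> cball p r" using h(2)[of n] r(2) by (intro r(4) pD) auto
        then show "z + h n *s v + t *s w \<in> U" using r(3) by (auto simp: add_ac)
      qed
      then have "(\<lambda>t. H (z + t *s w + h n *s v)) holomorphic_on D" by (simp add: add_ac)
      moreover have "(\<lambda>t. H (z + t *s w)) holomorphic_on D"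
      proof (rule lineholo_line[OF H])
        fix t assume "t \<in> D"
        then show "z + t *s w \<in> U" using pD[of t] r by auto
      qed
      ultimately show "q n holomorphic_on D" unfolding q_def by (intro holomorphic_intros h(1))
    next
      fix t assume "t \<in> D"
      then obtain d where d: "d > 0" "cball t d \<subseteq> D" using oD open_contains_cball by blast
      have bound: "dist (q n s) (ddir v H (z + s *s w)) \<le> 2 * B / \<rho>^2 * (\<rho> / (real n + 1))" if s: "s \<in> D" for n s
      proof -
        define x where "x = z + s *s w"
        define S where "S = {t. x + t *s v \<in> U}"
        have xv: "x + t *s v \<in> cball p r" if "cmod t \<le> 2 * \<rho>" for t unfolding x_def using r(4) pD[OF s] that by auto
        have "cmod (H (x + h n *s v) - H (x + 0 *s v) - deriv (\<lambda>t. H (x + t *s v)) 0 * (h n - 0))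
            \<le> 2 * B / \<rho>^2 * cmod (h n - 0)^2"
        proof (rule taylor2)
          show "(\<lambda>t. H (x + t *s v)) holomorphic_on S" unfolding S_def by (rule lineholo_line[OF H]) auto
          show "open S" unfolding S_def by (rule open_line[OF oU])
          show "cball 0 (2 * \<rho>) \<subseteq> S" using xv r(3) by (auto simp: S_def)
          show "cmod (H (x + t *s v)) \<le> B" if "t \<in> cball 0 (2 * \<rho>)" for t using that by (intro B xv) auto
        qed (use r h in auto)
        moreover have "H (x + h n *s v) - H (x + 0 *s v) - deriv (\<lambda>t. H (x + t *s v)) 0 * (h n - 0)
            = (q n s - ddir v H x) * h n"
        proof -
          have "q n s * h n = H (x + h n *s v) - H x" using h(1)[of n] by (simp add: q_def x_def)
          then show ?thesis by (simp add: left_diff_distrib ddir_def)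
        qed
        ultimately have "cmod (q n s - ddir v H x) * cmod (h n) \<le> (2 * B / \<rho>^2 * cmod (h n)) * cmod (h n)"
          by (simp add: norm_mult power2_eq_square mult.assoc)
        then have "cmod (q n s - ddir v H x) \<le> 2 * B / \<rho>^2 * cmod (h n)"
          by (rule mult_right_le_imp_le) (use h(1)[of n] in simp)
        then show ?thesis by (simp add: dist_norm x_def h(3))
      qed
      have "(\<lambda>n. \<rho> / (real n + 1)) \<longlonglongrightarrow> 0"
        using LIMSEQ_Suc[OF lim_const_over_n[of \<rho>]] by (simp add: add.commute)
      then have "(\<lambda>n. 2 * B / \<rho>^2 * (\<rho> / (real n + 1))) \<longlonglongrightarrow> 2 * B / \<rho>^2 * 0"
        by (intro tendsto_mult tendsto_const)
      then have lim: "(\<lambda>n. 2 * B / \<rho>^2 * (\<rho> / (real n + 1))) \<longlonglongrightarrow> 0" by simp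
      have "uniform_limit (cball t d) q (\<lambda>t. ddir v H (z + t *s w)) sequentially"
        unfolding uniform_limit_iff
      proof (intro allI impI)
        fix e :: real assume "e > 0"
        with lim have "\<forall>\<^sub>F n in sequentially. 2 * B / \<rho>^2 * (\<rho> / (real n + 1)) < e" by (rule order_tendstoD)
        then show "\<forall>\<^sub>F n in sequentially. \<forall>x\<in>cball t d. dist (q n x) (ddir v H (z + x *s w)) < e"
        proof (rule eventually_mono, intro ballI)
          fix n x assume "2 * B / \<rho>^2 * (\<rho> / (real n + 1)) < e" "x \<in> cball t d"
          then show "dist (q n x) (ddir v H (z + x *s w)) < e"
            using bound[of x n] d(2) by (meson le_less_trans subsetD)
        qed
      qed
      then show "\<exists>d>0. cball t d \<subseteq> D \<and> uniform_limit (cball t d) q (\<lambda>t. ddir v H (z + t *s w)) sequentially"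
        using d by blast
    qed
    moreover have "t0 \<in> D" using r by (simp add: D_def p_def)
    ultimately show ?thesis using oD by blast
  qed
  then have "\<exists>f'. ((\<lambda>t. ddir v H (z + t *s w)) has_field_derivative f') (at t0)" if "t0 \<in> T" for t0
    using that holomorphic_on_open by blast
  then show "(\<lambda>t. ddir v H (z + t *s w)) holomorphic_on {t. z + t *s w \<in> U}"
    using oT unfolding T_def[symmetric] by (simp add: holomorphic_on_open)
qed

lemma lineholo_ddir_funpow: "lineholo H U \<Longrightarrow> lineholo ((ddir v ^^ k) H) U"
  by (induction k) (auto intro: lineholo_ddir)

lemma lineholo_const: "open U \<Longrightarrow> lineholo (\<lambda>_. c) U"
  by (auto simp: lineholo_def)

lemma lineholo_add: "lineholo f U \<Longrightarrow> lineholo g U \<Longrightarrow> lineholo (\<lambda>z. f z + g z) U"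
  and lineholo_diff: "lineholo f U \<Longrightarrow> lineholo g U \<Longrightarrow> lineholo (\<lambda>z. f z - g z) U"
  and lineholo_mult: "lineholo f U \<Longrightarrow> lineholo g U \<Longrightarrow> lineholo (\<lambda>z. f z * g z) U"
  by (auto simp: lineholo_def intro!: continuous_intros holomorphic_intros)

lemma lineholo_sum: "open U \<Longrightarrow> (\<And>i. i \<in> I \<Longrightarrow> lineholo (f i) U) \<Longrightarrow> lineholo (\<lambda>z. \<Sum>i\<in>I. f i z) U"
  by (induction I rule: infinite_finite_induct) (auto intro: lineholo_const lineholo_add)

lemma lineholo_prod: "open U \<Longrightarrow> (\<And>i. i \<in> I \<Longrightarrow> lineholo (f i) U) \<Longrightarrow> lineholo (\<lambda>z. \<Prod>i\<in>I. f i z) U"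
  by (induction I rule: infinite_finite_induct) (auto intro: lineholo_const lineholo_mult)

lemma lineholo_det:
  assumes "open U" "\<And>i j. lineholo (\<lambda>z. M z $ i $ j) U"
  shows "lineholo (\<lambda>z. det (M z :: complex^'m^'m)) U"
  unfolding det_def using assms
  by (intro lineholo_sum lineholo_mult lineholo_prod lineholo_const)

lemma holo_on_line:
  fixes F :: "complex^'n \<Rightarrow> complex^'m"
  assumes L: "(F has_derivative L) (at (z + t *s v))" "\<And>c v. L (c *s v) = c *s L v"
  shows "((\<lambda>t. F (z + t *s v) $ i) has_field_derivative L v $ i) (at t)"
proof -
  have "((\<lambda>t. z + t *s v) has_derivative (\<lambda>h. h *s v)) (at t)"
    using has_derivative_add[OF has_derivative_const[of z]
        bounded_linear_imp_has_derivative[OF bounded_linear_cscale[of v]]] by simp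
  from diff_chain_at[OF this, of F L] L(1)
  have "((\<lambda>t. F (z + t *s v)) has_derivative (\<lambda>h. L (h *s v))) (at t)" by (simp add: o_def)
  from bounded_linear.has_derivative[OF bounded_linear_vec_nth this, of i]
  show ?thesis by (simp add: has_field_derivative_def L(2) mult.commute[of _ "L v $ i"])
qed

lemma holo_on_lineholo:
  assumes F: "holo_on F U" shows "lineholo (\<lambda>z. F z $ i) U"
  unfolding lineholo_def
proof (intro conjI allI)
  show oU: "open U" using F by (simp add: holo_on_def)
  have "continuous_on U F"
    using F unfolding holo_on_def by (meson continuous_at_imp_continuous_on has_derivative_continuous)
  then show "continuous_on U (\<lambda>z. F z $ i)" by (intro continuous_intros)
  fix z v
  show "(\<lambda>t. F (z + t *s v) $ i) holomorphic_on {t. z + t *s v \<in> U}"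
    unfolding holomorphic_on_open[OF open_line[OF oU]]
  proof safe
    fix t assume "z + t *s v \<in> U"
    then obtain L where "(F has_derivative L) (at (z + t *s v))" "\<forall>c v. L (c *s v) = c *s L v"
      using F unfolding holo_on_def by blast
    then show "\<exists>f'. ((\<lambda>t. F (z + t *s v) $ i) has_field_derivative f') (at t)"
      using holo_on_line by blast
  qed
qed

lemma holo_deriv_eq:
  assumes L: "(F has_derivative L) (at z)" "\<And>c v. L (c *s v) = c *s L v"
  shows "L v $ i = ddir v (\<lambda>z. F z $ i) z"
  using holo_on_line[of F L z 0 v i] L by (simp add: ddir_def DERIV_imp_deriv)

text \<open>Built from directional derivatives, so that its entries are again
  \<open>lineholo\<close> on the domain and so that it is available at the origin, where complex
  differentiability of the lifts is not known beforehand.\<close>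

definition jac :: "(complex^'n \<Rightarrow> complex^'m) \<Rightarrow> complex^'n \<Rightarrow> complex^'n^'m" where
  "jac F z = (\<chi> i j. ddir (axis j 1) (\<lambda>z. F z $ i) z)"

lemma vec_axis_sum: "(v::complex^'n) = (\<Sum>j\<in>UNIV. v $ j *s axis j 1)"
  by (simp add: vec_eq_iff axis_def if_distrib cong: if_cong)

lemma holo_deriv_jac:
  assumes L: "(F has_derivative L) (at z)" "\<And>c v. L (c *s v) = c *s L v"
  shows "L = (*v) (jac F z)"
proof
  fix v
  have "linear L" using L(1) has_derivative_linear by blast
  then have "L v = (\<Sum>j\<in>UNIV. v $ j *s L (axis j 1))"
    by (subst vec_axis_sum[of v]) (simp add: linear_sum L(2))
  also have "\<dots> = jac F z *v v"
    by (simp add: vec_eq_iff matrix_vector_mult_def jac_def holo_deriv_eq[OF L] mult.commute)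
  finally show "L v = jac F z *v v" .
qed

lemma holo_on_jac: "holo_on F U \<Longrightarrow> z \<in> U \<Longrightarrow> (F has_derivative (*v) (jac F z)) (at z)"
  unfolding holo_on_def using holo_deriv_jac by metis

lemma holo_onI_jac: "open U \<Longrightarrow> (\<And>z. z \<in> U \<Longrightarrow> (F has_derivative (*v) (J z)) (at z)) \<Longrightarrow> holo_on F U"
  unfolding holo_on_def using vec_mult_cscale by blast

section \<open>Injective holomorphic maps are immersive\<close>

lemma holo_on_subset: "holo_on F U \<Longrightarrow> open V \<Longrightarrow> V \<subseteq> U \<Longrightarrow> holo_on F V"
  unfolding holo_on_def by blast

lemma holo_on_continuous: "holo_on F U \<Longrightarrow> continuous_on U F"
  unfolding holo_on_def by (meson continuous_at_imp_continuous_on has_derivative_continuous)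

text \<open>Zeros of \<open>J\<close> of minimal order along \<open>a\<close> form a Lipschitz graph over the \<open>b\<close>-direction, and \<open>F\<close> is
  constant on this graph.\<close>
lemma critical_set_not_injective:
  fixes F :: "complex^'n \<Rightarrow> complex^'m"
  assumes J: "lineholo J U" and z0: "z0 \<in> U" "J z0 = 0"
    and crit: "\<And>z. z \<in> U \<Longrightarrow> J z = 0 \<Longrightarrow> \<exists>L. (F has_derivative L) (at z) \<and> (\<forall>s t. L (s *s a + t *s b) = 0)"
    and ind: "\<And>s t. s *s a + t *s b = 0 \<Longrightarrow> s = 0 \<and> t = 0"
  shows "\<not> inj_on F U"
proof
  assume inj: "inj_on F U"
  have oU: "open U" using J by (simp add: lineholo_def)
  \<comment> \<open>The argument takes place in the plane through \<open>z0\<close> spanned by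
    \<open>a\<close> and \<open>b\<close>, with coordinates \<open>x\<close> and
    \<open>y\<close>.\<close>
  define P where "P x y = z0 + x *s a + y *s b" for x y
  have Pdiff: "P x y - P x' y' = (x - x') *s a + (y - y') *s b" for x y x' y'
    by (simp add: P_def vec_eq_iff algebra_simps)
  have Pinj: "P x y = P x' y' \<Longrightarrow> x = x' \<and> y = y'" for x y x' y'
    using ind[of "x - x'" "y - y'"] Pdiff[of x y x' y'] by simp
  have Px: "P x y + t *s a = P (x + t) y" and Py: "P x y + t *s b = P x (y + t)" for x y t
    by (simp_all add: P_def vec_eq_iff algebra_simps)
  have contP: "continuous_on UNIV (\<lambda>(x,y). P x y)"
    unfolding P_def split_def by (intro continuous_intros)
  have "open {w. P (fst w) (snd w) \<in> U}"
    using open_vimage[OF oU contP] by (simp add: vimage_def split_def)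
  moreover have "(0,0) \<in> {w. P (fst w) (snd w) \<in> U}" using z0 by (simp add: P_def)
  ultimately obtain W1 W2 where W: "open W1" "open W2" "0 \<in> W1" "0 \<in> W2" "W1 \<times> W2 \<subseteq> {w. P (fst w) (snd w) \<in> U}"
    by (elim open_prod_elim) (auto simp: zero_prod_def)
  obtain r1 r2 where r12: "r1 > 0" "r2 > 0" "ball 0 r1 \<subseteq> W1" "ball 0 r2 \<subseteq> W2"
    using W open_contains_ball by meson
  have PU: "P x y \<in> U" if "x \<in> ball 0 r1" "y \<in> ball 0 r2" for x y
  proof -
    have "(x, y) \<in> W1 \<times> W2" using r12 that by auto
    then show ?thesis using W(5) by fastforce
  qed
  have Jline: "(\<lambda>x. H (P x y)) holomorphic_on ball 0 r1" if "y \<in> ball 0 r2" "lineholo H U" for y H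
  proof -
    have "(\<lambda>x. H (P 0 y + x *s a)) holomorphic_on ball 0 r1"
      by (rule lineholo_line[OF that(2)]) (use PU that in \<open>simp add: Px\<close>)
    then show ?thesis by (simp add: Px)
  qed
  have derx: "((\<lambda>x. H (P x y)) has_field_derivative ddir a H (P x y)) (at x)"
    if "x \<in> ball 0 r1" "y \<in> ball 0 r2" "lineholo H U" for x y H
    using lineholo_has_derivative[OF that(3), of "P 0 y" x a] PU that by (simp add: Px)
  have dery: "((\<lambda>y. H (P x y)) has_field_derivative ddir b H (P x y)) (at y)"
    if "x \<in> ball 0 r1" "y \<in> ball 0 r2" "lineholo H U" for x y H
    using lineholo_has_derivative[OF that(3), of "P x 0" y b] PU that by (simp add: Py)
  have contH: "continuous_on (ball 0 r1 \<times> ball 0 r2) (\<lambda>(x,y). H (P x y))" if "lineholo H U" for H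
  proof -
    have "continuous_on (ball 0 r1 \<times> ball 0 r2) (H \<circ> (\<lambda>(x,y). P x y))"
    proof (rule continuous_on_compose)
      show "continuous_on (ball 0 r1 \<times> ball 0 r2) (\<lambda>(x,y). P x y)"
        using contP continuous_on_subset by blast
      show "continuous_on ((\<lambda>(x,y). P x y) ` (ball 0 r1 \<times> ball 0 r2)) H"
        using that PU unfolding lineholo_def by (auto intro: continuous_on_subset)
    qed
    then show ?thesis by (simp add: o_def split_def)
  qed
  \<comment> \<open>This bounds the order of vanishing along \<open>a\<close> from above only.
    Minimality of \<open>k\<close> over all zeros in the bidisc will supply the vanishing of the
    derivative of order \<open>k - 1\<close> at every zero.\<close>
  define order_at where "order_at k x y \<longleftrightarrow> x \<in> ball 0 r1 \<and> y \<in> ball 0 r2 \<and> J (P x y) = 0 \<and> (ddir a ^^ k) J (P x y) \<noteq> 0" for k x y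
  \<comment> \<open>If \<open>J\<close> vanished on a whole disc in direction \<open>a\<close>, the
    derivative of \<open>F\<close> would kill \<open>a\<close> along it and \<open>F\<close> would
    be constant there.\<close>
  have finite_order: "\<exists>x'\<in>ball 0 r1. J (P x' y) \<noteq> 0" if xy: "x \<in> ball 0 r1" "y \<in> ball 0 r2" for x y
  proof (rule ccontr)
    assume "\<not> ?thesis"
    then have J0: "J (P x y) = 0" if "x \<in> ball 0 r1" for x using that by auto
    have "((\<lambda>x. F (P x y)) has_derivative (\<lambda>h. 0)) (at x within ball 0 r1)" if x: "x \<in> ball 0 r1" for x
    proof -
      obtain L where L: "(F has_derivative L) (at (P x y))" "\<And>s t. L (s *s a + t *s b) = 0"
        using crit[OF PU[OF x xy(2)] J0[OF x]] by blast
      have "((\<lambda>x. P x y) has_derivative (\<lambda>h. h *s a)) (at x)"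
        using has_derivative_add[OF has_derivative_const[of "P 0 y"]
          bounded_linear_imp_has_derivative[OF bounded_linear_cscale[of a]]] by (simp add: Px)
      from diff_chain_at[OF this, of F L] L(1)
      have "((\<lambda>x. F (P x y)) has_derivative (\<lambda>h. L (h *s a))) (at x)" by (simp add: o_def)
      moreover have "L (h *s a) = 0" for h using L(2)[of h 0] by simp
      ultimately show ?thesis by (simp add: has_derivative_at_withinI)
    qed
    then obtain c where c: "\<And>x. x \<in> ball 0 r1 \<Longrightarrow> F (P x y) = c"
      using has_derivative_zero_constant[of "ball 0 r1" "\<lambda>x. F (P x y)"] by auto
    define x' where "x' = complex_of_real (r1 / 2)"
    have x': "x' \<in> ball 0 r1" "x' \<noteq> 0" using r12(1) by (auto simp: x'_def)
    have "F (P x' y) = F (P 0 y)" using c[OF x'(1)] c[of 0] r12 by simp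
    then have "P x' y = P 0 y" using inj PU x' xy r12 by (simp add: inj_on_eq_iff)
    then show False using Pinj x' by blast
  qed
  have order_ex: "\<exists>k. order_at k x y" if xy: "x \<in> ball 0 r1" "y \<in> ball 0 r2" "J (P x y) = 0" for x y
  proof (rule ccontr)
    assume n: "\<nexists>k. order_at k x y"
    obtain x' where x': "x' \<in> ball 0 r1" "J (P x' y) \<noteq> 0" using finite_order xy by blast
    have eq: "(deriv ^^ k) (\<lambda>x. J (P x y)) = (\<lambda>x. (ddir a ^^ k) J (P x y))" for k
      using higher_deriv_line[of k J "P 0 y" a] by (simp add: Px)
    have "J (P x' y) = 0"
    proof (rule holomorphic_fun_eq_0_on_connected[OF Jline[OF xy(2) J] open_ball])
      show "(deriv ^^ k) (\<lambda>x. J (P x y)) x = 0" for k using n xy unfolding order_at_def by (simp add: eq)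
    qed (use xy x' in auto)
    then show False using x' by simp
  qed
  have "\<exists>k x y. order_at k x y"
    using order_ex[of 0 0] z0 r12 by (auto simp: P_def)
  then obtain k where k: "\<exists>x y. order_at k x y" "\<And>k'. k' < k \<Longrightarrow> \<not> (\<exists>x y. order_at k' x y)"
    using exists_least_iff[of "\<lambda>k. \<exists>x y. order_at k x y"] by metis
  then obtain xs ys where xys: "order_at k xs ys" by blast
  have "k \<noteq> 0" using xys by (metis funpow_0 order_at_def)
  then obtain m where m: "k = Suc m" by (cases k) auto
  \<comment> \<open>\<open>K\<close> vanishes wherever \<open>J\<close> does, but its
    \<open>a\<close>-derivative is nonzero at the chosen point: it serves as a reduced equation for
    the zeros of \<open>J\<close>.\<close>
  define K where "K = (ddir a ^^ m) J"
  have hK: "lineholo K U" and hKa: "lineholo (ddir a K) U" and hKb: "lineholo (ddir b K) U"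
    using J unfolding K_def by (auto intro: lineholo_ddir_funpow lineholo_ddir)
  have xsys: "xs \<in> ball 0 r1" "ys \<in> ball 0 r2" "J (P xs ys) = 0" using xys by (auto simp: order_at_def)
  have K0: "K (P x y) = 0" if "x \<in> ball 0 r1" "y \<in> ball 0 r2" "J (P x y) = 0" for x y
    using k(2)[of m] that unfolding order_at_def K_def m by blast
  define \<kappa> where "\<kappa> = ddir a K (P xs ys)"
  have \<kappa>: "\<kappa> \<noteq> 0" using xys by (simp add: order_at_def m \<kappa>_def K_def)
  define c where "c = cmod \<kappa>"
  have c: "c > 0" using \<kappa> by (simp add: c_def)
  have "isCont (\<lambda>(x,y). ddir a K (P x y)) (xs, ys)"
    using contH[OF hKa] xsys by (auto simp: continuous_on_eq_continuous_at open_Times)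
  then have "\<exists>e>0. \<forall>w. dist w (xs,ys) < e \<longrightarrow> dist ((\<lambda>(x,y). ddir a K (P x y)) w) \<kappa> < c / 2"
    using c unfolding continuous_at_eps_delta \<kappa>_def by (auto dest!: spec[of _ "c / 2"])
  then obtain e1 where e1: "e1 > 0" "\<And>x y. dist (x,y) (xs,ys) < e1 \<Longrightarrow> dist (ddir a K (P x y)) \<kappa> < c / 2"
    by auto
  define e2 where "e2 = Min {e1, r1 - cmod xs, r2 - cmod ys} / 3"
  have e2: "e2 > 0" "2 * e2 < e1" "e2 < r1 - cmod xs" "e2 < r2 - cmod ys"
    using e1 xsys by (auto simp: e2_def min_def field_simps)
  have ball2: "x \<in> ball 0 r1" if "x \<in> cball xs e2" for x
    using that e2 norm_triangle_ineq2[of x xs] by (auto simp: dist_norm norm_minus_commute)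
  have ball3: "y \<in> ball 0 r2" if "y \<in> cball ys e2" for y
    using that e2 norm_triangle_ineq2[of y ys] by (auto simp: dist_norm norm_minus_commute)
  have Ka: "cmod (ddir a K (P x y) - \<kappa>) \<le> c / 2" if "x \<in> cball xs e2" "y \<in> cball ys e2" for x y
  proof -
    have "dist (x,y) (xs,ys) \<le> dist x xs + dist y ys"
      unfolding dist_Pair_Pair by (rule sqrt_sum_squares_le_sum) auto
    also have "\<dots> < e1" using that e2 by (auto simp: dist_commute)
    finally show ?thesis using e1(2)[of x y] by (simp add: dist_norm)
  qed
  have "compact ((\<lambda>(x,y). ddir b K (P x y)) ` (cball xs e2 \<times> cball ys e2))"
    using ball2 ball3 by (intro compact_continuous_image compact_Times compact_cball continuous_on_subset[OF contH[OF hKb]]) auto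
  then have "bounded ((\<lambda>(x,y). ddir b K (P x y)) ` (cball xs e2 \<times> cball ys e2))"
    by (rule compact_imp_bounded)
  then have "\<exists>M. \<forall>x\<in>cball xs e2. \<forall>y\<in>cball ys e2. cmod (ddir b K (P x y)) \<le> M"
    unfolding bounded_iff by simp
  then obtain M where M: "\<And>x y. x \<in> cball xs e2 \<Longrightarrow> y \<in> cball ys e2 \<Longrightarrow> cmod (ddir b K (P x y)) \<le> M"
    by blast
  have M0: "M \<ge> 0" using order_trans[OF norm_ge_zero M[of xs ys]] e2 by simp
  obtain x' where x': "x' \<in> ball 0 r1" "J (P x' ys) \<noteq> 0" using finite_order xsys by blast
  obtain d0 where d0: "d0 > 0" "ball xs d0 \<subseteq> ball 0 r1" "\<And>x. x \<in> ball xs d0 - {xs} \<Longrightarrow> J (P x ys) \<noteq> 0"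
    using isolated_zeros[OF Jline[OF xsys(2) J] open_ball connected_ball xsys(1,3) x'] by blast
  define d where "d = min (d0/2) e2"
  have d: "d > 0" "d < d0" "d \<le> e2" using d0 e2 by (auto simp: d_def)
  have dsub: "x \<in> cball xs e2" if "x \<in> cball xs d" for x using that d by auto
  have "compact ((\<lambda>x. cmod (J (P x ys))) ` sphere xs d)"
    using dsub ball2 xsys(2)
    by (intro compact_continuous_image continuous_on_norm
        continuous_on_subset[OF holomorphic_on_imp_continuous_on[OF Jline[OF xsys(2) J]]]) auto
  moreover have "(\<lambda>x. cmod (J (P x ys))) ` sphere xs d \<noteq> {}" using d by simp
  ultimately obtain x1 where x1: "x1 \<in> sphere xs d" "\<And>x. x \<in> sphere xs d \<Longrightarrow> cmod (J (P x1 ys)) \<le> cmod (J (P x ys))"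
    using compact_attains_inf[of "(\<lambda>x. cmod (J (P x ys))) ` sphere xs d"] by auto
  define \<epsilon> where "\<epsilon> = cmod (J (P x1 ys))"
  have \<epsilon>: "\<epsilon> > 0" using d0(3)[of x1] x1(1) d by (auto simp: \<epsilon>_def dist_commute)
  have "uniformly_continuous_on (cball xs e2 \<times> cball ys e2) (\<lambda>(x,y). J (P x y))"
    using ball2 ball3
    by (intro compact_uniformly_continuous compact_Times compact_cball continuous_on_subset[OF contH[OF J]]) auto
  then obtain \<delta> where \<delta>: "\<delta> > 0" "\<And>w w'. w \<in> cball xs e2 \<times> cball ys e2 \<Longrightarrow> w' \<in> cball xs e2 \<times> cball ys e2
      \<Longrightarrow> dist w' w < \<delta> \<Longrightarrow> dist ((\<lambda>(x,y). J (P x y)) w') ((\<lambda>(x,y). J (P x y)) w) < \<epsilon> / 2"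
    unfolding uniformly_continuous_on_def using \<epsilon> by (meson half_gt_zero)
  define \<eta> where "\<eta> = min \<delta> e2"
  have \<eta>: "\<eta> > 0" using \<delta> e2 by (simp add: \<eta>_def)
  have Jclose: "cmod (J (P x y) - J (P x ys)) < \<epsilon> / 2" if "x \<in> cball xs d" "y \<in> ball ys \<eta>" for x y
    using \<delta>(2)[of "(x,ys)" "(x,y)"] that dsub[OF that(1)] e2 by (auto simp: \<eta>_def dist_Pair_Pair dist_commute dist_norm[of "J _"])
  \<comment> \<open>The zero persists for nearby \<open>y\<close>, as in Hurwitz' theorem: otherwise
    the maximum principle would bound \<open>1 / J\<close> by \<open>2 / \<epsilon>\<close> at the
    centre, where the modulus of \<open>J\<close> is below \<open>\<epsilon> / 2\<close>.\<close>
  have "\<exists>x\<in>cball xs d. J (P x y) = 0" if y: "y \<in> ball ys \<eta>" for y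
  proof (rule ccontr)
    assume n: "\<not> ?thesis"
    have y2: "y \<in> ball 0 r2" using y by (intro ball3) (auto simp: \<eta>_def)
    have hol: "(\<lambda>x. inverse (J (P x y))) holomorphic_on cball xs d"
      using n dsub ball2 by (intro holomorphic_on_inverse holomorphic_on_subset[OF Jline[OF y2 J]]) auto
    have "norm (inverse (J (P xs y))) \<le> 2 / \<epsilon>"
    proof (rule maximum_modulus_frontier[of "\<lambda>x. inverse (J (P x y))" "cball xs d"])
      show "(\<lambda>x. inverse (J (P x y))) holomorphic_on interior (cball xs d)"
        using hol interior_subset holomorphic_on_subset by blast
      show "continuous_on (closure (cball xs d)) (\<lambda>x. inverse (J (P x y)))"
        using holomorphic_on_imp_continuous_on[OF hol] by simp
      fix x assume "x \<in> frontier (cball xs d)"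
      then have x: "x \<in> sphere xs d" using d by (simp add: frontier_cball)
      then have "\<epsilon> \<le> cmod (J (P x ys))" using x1 by (simp add: \<epsilon>_def)
      moreover have "cmod (J (P x ys)) \<le> cmod (J (P x y)) + cmod (J (P x y) - J (P x ys))"
        by (metis add.commute diff_add_cancel norm_minus_commute norm_triangle_ineq)
      moreover have "cmod (J (P x y) - J (P x ys)) < \<epsilon> / 2" using x y by (intro Jclose) auto
      ultimately have "\<epsilon> / 2 \<le> cmod (J (P x y))" by simp
      then have "inverse (cmod (J (P x y))) \<le> inverse (\<epsilon> / 2)" using \<epsilon> by (intro le_imp_inverse_le) auto
      then show "cmod (inverse (J (P x y))) \<le> 2 / \<epsilon>" by (simp add: norm_inverse)
    qed (use d in auto)
    moreover have "cmod (J (P xs y)) < \<epsilon> / 2" using Jclose[OF _ y, of xs] xsys(3) d by simp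
    moreover have "J (P xs y) \<noteq> 0" using n d by auto
    ultimately have "inverse (cmod (J (P xs y))) \<le> inverse (\<epsilon> / 2)" "0 < cmod (J (P xs y))" by (auto simp: norm_inverse)
    then have "\<epsilon> / 2 \<le> cmod (J (P xs y))" using \<epsilon> by (metis inverse_le_imp_le half_gt_zero)
    then show False using \<open>cmod (J (P xs y)) < \<epsilon> / 2\<close> by simp
  qed
  then obtain \<zeta> where \<zeta>: "\<And>y. y \<in> ball ys \<eta> \<Longrightarrow> \<zeta> y \<in> cball xs d \<and> J (P (\<zeta> y) y) = 0" by metis
  \<comment> \<open>The estimate behind the implicit function theorem: \<open>K\<close> vanishes at
    both points, its \<open>x\<close>-derivative stays within \<open>c / 2\<close> of
    \<open>\<kappa>\<close>, and its \<open>y\<close>-derivative is at most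
    \<open>M\<close>.\<close>
  have lip: "cmod (\<zeta> y - \<zeta> y') \<le> (2 * M / c) * cmod (y - y')" if y: "y \<in> ball ys \<eta>" "y' \<in> ball ys \<eta>" for y y'
  proof -
    have z: "\<zeta> y \<in> cball xs e2" "\<zeta> y' \<in> cball xs e2" using \<zeta> y dsub by auto
    have yy: "y \<in> cball ys e2" "y' \<in> cball ys e2" using y by (auto simp: \<eta>_def)
    have "K (P (\<zeta> y) y) = 0" "K (P (\<zeta> y') y') = 0" using \<zeta>[OF y(1)] \<zeta>[OF y(2)]
      K0[OF ball2[OF z(1)] ball3[OF yy(1)]] K0[OF ball2[OF z(2)] ball3[OF yy(2)]] by auto
    moreover have "cmod ((K (P (\<zeta> y) y') - \<kappa> * \<zeta> y) - (K (P (\<zeta> y') y') - \<kappa> * \<zeta> y')) \<le> c / 2 * cmod (\<zeta> y - \<zeta> y')"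
    proof (rule field_differentiable_bound[of "cball xs e2" "\<lambda>x. K (P x y') - \<kappa> * x" "\<lambda>x. ddir a K (P x y') - \<kappa>"])
      fix x assume x: "x \<in> cball xs e2"
      show "((\<lambda>x. K (P x y') - \<kappa> * x) has_field_derivative ddir a K (P x y') - \<kappa>) (at x within cball xs e2)"
        by (rule has_field_derivative_at_within[OF DERIV_diff[OF derx[OF ball2[OF x] ball3[OF yy(2)] hK] DERIV_cmult_Id]])
      show "cmod (ddir a K (P x y') - \<kappa>) \<le> c / 2" by (rule Ka[OF x yy(2)])
    qed (use z in auto)
    moreover have "cmod (K (P (\<zeta> y) y') - K (P (\<zeta> y) y)) \<le> M * cmod (y' - y)"
    proof (rule field_differentiable_bound[of "cball ys e2" "\<lambda>v. K (P (\<zeta> y) v)" "\<lambda>v. ddir b K (P (\<zeta> y) v)"])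
      fix v assume v: "v \<in> cball ys e2"
      show "((\<lambda>v. K (P (\<zeta> y) v)) has_field_derivative ddir b K (P (\<zeta> y) v)) (at v within cball ys e2)"
        by (rule has_field_derivative_at_within[OF dery[OF ball2[OF z(1)] ball3[OF v] hK]])
      show "cmod (ddir b K (P (\<zeta> y) v)) \<le> M" by (rule M[OF z(1) v])
    qed (use yy in auto)
    ultimately have "cmod (K (P (\<zeta> y) y') - \<kappa> * (\<zeta> y - \<zeta> y')) \<le> c / 2 * cmod (\<zeta> y - \<zeta> y')"
      "cmod (K (P (\<zeta> y) y')) \<le> M * cmod (y - y')"
      by (auto simp: algebra_simps norm_minus_commute)
    moreover have "c * cmod (\<zeta> y - \<zeta> y') \<le> cmod (K (P (\<zeta> y) y')) + cmod (K (P (\<zeta> y) y') - \<kappa> * (\<zeta> y - \<zeta> y'))"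
      using norm_triangle_ineq4[of "K (P (\<zeta> y) y')" "K (P (\<zeta> y) y') - \<kappa> * (\<zeta> y - \<zeta> y')"] by (simp add: c_def norm_mult)
    ultimately have "c / 2 * cmod (\<zeta> y - \<zeta> y') \<le> M * cmod (y - y')" by simp
    then show ?thesis using c by (simp add: field_simps)
  qed
  have "((\<lambda>y. F (P (\<zeta> y) y)) has_derivative (\<lambda>h. 0)) (at y within ball ys \<eta>)" if y: "y \<in> ball ys \<eta>" for y
  proof -
    have z: "\<zeta> y \<in> cball xs e2" "y \<in> cball ys e2" using \<zeta> y dsub by (auto simp: \<eta>_def)
    define Q where "Q y = P (\<zeta> y) y" for y
    have "Q y \<in> U" "J (Q y) = 0"
      using \<zeta>[OF y] PU[OF ball2[OF z(1)] ball3[OF z(2)]] unfolding Q_def by auto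
    then obtain L where L: "(F has_derivative L) (at (Q y))" "\<And>s t. L (s *s a + t *s b) = 0" using crit by blast
    define C where "C = 2 * M / c * norm a + norm b + 1"
    have C: "C > 0" using c M0 by (simp add: C_def add_nonneg_pos)
    have QC: "norm (Q y' - Q y) \<le> C * norm (y' - y)" if "y' \<in> ball ys \<eta>" for y'
    proof -
      have "norm (Q y' - Q y) \<le> norm ((\<zeta> y' - \<zeta> y) *s a) + norm ((y' - y) *s b)"
        unfolding Q_def Pdiff by (rule norm_triangle_ineq)
      also have "\<dots> \<le> (2 * M / c * cmod (y' - y)) * norm a + cmod (y' - y) * norm b"
        unfolding norm_cscale using mult_right_mono[OF lip[OF that y] norm_ge_zero[of a]] by simp
      also have "\<dots> \<le> C * norm (y' - y)" by (simp add: C_def algebra_simps)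
      finally show ?thesis .
    qed
    \<comment> \<open>The curve \<open>Q\<close> is only known to be Lipschitz. This suffices:
      \<open>L\<close> annihilates every increment of \<open>Q\<close>, and the remainder of
      \<open>F\<close> is small relative to that increment.\<close>
    show ?thesis
      unfolding has_derivative_within_alt Q_def[symmetric]
    proof (intro conjI allI impI)
      fix e :: real assume e: "e > 0"
      then obtain d where d: "d > 0" "\<And>q. norm (q - Q y) < d \<Longrightarrow> norm (F q - F (Q y) - L (q - Q y)) \<le> e / C * norm (q - Q y)"
        using L(1) C unfolding has_derivative_at_alt by (metis divide_pos_pos)
      have "norm (F (Q y') - F (Q y)) \<le> e * norm (y' - y)" if y': "y' \<in> ball ys \<eta>" "norm (y' - y) < d / C" for y'
      proof -
        have "norm (Q y' - Q y) < d" using QC[OF y'(1)] y'(2) C by (simp add: field_simps)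
        moreover have "L (Q y' - Q y) = 0" unfolding Q_def Pdiff by (rule L(2))
        ultimately have "norm (F (Q y') - F (Q y)) \<le> e / C * norm (Q y' - Q y)"
          using d(2)[of "Q y'"] by simp
        also have "\<dots> \<le> e / C * (C * norm (y' - y))" using e C QC[OF y'(1)] by (intro mult_left_mono) auto
        finally show ?thesis using C by simp
      qed
      then show "\<exists>d>0. \<forall>y'\<in>ball ys \<eta>. norm (y' - y) < d \<longrightarrow> norm (F (Q y') - F (Q y) - 0) \<le> e * norm (y' - y)"
        using d C by (intro exI[of _ "d / C"]) auto
    qed (rule bounded_linear_zero)
  qed
  then obtain const where cst: "\<And>y. y \<in> ball ys \<eta> \<Longrightarrow> F (P (\<zeta> y) y) = const"
    using has_derivative_zero_constant[of "ball ys \<eta>" "\<lambda>y. F (P (\<zeta> y) y)"] by auto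
  define y' where "y' = ys + of_real (\<eta>/2)"
  have y': "y' \<in> ball ys \<eta>" "y' \<noteq> ys" "ys \<in> ball ys \<eta>" using \<eta> by (auto simp: y'_def dist_norm)
  have inU: "P (\<zeta> y) y \<in> U" if "y \<in> ball ys \<eta>" for y
    using \<zeta>[OF that] dsub[of "\<zeta> y"] that PU[OF ball2 ball3, of "\<zeta> y" y] by (auto simp: \<eta>_def)
  have "P (\<zeta> y') y' = P (\<zeta> ys) ys"
    using cst[OF y'(1)] cst[OF y'(3)] inj_onD[OF inj _ inU[OF y'(1)] inU[OF y'(3)]] by simp
  then show False using Pinj y' by blast
qed

text \<open>Invariance of domain gives the openness of the image, so only the differentiability of
  an inverse that already exists remains to be shown.\<close>

lemma holo_inverse:
  fixes F :: "complex^'n \<Rightarrow> complex^'n"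
  assumes F: "holo_on F U" "inj_on F U" and der: "\<And>z. z \<in> U \<Longrightarrow> inj ((*v) (jac F z))"
  shows "open (F ` U)" "holo_on (inv_into U F) (F ` U)"
proof -
  have oU: "open U" using F by (simp add: holo_on_def)
  show op: "open (F ` U)" by (rule invariance_of_domain[OF holo_on_continuous[OF F(1)] oU F(2)])
  show "holo_on (inv_into U F) (F ` U)"
    unfolding holo_on_def
  proof (intro conjI ballI op)
    fix w assume "w \<in> F ` U"
    then obtain z where z: "z \<in> U" "w = F z" by blast
    obtain B where B: "B ** jac F z = mat 1" using der[OF z(1)] by (metis matrix_left_invertible_injective)
    then have B': "jac F z ** B = mat 1" using matrix_left_right_inverse by blast
    have "(inv_into U F has_derivative (*v) B) (at (F z))"
    proof (rule has_derivative_inverse_strong[OF oU z(1) holo_on_continuous[OF F(1)]])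
      show "inv_into U F (F x) = x" if "x \<in> U" for x using that F(2) by simp
      show "(F has_derivative (*v) (jac F z)) (at z)" by (rule holo_on_jac[OF F(1) z(1)])
      show "(*v) (jac F z) \<circ> (*v) B = id" by (auto simp: fun_eq_iff matrix_vector_mul_assoc B')
    qed
    then show "\<exists>L. (inv_into U F has_derivative L) (at w) \<and> (\<forall>c v. L (c *s v) = c *s L v)"
      using z vec_mult_cscale by blast
  qed
qed

lemma holo_compose:
  assumes "holo_on G V" "holo_on F U" "G ` V \<subseteq> U"
  shows "holo_on (F \<circ> G) V"
proof (rule holo_onI_jac)
  show "open V" using assms by (simp add: holo_on_def)
  fix z assume z: "z \<in> V"
  have "(F \<circ> G has_derivative (*v) (jac F (G z)) \<circ> (*v) (jac G z)) (at z)"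
    using assms z by (intro diff_chain_at holo_on_jac) auto
  then show "(F \<circ> G has_derivative (*v) (jac F (G z) ** jac G z)) (at z)"
    by (simp add: o_def matrix_vector_mul_assoc)
qed

lemma inj_matrix_iff: "inj ((*v) A) \<longleftrightarrow> (\<forall>v. A *v v = 0 \<longrightarrow> v = 0)" for A :: "complex^'n^'m"
  using linear_injective_0[of "(*v) A"] by (simp add: matrix_vector_mul_linear)

lemma inj_matrix_det: "inj ((*v) A) \<longleftrightarrow> det A \<noteq> 0" for A :: "complex^'n^'n"
  by (simp add: invertible_det_nz[symmetric] invertible_left_inverse matrix_left_invertible_injective)

lemma jac_fixed_coordinate:
  assumes F: "holo_on F U" and z: "z \<in> U" and eq: "\<And>z. z \<in> U \<Longrightarrow> F z $ i = z $ j"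
  shows "(jac F z *v v) $ i = v $ j"
proof -
  have oU: "open U" using F by (simp add: holo_on_def)
  have 1: "((\<lambda>z. F z $ i) has_derivative (\<lambda>v. (jac F z *v v) $ i)) (at z)"
    by (rule bounded_linear.has_derivative[OF bounded_linear_vec_nth holo_on_jac[OF F z]])
  have "((\<lambda>z. z $ j) has_derivative (\<lambda>v. v $ j)) (at z)"
    by (rule bounded_linear_imp_has_derivative[OF bounded_linear_vec_nth])
  then have "((\<lambda>z. F z $ i) has_derivative (\<lambda>v. v $ j)) (at z)"
    using eq by (auto intro: has_derivative_transform_within_open[OF _ oU z])
  with 1 have "(\<lambda>v. (jac F z *v v) $ i) = (\<lambda>v. v $ j)" by (rule has_derivative_unique)
  then show ?thesis by metis
qed

text \<open>\<open>G\<close> takes the \<open>a\<close>-th component of \<open>F\<close> as its new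
  \<open>b\<close>-th coordinate. Two points with the same image under \<open>G\<close> differ in
  direction \<open>b\<close> only, and along it the derivative of that component stays within half
  the modulus of its nonzero value at \<open>z\<close>; this forces injectivity on a small
  ball.\<close>

lemma straighten_coordinate:
  fixes F :: "complex^'n \<Rightarrow> complex^'n"
  assumes F: "holo_on F U" and z: "z \<in> U" and nz: "jac F z $ a $ b \<noteq> 0"
  obtains V G where "open V" "z \<in> V" "V \<subseteq> U" "holo_on G V" "inj_on G V"
    "\<And>x. x \<in> V \<Longrightarrow> inj ((*v) (jac G x))" "\<And>x. G x $ b = F x $ a" "\<And>x i. i \<noteq> b \<Longrightarrow> G x $ i = x $ i"
proof -
  have oU: "open U" using F by (simp add: holo_on_def)
  define D where "D = ddir (axis b 1) (\<lambda>x. F x $ a)"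
  have hF: "lineholo (\<lambda>x. F x $ a) U" by (rule holo_on_lineholo[OF F])
  have Djac: "D x = jac F x $ a $ b" for x by (simp add: D_def jac_def)
  define k where "k = D z"
  have k: "cmod k > 0" using nz by (simp add: k_def Djac)
  have "continuous_on U D" using lineholo_ddir[OF hF] by (simp add: D_def lineholo_def)
  then have "isCont D z" using oU z by (simp add: continuous_on_eq_continuous_at)
  then have "\<exists>d>0. \<forall>x. dist x z < d \<longrightarrow> dist (D x) k < cmod k / 2"
    using k unfolding continuous_at_eps_delta k_def by (auto dest!: spec[of _ "cmod (D z) / 2"])
  then obtain d where d: "d > 0" "\<And>x. dist x z < d \<Longrightarrow> dist (D x) k < cmod k / 2" by blast
  obtain r0 where r0: "r0 > 0" "ball z r0 \<subseteq> U" using oU z open_contains_ball by blast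
  define V where "V = ball z (min d r0)"
  have V: "open V" "z \<in> V" "V \<subseteq> U" "convex V" using d r0 by (auto simp: V_def)
  have DV: "cmod (D x - k) \<le> cmod k / 2" if "x \<in> V" for x
    using d(2)[of x] that by (simp add: V_def dist_commute dist_norm norm_minus_commute)
  define G where "G x = x + (F x $ a - x $ b) *s axis b 1" for x
  have Gb: "G x $ b = F x $ a" and Gi: "i \<noteq> b \<Longrightarrow> G x $ i = x $ i" for x i
    by (simp_all add: G_def axis_def)
  define L where "L x v = v + ((jac F x *v v) $ a - v $ b) *s axis b 1" for x v
  have derG: "(G has_derivative L x) (at x)" if "x \<in> V" for x
    unfolding G_def L_def
  proof (intro has_derivative_add has_derivative_ident bounded_linear.has_derivative[OF bounded_linear_cscale]
      has_derivative_diff bounded_linear.has_derivative[OF bounded_linear_vec_nth])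
    show "(F has_derivative (*v) (jac F x)) (at x)" using holo_on_jac[OF F] that V by blast
  qed
  have linL: "L x (c *s v) = c *s L x v" for x c v
    by (simp add: L_def vec_mult_cscale vec_eq_iff algebra_simps)
  have hG: "holo_on G V" unfolding holo_on_def using derG linL V(1) by blast
  have injL: "inj ((*v) (jac G x))" if x: "x \<in> V" for x
    unfolding inj_matrix_iff
  proof (intro allI impI)
    fix v assume "jac G x *v v = 0"
    then have L0: "L x v = 0" using holo_deriv_jac[OF derG[OF x] linL] by simp
    have "v $ i = 0" if "i \<noteq> b" for i
      using arg_cong[OF L0, of "\<lambda>v. v $ i"] that by (simp add: L_def axis_def)
    then have v: "v = v $ b *s axis b 1" by (simp add: vec_eq_iff axis_def)
    have "L x v $ b = (jac F x *v v) $ a" by (simp add: L_def)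
    also have "\<dots> = (jac F x *v (v $ b *s axis b 1)) $ a" using v by simp
    also have "\<dots> = v $ b * D x" by (simp only: vec_mult_cscale) (simp add: mult_axis Djac)
    finally have "v $ b * D x = 0" using L0 by simp
    moreover have "D x \<noteq> 0" using DV[OF x] k by auto
    ultimately show "v = 0" using v by simp
  qed
  have "inj_on G V"
  proof (rule inj_onI)
    fix x y assume xy: "x \<in> V" "y \<in> V" "G x = G y"
    define t where "t = y $ b - x $ b"
    have "y $ i = x $ i" if "i \<noteq> b" for i using arg_cong[OF xy(3), of "\<lambda>v. v $ i"] Gi that by simp
    then have y: "y = x + t *s axis b 1" by (simp add: vec_eq_iff axis_def t_def)
    have "cmod ((F (x + t *s axis b 1) $ a - k * t) - (F (x + 0 *s axis b 1) $ a - k * 0)) \<le> cmod k / 2 * cmod (t - 0)"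
    proof (rule field_differentiable_bound[of "closed_segment 0 t" "\<lambda>s. F (x + s *s axis b 1) $ a - k * s"
          "\<lambda>s. D (x + s *s axis b 1) - k"])
      fix s assume s: "s \<in> closed_segment 0 t"
      then obtain u where u: "0 \<le> u" "u \<le> 1" "s = u *\<^sub>R t" by (auto simp: in_segment)
      have "x + s *s axis b 1 = (1 - u) *\<^sub>R x + u *\<^sub>R y"
        by (simp add: y u vec_eq_iff axis_def algebra_simps)
      then have xs: "x + s *s axis b 1 \<in> V" using convexD[OF V(4) xy(1,2), of "1 - u" u] u by simp
      show "((\<lambda>s. F (x + s *s axis b 1) $ a - k * s) has_field_derivative D (x + s *s axis b 1) - k) (at s within closed_segment 0 t)"
        unfolding D_def
        by (rule has_field_derivative_at_within[OF DERIV_diff[OF lineholo_has_derivative[OF hF] DERIV_cmult_Id]])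
          (use xs V(3) in blast)
      show "cmod (D (x + s *s axis b 1) - k) \<le> cmod k / 2" by (rule DV[OF xs])
    qed auto
    moreover have "F y $ a = F x $ a" using arg_cong[OF xy(3), of "\<lambda>v. v $ b"] Gb by simp
    ultimately have "cmod k * cmod t \<le> cmod k / 2 * cmod t" by (simp add: y norm_mult)
    then have "cmod t \<le> 0" using k by (simp add: mult_le_0_iff)
    then have "t = 0" by simp
    then show "x = y" using y by simp
  qed
  then show thesis using that V hG injL Gb Gi by blast
qed

text \<open>Induction on the number of coordinates that \<open>F\<close> does not preserve, after Rosay. At a critical point the
  block of partial derivatives in the remaining coordinates vanishes: a nonzero entry would allow one more
  coordinate to be straightened.\<close>
lemma injective_holo_regular_aux:
  fixes F :: "complex^'n \<Rightarrow> complex^'n"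
  assumes "card (- I) = k" "inj_on \<pi> I" "\<And>z i. z \<in> U \<Longrightarrow> i \<in> I \<Longrightarrow> F z $ \<pi> i = z $ i"
    "holo_on F U" "inj_on F U" "z \<in> U"
  shows "inj ((*v) (jac F z))"
  using assms
proof (induction k arbitrary: I \<pi> F U z)
  case 0
  then have I: "i \<in> I" for i by auto
  show ?case
    unfolding inj_matrix_iff
  proof (intro allI impI)
    fix v assume "jac F z *v v = 0"
    then show "v = 0"
      using jac_fixed_coordinate[OF 0(4,6) 0(3)[OF _ I], where v = v] by (simp add: vec_eq_iff)
  qed
next
  case (Suc k)
  note F = Suc.prems(4,5)
  have oU: "open U" using F by (simp add: holo_on_def)
  have regular: "inj ((*v) (jac F x))" if x: "x \<in> U" and ab: "a \<notin> \<pi> ` I" "b \<notin> I" "jac F x $ a $ b \<noteq> 0" for x a b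
  proof -
    obtain V G where V: "open V" "x \<in> V" "V \<subseteq> U" and G: "holo_on G V" "inj_on G V"
      "\<And>x. x \<in> V \<Longrightarrow> inj ((*v) (jac G x))" "\<And>x. G x $ b = F x $ a" "\<And>x i. i \<noteq> b \<Longrightarrow> G x $ i = x $ i"
      using straighten_coordinate[OF F(1) x ab(3)] by blast
    define H where "H = inv_into V G"
    have HG: "H (G y) = y" if "y \<in> V" for y using that G(2) by (simp add: H_def)
    have H: "holo_on H (G ` V)" unfolding H_def using holo_inverse[OF G(1-3)] by blast
    have HV: "H ` (G ` V) \<subseteq> V" using HG by auto
    define F' where "F' = F \<circ> H"
    have F': "holo_on F' (G ` V)" unfolding F'_def
      using holo_compose[OF H holo_on_subset[OF F(1) V(1,3)] HV] .
    have "inj ((*v) (jac F' (G x)))"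
    \<comment> \<open>In the straightened coordinates the source coordinate \<open>b\<close> is
      carried to the target coordinate \<open>a\<close>, so one more coordinate is
      preserved.\<close>
    proof (rule Suc.IH[of "insert b I" "\<pi>(b := a)" "G ` V"])
      have "- I = insert b (- insert b I)" using ab by auto
      then have "card (- I) = card (insert b (- insert b I))" by simp
      then have "card (- I) = Suc (card (- insert b I))" by (subst (asm) card_insert_disjoint) auto
      then show "card (- insert b I) = k" using Suc.prems(1) by simp
      show "inj_on (\<pi>(b := a)) (insert b I)"
        using Suc.prems(2) ab by (auto simp: inj_on_def)
      show "F' w $ (\<pi>(b := a)) i = w $ i" if "w \<in> G ` V" "i \<in> insert b I" for w i
        using that HG V(3) Suc.prems(3) ab(2) G(4,5) by (auto simp: F'_def)
      show "inj_on F' (G ` V)"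
        using F(2) HG V(3) by (auto simp: inj_on_def F'_def)
    qed (use F' V in auto)
    moreover have "jac F x *v v = jac F' (G x) *v (jac G x *v v)" for v
    proof -
      have "(F' \<circ> G has_derivative (*v) (jac F' (G x)) \<circ> (*v) (jac G x)) (at x)"
        using F' G(1) V(2) by (intro diff_chain_at holo_on_jac) auto
      then have "(F has_derivative (*v) (jac F' (G x)) \<circ> (*v) (jac G x)) (at x)"
        by (rule has_derivative_transform_within_open[OF _ V(1,2)]) (simp add: F'_def HG)
      moreover have "(F has_derivative (*v) (jac F x)) (at x)" by (rule holo_on_jac[OF F(1) x])
      ultimately have "(*v) (jac F' (G x)) \<circ> (*v) (jac G x) = (*v) (jac F x)" by (rule has_derivative_unique)
      from fun_cong[OF this, of v] show ?thesis by simp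
    qed
    ultimately have "(*v) (jac F x) = (*v) (jac F' (G x)) \<circ> (*v) (jac G x)" "inj ((*v) (jac F' (G x)))"
      by (simp_all add: fun_eq_iff)
    then show ?thesis using G(3)[OF V(2)] by (simp add: inj_compose)
  qed
  show ?case
  proof (rule ccontr)
    assume sing: "\<not> ?thesis"
    have block: "jac F x $ a $ b = 0" if "x \<in> U" "\<not> inj ((*v) (jac F x))" "a \<notin> \<pi> ` I" "b \<notin> I" for x a b
      using regular that by blast
    have "- I \<noteq> {}" using Suc.prems(1) by auto
    then obtain b where b: "b \<notin> I" by auto
    show False
    proof (cases "- I = {b}")
      \<comment> \<open>With one free coordinate left, all components except the \<open>a\<close>-th
        are constant along the direction \<open>b\<close>; that component is an injective function
        of one variable and so has nonzero derivative.\<close>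
      case True
      have cI: "card (\<pi> ` I) = card I" using Suc.prems(2) card_image by blast
      have "card I \<noteq> CARD('n)" using b card_subset_eq[of UNIV I] by auto
      then have "\<pi> ` I \<noteq> UNIV" using cI by auto
      then obtain a where a: "a \<notin> \<pi> ` I" by auto
      have "I = UNIV - {b}" using True by auto
      then have "card I = CARD('n) - 1" by (simp add: card_Diff_singleton)
      then have "card (insert a (\<pi> ` I)) = CARD('n)" using a cI zero_less_card_finite[where 'a='n] by simp
      then have all: "insert a (\<pi> ` I) = UNIV" by (intro card_subset_eq) auto
      obtain r where r: "r > 0" "ball z r \<subseteq> U" using oU Suc.prems(6) open_contains_ball by blast
      have inb: "z + t *s axis b 1 \<in> U" if "t \<in> ball 0 r" for t
        using that r(2) by (auto simp: norm_cscale dist_norm norm_axis_1 subset_iff)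
      have lh: "lineholo (\<lambda>z. F z $ a) U" by (rule holo_on_lineholo[OF F(1)])
      have "deriv (\<lambda>t. F (z + t *s axis b 1) $ a) 0 \<noteq> 0"
      proof (rule holomorphic_injective_imp_regular)
        show "(\<lambda>t. F (z + t *s axis b 1) $ a) holomorphic_on ball 0 r"
          using inb by (intro lineholo_line[OF lh]) auto
        show "inj_on (\<lambda>t. F (z + t *s axis b 1) $ a) (ball 0 r)"
        proof (rule inj_onI)
          fix s t assume st: "s \<in> ball 0 r" "t \<in> ball 0 r" "F (z + s *s axis b 1) $ a = F (z + t *s axis b 1) $ a"
          have "F (z + s *s axis b 1) $ j = F (z + t *s axis b 1) $ j" for j
          proof (cases "j = a")
            case False
            then obtain i where i: "i \<in> I" "j = \<pi> i" using all by auto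
            then have "i \<noteq> b" using b by auto
            then show ?thesis using Suc.prems(3)[OF inb[OF st(1)] i(1)] Suc.prems(3)[OF inb[OF st(2)] i(1)] i
              by (simp add: axis_def)
          qed (use st in simp)
          then have "F (z + s *s axis b 1) = F (z + t *s axis b 1)" by (simp add: vec_eq_iff)
          then have "z + s *s axis b 1 = z + t *s axis b 1" using F(2) inb st by (meson inj_onD)
          from arg_cong[OF this, of "\<lambda>v. v $ b"] show "s = t" by (simp add: axis_def)
        qed
      qed (use r in auto)
      then have "jac F z $ a $ b \<noteq> 0" by (simp add: jac_def ddir_def)
      then show False using block[OF Suc.prems(6) sing a b] by simp
    next
      case False
      \<comment> \<open>With two free coordinates the vanishing block makes the derivative kill both
        directions at every critical point, and the Jacobian determinant cuts out the critical
        points.\<close>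
      then obtain b' where b': "b' \<notin> I" "b' \<noteq> b" using b by blast
      have "\<not> inj_on F U"
      proof (rule critical_set_not_injective[of "\<lambda>x. det (jac F x)" U z F "axis b 1" "axis b' 1"])
        show "lineholo (\<lambda>x. det (jac F x)) U"
        proof (rule lineholo_det[OF oU])
          fix i j
          show "lineholo (\<lambda>z. jac F z $ i $ j) U"
            using lineholo_ddir[OF holo_on_lineholo[OF F(1)]] by (simp add: jac_def)
        qed
        show "det (jac F z) = 0" using sing by (simp add: inj_matrix_det)
        fix x assume x: "x \<in> U" "det (jac F x) = 0"
        then have nx: "\<not> inj ((*v) (jac F x))" by (simp add: inj_matrix_det)
        have "jac F x *v (s *s axis b 1 + t *s axis b' 1) = 0" for s t
        proof -
          have "(jac F x *v (s *s axis b 1 + t *s axis b' 1)) $ j = 0" for j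
          proof (cases "j \<in> \<pi> ` I")
            case True
            then obtain i where i: "i \<in> I" "j = \<pi> i" by auto
            then have "i \<noteq> b" "i \<noteq> b'" using b b' by auto
            then show ?thesis
              using jac_fixed_coordinate[OF F(1) x(1) Suc.prems(3)[OF _ i(1)]] i by (simp add: axis_def)
          next
            case False
            then show ?thesis using block[OF x(1) nx False b] block[OF x(1) nx False b'(1)]
              by (simp add: matrix_vector_right_distrib vec_mult_cscale mult_axis)
          qed
          then show ?thesis by (simp add: vec_eq_iff)
        qed
        then show "\<exists>L. (F has_derivative L) (at x) \<and> (\<forall>s t. L (s *s axis b 1 + t *s axis b' 1) = 0)"
          using holo_on_jac[OF F(1) x(1)] by blast
      next
        fix s t assume "s *s axis b 1 + t *s axis b' 1 = (0 :: complex^'n)"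
        then have "\<forall>i. (s *s axis b 1 + t *s axis b' 1 :: complex^'n) $ i = 0" by simp
        from spec[OF this, of b] spec[OF this, of b'] show "s = 0 \<and> t = 0"
          using b' by (simp add: axis_def)
      qed (use Suc.prems in auto)
      then show False using F by blast
    qed
  qed
qed

theorem injective_holo_regular:
  fixes F :: "complex^'n \<Rightarrow> complex^'n"
  assumes "holo_on F U" "inj_on F U" "z \<in> U"
  shows "inj ((*v) (jac F z))"
  using injective_holo_regular_aux[of "{}", OF refl _ _ assms] by simp

section \<open>Holomorphic maps near the puncture\<close>

text \<open>Pairing with the fixed vector \<open>h x\<close> reduces the claim to the scalar maximum
  principle.\<close>

lemma vector_maximum_modulus:
  fixes h :: "complex \<Rightarrow> complex^'n"
  assumes hol: "\<And>i. (\<lambda>t. h t $ i) holomorphic_on S" and S: "cball c r \<subseteq> S" "r > 0"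
    and B: "\<And>t. t \<in> sphere c r \<Longrightarrow> norm (h t) \<le> B" and x: "x \<in> cball c r"
  shows "norm (h x) \<le> B"
proof (cases "h x = 0")
  case True
  have "c + of_real r \<in> sphere c r" using S by (simp add: dist_norm)
  then show ?thesis using order_trans[OF norm_ge_zero B[of "c + of_real r"]] True by simp
next
  case False
  define \<phi> where "\<phi> t = herm (h t) (h x)" for t
  have hol\<phi>: "\<phi> holomorphic_on S" unfolding \<phi>_def herm_def by (intro holomorphic_intros hol)
  have "norm (\<phi> x) \<le> B * norm (h x)"
  proof (rule maximum_modulus_frontier[of \<phi> "cball c r"])
    show "\<phi> holomorphic_on interior (cball c r)"
      using S interior_subset by (intro holomorphic_on_subset[OF hol\<phi>]) blast
    show "continuous_on (closure (cball c r)) \<phi>"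
      using S holomorphic_on_imp_continuous_on[OF hol\<phi>] continuous_on_subset by auto
    fix t assume "t \<in> frontier (cball c r)"
    then have "t \<in> sphere c r" using S by (simp add: frontier_cball)
    then have "norm (h t) * norm (h x) \<le> B * norm (h x)" by (intro mult_right_mono B) auto
    then show "norm (\<phi> t) \<le> B * norm (h x)" unfolding \<phi>_def using cmod_herm_le order_trans by blast
  qed (use x in auto)
  moreover have "norm (\<phi> x) = norm (h x) * norm (h x)"
    by (simp add: \<phi>_def herm_self norm_mult power2_eq_square)
  ultimately show ?thesis using False by simp
qed

lemma orthogonal_unit_vector:
  fixes z :: "complex^'n"
  assumes "CARD('n) \<ge> 2"
  obtains w where "norm w = 1" "herm z w = 0"
proof -
  have "\<exists>i j :: 'n. i \<noteq> j"
  proof (rule ccontr)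
    assume "\<not> ?thesis"
    then have "(UNIV :: 'n set) = {undefined}" by blast
    then have "CARD('n) = card {undefined :: 'n}" by (rule arg_cong)
    then show False using assms by simp
  qed
  then obtain i j :: 'n where ij: "i \<noteq> j" by blast
  \<comment> \<open>The vector orthogonal to \<open>z\<close> in the plane of two coordinates,
    before normalization; if \<open>z\<close> vanishes in both, a coordinate vector does.\<close>
  define w :: "complex^'n" where
    "w = (if z $ i = 0 \<and> z $ j = 0 then axis i 1 else cnj (z $ j) *s axis i 1 + (- cnj (z $ i)) *s axis j 1)"
  have "herm z w = (\<Sum>k\<in>{i, j}. z $ k * cnj (w $ k))"
    unfolding herm_def by (rule sum.mono_neutral_right) (auto simp: w_def axis_def)
  then have h: "herm z w = 0" using ij by (auto simp: w_def axis_def)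
  have "w $ i \<noteq> 0 \<or> w $ j \<noteq> 0" using ij by (auto simp: w_def axis_def)
  then have "norm w \<noteq> 0" by auto
  then have "norm (of_real (inverse (norm w)) *s w) = 1"
    unfolding norm_cscale norm_of_real by simp
  moreover have "herm z (of_real (inverse (norm w)) *s w) = 0" by (simp add: herm_scale_right h)
  ultimately show thesis by (rule that)
qed

lemma norm_orthogonal:
  assumes "norm w = 1" "herm z w = 0"
  shows "(norm (z + t *s w))\<^sup>2 = (norm z)\<^sup>2 + (cmod t)\<^sup>2"
proof -
  have "z \<bullet> (t *s w) = 0" using assms by (simp add: Re_herm[symmetric] herm_scale_right)
  then show ?thesis using assms
    by (simp add: power2_norm_eq_inner inner_add inner_commute) (simp add: norm_cscale flip: power2_norm_eq_inner)
qed

text \<open>A disc through \<open>z\<close> in a direction orthogonal to \<open>z\<close> avoids the puncture, so the maximum principle on it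
  replaces Hartogs' extension theorem.\<close>
lemma slice_maximum:
  fixes f :: "complex^'n \<Rightarrow> complex^'n"
  assumes n: "CARD('n) \<ge> 2" and f: "holo_on f (- {0})"
    and B: "\<And>y. norm y = R \<Longrightarrow> norm (f y) \<le> B" and z: "z \<noteq> 0" "norm z \<le> R"
  shows "norm (f z) \<le> B"
proof (cases "norm z = R")
  case False
  obtain w where w: "norm w = 1" "herm z w = 0" using orthogonal_unit_vector[OF n] .
  \<comment> \<open>By Pythagoras the boundary of the disc of this radius lies on the sphere of
    radius \<open>R\<close>.\<close>
  define \<rho> where "\<rho> = sqrt (R\<^sup>2 - (norm z)\<^sup>2)"
  have lt: "norm z < R" using False z by simp
  then have "(norm z)\<^sup>2 < R\<^sup>2" by (intro power_strict_mono) auto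
  then have \<rho>: "\<rho> > 0" "\<rho>\<^sup>2 = R\<^sup>2 - (norm z)\<^sup>2" by (auto simp: \<rho>_def)
  have nz: "z + t *s w \<noteq> 0" for t
  proof
    assume "z + t *s w = 0"
    then have "(norm z)\<^sup>2 + (cmod t)\<^sup>2 = 0" using norm_orthogonal[OF w, of t] by simp
    then show False using z by (simp add: sum_power2_eq_zero_iff)
  qed
  have "norm (f (z + 0 *s w)) \<le> B"
  proof (rule vector_maximum_modulus[of "\<lambda>t. f (z + t *s w)" UNIV 0 \<rho>])
    show "(\<lambda>t. f (z + t *s w) $ i) holomorphic_on UNIV" for i
      using nz by (intro lineholo_line[OF holo_on_lineholo[OF f]]) auto
    fix t :: complex assume "t \<in> sphere 0 \<rho>"
    then have "(norm (z + t *s w))\<^sup>2 = R\<^sup>2" using norm_orthogonal[OF w, of t] \<rho> by simp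
    then have "norm (z + t *s w) = R"
      using order_trans[OF norm_ge_zero z(2)] by (simp add: power2_eq_iff_nonneg)
    then show "norm (f (z + t *s w)) \<le> B" by (rule B)
  qed (use \<rho> in auto)
  then show ?thesis by simp
qed (use B in auto)

lemma bounded_near_puncture:
  fixes f :: "complex^'n \<Rightarrow> complex^'n"
  assumes n: "CARD('n) \<ge> 2" and f: "holo_on f (- {0})"
  obtains B where "\<And>z. z \<noteq> 0 \<Longrightarrow> norm z \<le> R \<Longrightarrow> norm (f z) \<le> B"
proof (cases "R > 0")
  case True
  have "compact (f ` sphere 0 R)"
    using True by (intro compact_continuous_image continuous_on_subset[OF holo_on_continuous[OF f]]) auto
  then have "bounded (f ` sphere 0 R)" by (rule compact_imp_bounded)
  then have "\<exists>B. \<forall>x\<in>sphere 0 R. norm (f x) \<le> B" unfolding bounded_iff by simp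
  then obtain B where "\<And>y. norm y = R \<Longrightarrow> norm (f y) \<le> B" by (metis mem_sphere_0)
  then show thesis using that slice_maximum[OF n f] by blast
next
  case False
  have "\<not> norm z \<le> R" if "z \<noteq> 0" for z :: "complex^'n"
    using False that by (metis order_less_le_trans zero_less_norm_iff)
  then show thesis using that by blast
qed

text \<open>Near the puncture \<open>f\<close> is bounded. Those values that stay away from 0 lie in
  a compact shell, whose image under the inverse \<open>g\<close> is compact and avoids 0, so they
  cannot arise from points close to 0.\<close>

lemma automorphism_tendsto_0:
  fixes f :: "complex^'n \<Rightarrow> complex^'n"
  assumes n: "CARD('n) \<ge> 2" and f: "holo_on f (- {0})" and g: "holo_on g (- {0})"
    and nz: "\<And>z. z \<noteq> 0 \<Longrightarrow> g z \<noteq> 0" and gf: "\<And>z. z \<noteq> 0 \<Longrightarrow> g (f z) = z" and f0: "f 0 = 0"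
  shows "continuous_on UNIV f"
proof -
  obtain B where B: "\<And>z. z \<noteq> 0 \<Longrightarrow> norm z \<le> 1 \<Longrightarrow> norm (f z) \<le> B" 
    using bounded_near_puncture[OF n f] by blast
  have "isCont f 0"
    unfolding continuous_at_eps_delta
  proof (intro allI impI)
    fix e :: real assume e: "e > 0"
    define A where "A = cball 0 B - ball (0::complex^'n) e"
    have "compact A" unfolding A_def by (simp add: compact_diff)
    moreover have "continuous_on A g"
      using e by (intro continuous_on_subset[OF holo_on_continuous[OF g]]) (auto simp: A_def)
    ultimately have "closed (g ` A)" by (simp add: compact_continuous_image compact_imp_closed)
    moreover have "y \<noteq> 0" if "y \<in> A" for y using that e by (auto simp: A_def)
    then have "0 \<notin> g ` A" using nz by force
    ultimately obtain d where d: "d > 0" "\<And>y. y \<in> g ` A \<Longrightarrow> d \<le> dist 0 y"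
      using separate_point_closed by metis
    have "norm (f z) < e" if z: "norm z < min 1 d" for z
    proof (cases "z = 0")
      case False
      show ?thesis
      proof (rule ccontr)
        assume "\<not> ?thesis"
        then have "f z \<in> A" using B[OF False] z by (auto simp: A_def)
        then have "d \<le> dist 0 z" using d(2) gf[OF False] by force
        then show False using z by simp
      qed
    qed (use e f0 in simp)
    then show "\<exists>d>0. \<forall>x'. dist x' 0 < d \<longrightarrow> dist (f x') (f 0) < e"
      using d f0 by (intro exI[of _ "min 1 d"]) auto
  qed
  moreover have "isCont f z" if "z \<noteq> 0" for z
    using holo_on_continuous[OF f] that continuous_on_eq_continuous_at[of "- {0}" f, OF open_Compl[OF closed_singleton]]
    by simp
  ultimately show ?thesis by (metis continuous_at_imp_continuous_on)
qed

text \<open>A complex line meets the origin in at most one parameter value, and continuity makes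
  that singularity removable.\<close>

lemma lineholo_across_puncture:
  assumes f: "holo_on f (- {0})" and c: "continuous_on UNIV f"
  shows "lineholo (\<lambda>z. f z $ i) UNIV"
  unfolding lineholo_def
proof (intro conjI allI)
  show "continuous_on UNIV (\<lambda>z. f z $ i)" using c by (intro continuous_intros)
  fix z v
  show "(\<lambda>t. f (z + t *s v) $ i) holomorphic_on {t. z + t *s v \<in> UNIV}"
  proof (cases "v = 0")
    case False
    define K where "K = {t. z + t *s v = 0}"
    obtain j where j: "v $ j \<noteq> 0" using False by (auto simp: vec_eq_iff)
    have "K \<subseteq> {- (z $ j) / v $ j}"
    proof
      fix t assume "t \<in> K"
      then have "(z + t *s v) $ j = 0" by (simp only: K_def mem_Collect_eq zero_index)
      then have "t * v $ j = - (z $ j)" by (simp add: add_eq_0_iff)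
      then show "t \<in> {- (z $ j) / v $ j}" using j by (simp add: field_simps)
    qed
    then have "finite K" using finite_subset by blast
    moreover have "continuous_on UNIV (\<lambda>t. f (z + t *s v) $ i)"
      by (intro continuous_on_compose2[OF c] continuous_intros) auto
    moreover have "(\<lambda>t. f (z + t *s v) $ i) holomorphic_on (UNIV - K)"
      by (intro lineholo_line[OF holo_on_lineholo[OF f]]) (auto simp: K_def)
    ultimately show ?thesis using no_isolated_singularity[of UNIV _ K] by simp
  qed simp
qed simp

section \<open>The derivative at the origin and quadratic estimates\<close>

lemma ddir_scale:
  assumes H: "lineholo H U" and p: "p \<in> U"
  shows "ddir (c *s v) H p = c * ddir v H p"
proof -
  have "((\<lambda>t. H (p + t *s v)) has_field_derivative ddir v H p) (at (c * 0))"
    using lineholo_has_derivative[OF H, of p "c * 0" v] p by simp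
  from DERIV_chain2[of "\<lambda>t. H (p + t *s v)" _ "\<lambda>t. c * t" 0 c UNIV, OF this]
  have "((\<lambda>t. H (p + (c * t) *s v)) has_field_derivative ddir v H p * c) (at 0)"
    by (simp add: DERIV_cmult_Id)
  moreover have "(c * t) *s v = t *s (c *s v)" for t by (simp add: mult.commute)
  ultimately have "((\<lambda>t. H (p + t *s (c *s v))) has_field_derivative ddir v H p * c) (at 0)" by (simp only:)
  then show ?thesis unfolding ddir_def[of "c *s v"] by (simp add: DERIV_imp_deriv mult.commute)
qed

text \<open>Membership in \<open>lineholo\<close> does not include a joint derivative, so additivity
  needs an argument: the mean value inequality in direction \<open>v\<close> from the moving base
  point \<open>p + t *s w\<close>, with the continuity of the directional derivative.\<close>

lemma ddir_add:
  assumes H: "lineholo H U" and p: "p \<in> U"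
  shows "ddir (v + w) H p = ddir v H p + ddir w H p"
proof -
  have oU: "open U" using H by (simp add: lineholo_def)
  define k where "k = ddir v H p"
  define D where "D = ddir (v + w) H p - ddir w H p - k"
  have d1: "((\<lambda>t. H (p + t *s (v + w))) has_field_derivative ddir (v + w) H p) (at 0)"
    and d2: "((\<lambda>t. H (p + t *s w)) has_field_derivative ddir w H p) (at 0)"
    using lineholo_has_derivative[OF H, of p 0 "v + w"] lineholo_has_derivative[OF H, of p 0 w] p
    by simp_all
  have "((\<lambda>t. H (p + t *s (v + w)) - H (p + t *s w) - k * t) has_field_derivative D) (at 0)"
    unfolding D_def by (intro DERIV_diff d1 d2 DERIV_cmult_Id)
  then have lim: "(\<lambda>t. (H (p + t *s (v + w)) - H (p + t *s w) - k * t) / t) \<midarrow>0\<rightarrow> D"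
    by (simp add: DERIV_def)
  have "(\<lambda>t. (H (p + t *s (v + w)) - H (p + t *s w) - k * t) / t) \<midarrow>0\<rightarrow> 0"
    unfolding LIM_eq
  proof (intro allI impI)
    fix e :: real assume e: "e > 0"
    have "continuous_on U (ddir v H)" using lineholo_ddir[OF H] by (simp add: lineholo_def)
    then have "isCont (ddir v H) p" using oU p by (simp add: continuous_on_eq_continuous_at)
    then obtain d0 where d0: "d0 > 0" "\<And>q. dist q p < d0 \<Longrightarrow> dist (ddir v H q) k < e / 2"
      using e unfolding continuous_at_eps_delta k_def by (meson half_gt_zero)
    obtain d1 where d1: "d1 > 0" "ball p d1 \<subseteq> U" using oU p open_contains_ball by blast
    define d where "d = min d0 d1 / (norm v + norm w + 1)"
    have nn: "norm v + norm w + 1 > 0" by (simp add: add_nonneg_pos)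
    have d: "d > 0" using d0 d1 nn by (simp add: d_def)
    have near: "dist (p + t *s w + s *s v) p < min d0 d1" if "cmod t < d" "cmod s \<le> cmod t" for s t :: complex
    proof -
      have "dist (p + t *s w + s *s v) p = norm (t *s w + s *s v)" by (simp add: dist_norm)
      also have "\<dots> \<le> cmod t * norm w + cmod s * norm v"
        using norm_triangle_ineq[of "t *s w" "s *s v"] by (simp only: norm_cscale)
      also have "\<dots> \<le> cmod t * norm w + cmod t * norm v"
        using that by (intro add_left_mono mult_right_mono) auto
      also have "\<dots> \<le> cmod t * (norm v + norm w + 1)" by (simp add: algebra_simps)
      also have "\<dots> < d * (norm v + norm w + 1)" using that nn by (intro mult_strict_right_mono)
      also have "\<dots> = min d0 d1" using nn by (simp add: d_def)
      finally show ?thesis .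
    qed
    have "norm ((H (p + t *s (v + w)) - H (p + t *s w) - k * t) / t) < e" if t: "t \<noteq> 0" "cmod t < d" for t
    proof -
      have "cmod ((H (p + t *s w + t *s v) - k * t) - (H (p + t *s w + 0 *s v) - k * 0)) \<le> e / 2 * cmod (t - 0)"
      proof (rule field_differentiable_bound[of "cball 0 (cmod t)" "\<lambda>s. H (p + t *s w + s *s v) - k * s"
            "\<lambda>s. ddir v H (p + t *s w + s *s v) - k"])
        fix s :: complex assume "s \<in> cball 0 (cmod t)"
        then have s: "cmod s \<le> cmod t" by simp
        have "p + t *s w + s *s v \<in> U" using near[OF t(2) s] d1 by (auto simp: dist_commute)
        then show "((\<lambda>s. H (p + t *s w + s *s v) - k * s) has_field_derivative ddir v H (p + t *s w + s *s v) - k)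
            (at s within cball 0 (cmod t))"
          by (rule has_field_derivative_at_within[OF DERIV_diff[OF lineholo_has_derivative[OF H] DERIV_cmult_Id]])
        show "cmod (ddir v H (p + t *s w + s *s v) - k) \<le> e / 2"
          using d0(2) near[OF t(2) s] by (simp add: dist_norm less_imp_le)
      qed auto
      then have "cmod (H (p + t *s (v + w)) - H (p + t *s w) - k * t) \<le> e / 2 * cmod t"
        by (simp add: algebra_simps)
      also have "\<dots> < e * cmod t" using e t by simp
      finally show ?thesis using t by (simp add: norm_divide divide_less_eq)
    qed
    then show "\<exists>s>0. \<forall>x. x \<noteq> 0 \<and> norm (x - 0) < s \<longrightarrow>
        norm ((H (p + x *s (v + w)) - H (p + x *s w) - k * x) / x - 0) < e"
      using d by auto
  qed
  with lim have "D = 0" by (rule LIM_unique)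
  then show ?thesis by (simp add: D_def k_def diff_eq_eq)
qed

lemma ddir_linear:
  assumes H: "lineholo H U" and p: "p \<in> U"
  shows "ddir v H p = (\<Sum>j\<in>UNIV. v $ j * ddir (axis j 1) H p)"
proof -
  have "ddir (\<Sum>j\<in>J. v $ j *s axis j 1) H p = (\<Sum>j\<in>J. v $ j * ddir (axis j 1) H p)" for J
  proof (induction J rule: infinite_finite_induct)
    case empty
    show ?case by (simp add: ddir_def)
  next
    case (insert j J)
    then show ?case by (simp only: sum.insert ddir_add[OF H p] ddir_scale[OF H p] simp_thms if_False)
  qed (simp add: ddir_def)
  from this[of UNIV] show ?thesis by (simp only: vec_axis_sum[symmetric])
qed

lemma quadratic_bound_scalar:
  assumes H: "lineholo H UNIV"
  shows "\<exists>C\<ge>0. \<forall>z. norm z \<le> 1 \<longrightarrow> cmod (H z - H 0 - ddir z H 0) \<le> C * (norm z)\<^sup>2"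
proof -
  have "continuous_on UNIV H" using H by (simp add: lineholo_def)
  then have "compact (H ` cball 0 2)" by (intro compact_continuous_image[OF continuous_on_subset]) auto
  then have "bounded (H ` cball 0 2)" by (rule compact_imp_bounded)
  then have "\<exists>B. \<forall>x\<in>cball 0 2. cmod (H x) \<le> B" unfolding bounded_iff by simp
  then obtain B where B: "\<And>z. norm z \<le> 2 \<Longrightarrow> cmod (H z) \<le> B" by (metis mem_cball_0)
  have B0: "B \<ge> 0" using order_trans[OF norm_ge_zero B[of 0]] by simp
  have "cmod (H z - H 0 - ddir z H 0) \<le> 2 * B * (norm z)\<^sup>2" if z: "norm z \<le> 1" for z
  proof (cases "z = 0")
    case False
    define u where "u = of_real (inverse (norm z)) *s z"
    have u: "norm u = 1" using False unfolding u_def norm_cscale norm_of_real by simp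
    have zu: "of_real (norm z) *s u = z" using False by (simp add: u_def vec_eq_iff)
    have "cmod (H (0 + of_real (norm z) *s u) - H (0 + 0 *s u) - deriv (\<lambda>t. H (0 + t *s u)) 0 * (of_real (norm z) - 0))
        \<le> 2 * B / 1\<^sup>2 * (cmod (of_real (norm z) - 0))\<^sup>2"
    proof (rule taylor2)
      show "(\<lambda>t. H (0 + t *s u)) holomorphic_on UNIV" by (rule lineholo_line[OF H]) simp
      show "cmod (H (0 + t *s u)) \<le> B" if "t \<in> cball 0 (2 * 1)" for t
        using that by (intro B) (simp add: norm_cscale u)
    qed (use z in auto)
    moreover have "deriv (\<lambda>t. H (0 + t *s u)) 0 * of_real (norm z) = ddir z H 0"
      using ddir_scale[OF H, of 0 "of_real (norm z)" u] zu by (simp add: ddir_def mult.commute)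
    ultimately show ?thesis by (simp add: zu)
  qed (simp add: ddir_def)
  then show ?thesis using B0 by (intro exI[of _ "2 * B"]) auto
qed

lemma jac_mult_vec:
  assumes "\<And>i. lineholo (\<lambda>z. f z $ i) U" "p \<in> U"
  shows "(jac f p *v v) $ i = ddir v (\<lambda>z. f z $ i) p"
  using ddir_linear[OF assms(1)[of i] assms(2), of v]
  by (simp add: jac_def matrix_vector_mult_def mult.commute)

lemma quadratic_bound:
  fixes f :: "complex^'n \<Rightarrow> complex^'m"
  assumes H: "\<And>i. lineholo (\<lambda>z. f z $ i) UNIV"
  obtains C where "C \<ge> 0" "\<And>z. norm z \<le> 1 \<Longrightarrow> norm (f z - f 0 - jac f 0 *v z) \<le> C * (norm z)\<^sup>2"
proof -
  have "\<forall>i. \<exists>C\<ge>0. \<forall>z. norm z \<le> 1 \<longrightarrow> cmod (f z $ i - f 0 $ i - ddir z (\<lambda>z. f z $ i) 0) \<le> C * (norm z)\<^sup>2"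
    using quadratic_bound_scalar[OF H] by blast
  then obtain C where C: "\<And>i. C i \<ge> 0" "\<And>i z. norm z \<le> 1 \<Longrightarrow> cmod (f z $ i - f 0 $ i - ddir z (\<lambda>z. f z $ i) 0) \<le> C i * (norm z)\<^sup>2"
    by metis
  have "norm (f z - f 0 - jac f 0 *v z) \<le> (\<Sum>i\<in>UNIV. C i) * (norm z)\<^sup>2" if "norm z \<le> 1" for z
  proof -
    have "norm (f z - f 0 - jac f 0 *v z) \<le> (\<Sum>i\<in>UNIV. cmod ((f z - f 0 - jac f 0 *v z) $ i))"
      by (rule norm_vec_le_sum)
    also have "\<dots> \<le> (\<Sum>i\<in>UNIV. C i * (norm z)\<^sup>2)"
      using C(2)[OF that] by (intro sum_mono) (simp add: jac_mult_vec[OF H])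
    finally show ?thesis by (simp add: sum_distrib_right)
  qed
  then show thesis using that[of "\<Sum>i\<in>UNIV. C i"] C(1) by (simp add: sum_nonneg)
qed

text \<open>Supplies the derivative at the origin, the point that \<open>holo_on\<close> on the
  punctured space leaves out. Taylor's bound along lines is uniform in the direction.\<close>

lemma lineholo_has_derivative_0:
  fixes f :: "complex^'n \<Rightarrow> complex^'m"
  assumes H: "\<And>i. lineholo (\<lambda>z. f z $ i) UNIV"
  shows "(f has_derivative (*v) (jac f 0)) (at 0)"
  unfolding has_derivative_at_alt
proof (intro conjI allI impI)
  show "bounded_linear ((*v) (jac f 0))" by (simp add: matrix_vector_mul_linear linear_conv_bounded_linear[symmetric])
  fix e :: real assume e: "e > 0"
  obtain C where C: "C \<ge> 0" "\<And>z. norm z \<le> 1 \<Longrightarrow> norm (f z - f 0 - jac f 0 *v z) \<le> C * (norm z)\<^sup>2"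
    using quadratic_bound[OF H] by blast
  define d where "d = min 1 (e / (C + 1))"
  have d: "d > 0" using e C by (simp add: d_def)
  have "norm (f y - f 0 - jac f 0 *v (y - 0)) \<le> e * norm (y - 0)" if "norm (y - 0) < d" for y
  proof -
    have y: "norm y \<le> 1" "norm y \<le> e / (C + 1)" using that by (auto simp: d_def)
    then have "C * norm y \<le> (C + 1) * (e / (C + 1))" using C e by (intro mult_mono) auto
    also have "\<dots> = e" using C by simp
    finally have "C * (norm y)\<^sup>2 \<le> e * norm y" by (simp add: power2_eq_square mult_right_mono flip: mult.assoc)
    then show ?thesis using C(2)[OF y(1)] by simp
  qed
  then show "\<exists>d>0. \<forall>y. norm (y - 0) < d \<longrightarrow> norm (f y - f 0 - jac f 0 *v (y - 0)) \<le> e * norm (y - 0)"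
    using d by blast
qed

text \<open>Quadratic vanishing makes the Lipschitz constant proportional to \<open>r\<close>: on a
  ball of radius \<open>2 * r\<close> the function is at most \<open>C * (2 * r)\<^sup>2\<close>,
  and Cauchy's estimate loses one factor \<open>r\<close>.\<close>

lemma lineholo_lipschitz:
  assumes H: "lineholo H UNIV" and C: "C \<ge> 0" "\<And>z. norm z \<le> 1 \<Longrightarrow> cmod (H z) \<le> C * (norm z)\<^sup>2"
    and r: "0 < r" "r \<le> 1/2" and xy: "norm x < r" "norm y < r"
  shows "cmod (H y - H x) \<le> 4 * C * r * norm (y - x)"
proof (cases "x = y")
  case False
  define w where "w = y - x"
  have w: "norm w > 0" using False by (simp add: w_def)
  define \<rho> where "\<rho> = r / norm w"
  have \<rho>: "\<rho> > 0" using r w by (simp add: \<rho>_def)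
  have "cmod (H (x + 1 *s w) - H (x + 0 *s w)) \<le> (4 * C * r * norm w) * cmod (1 - 0)"
  proof (rule field_differentiable_bound[of "closed_segment 0 1" "\<lambda>s. H (x + s *s w)" "\<lambda>s. ddir w H (x + s *s w)"])
    fix s :: complex assume "s \<in> closed_segment 0 1"
    then obtain u where u: "0 \<le> u" "u \<le> 1" "s = of_real u" by (auto simp: in_segment scaleR_conv_of_real)
    show "((\<lambda>s. H (x + s *s w)) has_field_derivative ddir w H (x + s *s w)) (at s within closed_segment 0 1)"
      by (rule has_field_derivative_at_within[OF lineholo_has_derivative[OF H]]) simp
    have "x + s *s w = (1 - u) *\<^sub>R x + u *\<^sub>R y"
      by (simp add: w_def u vec_eq_iff algebra_simps) (simp add: scaleR_conv_of_real algebra_simps)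
    then have p: "norm (x + s *s w) < r" using convexD[OF convex_ball[of 0 r], of x y "1 - u" u] u xy by simp
    have "cmod ((deriv ^^ 1) (\<lambda>t. H (x + s *s w + t *s w)) 0) \<le> fact 1 * (C * (2 * r)\<^sup>2) / \<rho> ^ 1"
    proof (rule Cauchy_inequality)
      have hol: "(\<lambda>t. H (x + s *s w + t *s w)) holomorphic_on UNIV" by (rule lineholo_line[OF H]) simp
      show "(\<lambda>t. H (x + s *s w + t *s w)) holomorphic_on ball 0 \<rho>" using hol holomorphic_on_subset by blast
      show "continuous_on (cball 0 \<rho>) (\<lambda>t. H (x + s *s w + t *s w))"
        using holomorphic_on_imp_continuous_on[OF hol] continuous_on_subset by blast
      fix t assume "cmod (0 - t) = \<rho>"
      then have "norm (t *s w) = r" using w by (simp add: norm_cscale \<rho>_def)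
      then have n: "norm (x + s *s w + t *s w) \<le> 2 * r"
        using norm_triangle_ineq[of "x + s *s w" "t *s w"] p by linarith
      then have "cmod (H (x + s *s w + t *s w)) \<le> C * (norm (x + s *s w + t *s w))\<^sup>2" using r by (intro C(2)) linarith
      also have "\<dots> \<le> C * (2 * r)\<^sup>2" using n C(1) by (intro mult_left_mono power_mono) auto
      finally show "cmod (H (x + s *s w + t *s w)) \<le> C * (2 * r)\<^sup>2" .
    qed fact
    then show "cmod (ddir w H (x + s *s w)) \<le> 4 * C * r * norm w"
      using r w by (simp add: ddir_def \<rho>_def power2_eq_square field_simps)
  qed auto
  then show ?thesis by (simp add: w_def)
qed simp

text \<open>The average \<open>\<phi>\<close> of the iterates satisfies \<open>\<phi> \<circ> f = \<phi>\<close> and is injective near the origin, because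
  \<open>\<psi> = \<phi> - id\<close> is a contraction there.\<close>
lemma finite_order_tangent_identity:
  fixes f :: "complex^'n \<Rightarrow> complex^'n"
  assumes H: "\<And>k i. lineholo (\<lambda>z. (f ^^ k) z $ i) UNIV" and f0: "f 0 = 0"
    and jac1: "\<And>k. jac (f ^^ k) 0 = mat 1" and m: "m > 0" "f ^^ m = id"
  shows "f z = z"
proof -
  have f0k: "(f ^^ k) 0 = 0" for k by (induction k) (auto simp: f0)
  define \<psi> where "\<psi> z = (1 / of_nat m) *s (\<Sum>k<m. (f ^^ k) z) - z" for z
  have H1: "lineholo (\<lambda>z. f z $ i) UNIV" for i using H[of 1] by simp
  have Hid: "lineholo (\<lambda>z :: complex^'n. z $ i) UNIV" for i using H[of 0] by simp
  have H\<psi>: "lineholo (\<lambda>z. \<psi> z $ i) UNIV" for i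
  proof -
    have "lineholo (\<lambda>z. (1 / of_nat m) * (\<Sum>k<m. (f ^^ k) z $ i) - z $ i) UNIV"
      by (intro lineholo_diff lineholo_mult lineholo_const lineholo_sum H Hid) auto
    then show ?thesis by (simp add: \<psi>_def)
  qed
  have "\<forall>k. \<exists>C\<ge>0. \<forall>z. norm z \<le> 1 \<longrightarrow> norm ((f ^^ k) z - z) \<le> C * (norm z)\<^sup>2"
  proof
    fix k
    show "\<exists>C\<ge>0. \<forall>z. norm z \<le> 1 \<longrightarrow> norm ((f ^^ k) z - z) \<le> C * (norm z)\<^sup>2"
      using quadratic_bound[OF H, of k] by (auto simp: f0k jac1)
  qed
  then obtain C where C: "\<And>k. C k \<ge> 0" "\<And>k z. norm z \<le> 1 \<Longrightarrow> norm ((f ^^ k) z - z) \<le> C k * (norm z)\<^sup>2"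
    by metis
  define C' where "C' = (\<Sum>k<m. C k)"
  have C'0: "C' \<ge> 0" using C by (simp add: C'_def sum_nonneg)
  have \<psi>C: "norm (\<psi> z) \<le> C' * (norm z)\<^sup>2" if z: "norm z \<le> 1" for z
  proof -
    have "(\<Sum>k<m. z) = of_nat m *s z"
    proof (induction m)
      case (Suc m)
      then show ?case by (simp add: vector_sadd_rdistrib add.commute del: sum_constant)
    qed simp
    then have "\<psi> z = (1 / of_nat m) *s (\<Sum>k<m. (f ^^ k) z - z)"
      using m by (simp only: \<psi>_def sum_subtractf vector_ssub_ldistrib) simp
    then have "norm (\<psi> z) = 1 / real m * norm (\<Sum>k<m. (f ^^ k) z - z)"
      by (simp only: norm_cscale norm_divide norm_of_nat norm_one)
    also have "\<dots> \<le> 1 / real m * (\<Sum>k<m. C k * (norm z)\<^sup>2)"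
      using C(2)[OF z] by (intro mult_left_mono sum_norm_le) auto
    also have "\<dots> \<le> 1 * (\<Sum>k<m. C k * (norm z)\<^sup>2)"
      using m C by (intro mult_right_mono sum_nonneg) auto
    finally show ?thesis by (simp add: C'_def sum_distrib_right)
  qed
  have \<psi>i: "cmod (\<psi> z $ i) \<le> C' * (norm z)\<^sup>2" if "norm z \<le> 1" for z i
    using \<psi>C[OF that] Finite_Cartesian_Product.norm_nth_le order_trans by blast
  define n where "n = real CARD('n)"
  have n: "n > 0" by (simp add: n_def)
  \<comment> \<open>Makes \<open>4 * C' * r * n\<close> at most 1/2, the factor \<open>n\<close>
    coming from the sum over coordinates; the summand 8 keeps the denominator positive.\<close>
  define r where "r = min (1/2) (1 / (8 * C' * n + 8))"
  have pos: "8 * C' * n + 8 > 0" using C'0 n by (simp add: add_nonneg_pos)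
  have r: "0 < r" "r \<le> 1/2" "r \<le> 1 / (8 * C' * n + 8)" using pos by (auto simp: r_def)
  have "4 * C' * r * n = (4 * C' * n) * r" by simp
  also have "\<dots> \<le> (4 * C' * n) * (1 / (8 * C' * n + 8))"
    using C'0 n by (intro mult_left_mono[OF r(3)]) auto
  also have "\<dots> \<le> 1/2" using pos by (simp add: field_simps)
  finally have r4: "4 * C' * r * n \<le> 1/2" .
  have lip: "norm (\<psi> y - \<psi> x) \<le> 1/2 * norm (y - x)" if "norm x < r" "norm y < r" for x y
  proof -
    have "norm (\<psi> y - \<psi> x) \<le> (\<Sum>i\<in>UNIV. cmod ((\<psi> y - \<psi> x) $ i))" by (rule norm_vec_le_sum)
    also have "\<dots> \<le> (\<Sum>i\<in>(UNIV :: 'n set). 4 * C' * r * norm (y - x))"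
    proof (rule sum_mono)
      fix i
      show "cmod ((\<psi> y - \<psi> x) $ i) \<le> 4 * C' * r * norm (y - x)"
        using lineholo_lipschitz[OF H\<psi> C'0 \<psi>i r(1,2) that, of i] by simp
    qed
    also have "\<dots> = (4 * C' * r * n) * norm (y - x)" by (simp add: n_def)
    also have "\<dots> \<le> 1/2 * norm (y - x)" by (rule mult_right_mono[OF r4 norm_ge_zero])
    finally show ?thesis .
  qed
  have \<psi>f: "\<psi> (f z) - \<psi> z = z - f z" for z
  proof -
    have "(\<Sum>k<m. (f ^^ k) (f z)) = (\<Sum>k<m. (f ^^ Suc k) z)" by (simp add: funpow_swap1)
    also have "\<dots> = (\<Sum>k<m. (f ^^ k) z)"
      using sum.lessThan_Suc[of "\<lambda>k. (f ^^ k) z" m] sum.lessThan_Suc_shift[of "\<lambda>k. (f ^^ k) z" m] m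
      by (simp del: funpow.simps(2))
    finally show ?thesis by (simp add: \<psi>_def)
  qed
  have contf: "continuous_on UNIV f"
    using continuous_on_vec_lambda[of UNIV "\<lambda>i z. f z $ i"] H1 by (simp add: lineholo_def)
  then have "isCont f 0" by (simp add: continuous_on_eq_continuous_at)
  then obtain d where d: "d > 0" "\<And>z. norm z < d \<Longrightarrow> norm (f z) < r"
    using r(1) f0 unfolding continuous_at_eps_delta by (metis dist_0_norm dist_commute)
  have near: "f z = z" if "norm z < min d r" for z
  proof -
    have "norm (z - f z) \<le> 1/2 * norm (f z - z)" using lip[of z "f z"] that d(2)[of z] \<psi>f[of z] by simp
    then show ?thesis by (simp add: norm_minus_commute)
  qed
  \<comment> \<open>From the neighbourhood of the origin to all points: the identity theorem on the
    complex line through \<open>z\<close>.\<close>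
  have "f z $ i = z $ i" for i
  proof -
    define g where "g t = f (0 + t *s z) $ i - (0 + t *s z) $ i" for t
    define e where "e = min d r / (norm z + 1)"
    have nz: "norm z + 1 > 0" by (simp add: add_nonneg_pos)
    have e: "e > 0" using d r nz by (simp add: e_def)
    have "g 1 = 0"
    proof (rule analytic_continuation[of g UNIV "ball 0 e" 0])
      show "g holomorphic_on UNIV" unfolding g_def
        by (intro holomorphic_on_diff lineholo_line[OF H1] lineholo_line[OF Hid]) auto
      show "0 islimpt ball (0 :: complex) e" using e by (simp add: islimpt_ball)
      fix t :: complex assume "t \<in> ball 0 e"
      then have "cmod t * (norm z + 1) < e * (norm z + 1)" using nz by (intro mult_strict_right_mono) auto
      moreover have "e * (norm z + 1) = min d r" using nz by (simp add: e_def)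
      moreover have "norm (t *s z) \<le> cmod t * (norm z + 1)" by (simp add: norm_cscale distrib_left)
      ultimately have "norm (t *s z) < min d r" by linarith
      then show "g t = 0" using near by (simp add: g_def)
    qed auto
    then show ?thesis by (simp add: g_def)
  qed
  then show ?thesis by (simp add: vec_eq_iff)
qed

lemma continuous_on_det: "continuous_on UNIV (det :: complex^'n^'n \<Rightarrow> complex)"
  unfolding det_def by (intro continuous_intros)

lemma mpow_vec_bound:
  assumes "\<And>x. norm (A *v x) \<le> q * norm x" "q \<ge> 0"
  shows "norm (mpow A k *v x) \<le> q ^ k * norm x"
proof (induction k)
  case (Suc k)
  have "norm (mpow A (Suc k) *v x) \<le> q * norm (mpow A k *v x)"
    using assms(1)[of "mpow A k *v x"] by (simp add: matrix_vector_mul_assoc)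
  also have "\<dots> \<le> q * (q ^ k * norm x)" using Suc assms(2) by (rule mult_left_mono)
  finally show ?case by (simp add: mult_ac)
qed simp

lemma det_mpow: "det (mpow A k) = det A ^ k"
  by (induction k) (auto simp: det_mul)

text \<open>The powers of \<open>A\<close> tend to 0, hence so do their determinants.\<close>

lemma det_contraction:
  fixes A :: "complex^'n^'n"
  assumes A: "\<And>x. norm (A *v x) \<le> q * norm x" and q: "0 \<le> q" "q < 1"
  shows "cmod (det A) < 1"
proof (rule ccontr)
  assume "\<not> ?thesis"
  then have ge: "cmod (det (mpow A k)) \<ge> 1" for k by (simp add: det_mpow norm_power one_le_power)
  have "(\<lambda>k. mpow A k $ i $ j) \<longlonglongrightarrow> 0" for i j
  proof (rule Lim_null_comparison)
    show "\<forall>\<^sub>F k in sequentially. norm (mpow A k $ i $ j) \<le> q ^ k * norm (axis j 1 :: complex^'n)"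
      using order_trans[OF Finite_Cartesian_Product.norm_nth_le mpow_vec_bound[OF A q(1)]]
      by (intro always_eventually allI) (metis mult_axis)
    have "(\<lambda>k. q ^ k * norm (axis j 1 :: complex^'n)) \<longlonglongrightarrow> 0 * norm (axis j 1 :: complex^'n)"
      using q by (intro tendsto_mult tendsto_const LIMSEQ_realpow_zero)
    then show "(\<lambda>k. q ^ k * norm (axis j 1 :: complex^'n)) \<longlonglongrightarrow> 0" by simp
  qed
  then have "mpow A \<longlonglongrightarrow> 0"
    by (intro vec_tendstoI) simp
  moreover have "isCont (det :: complex^'n^'n \<Rightarrow> complex) 0"
    using continuous_on_det[where 'n = 'n] by (simp add: continuous_on_eq_continuous_at)
  ultimately have "(\<lambda>k. det (mpow A k)) \<longlonglongrightarrow> det (0 :: complex^'n^'n)" by (rule isCont_tendsto_compose[rotated])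
  moreover have "det (0 :: complex^'n^'n) = 0"
    using inj_matrix_det[of "0 :: complex^'n^'n"] by (auto simp: inj_def)
  ultimately have "(\<lambda>k. cmod (det (mpow A k))) \<longlonglongrightarrow> 0" using tendsto_norm_zero by fastforce
  then have "\<forall>\<^sub>F k in sequentially. cmod (det (mpow A k)) < 1" by (rule order_tendstoD(2)) simp
  then obtain k where "cmod (det (mpow A k)) < 1" unfolding eventually_sequentially by blast
  then show False using ge[of k] by simp
qed

lemma connected_shell:
  fixes r R :: real
  assumes "CARD('n) \<ge> 2"
  shows "connected {z :: complex^'n. r \<le> norm z \<and> norm z \<le> R}"
  using connected_annulus(4)[where a = "0 :: complex^'n" and ?r1.0 = r and ?r2.0 = R] assms by simp

text \<open>The scalar Schwarz lemma on the line through \<open>z\<close>, after pairing with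
  \<open>f z\<close>. It needs a strict bound on the open disc, which is why \<open>C\<close> lies
  strictly above \<open>B\<close>.\<close>

lemma vector_schwarz:
  fixes f :: "complex^'n \<Rightarrow> complex^'n"
  assumes H: "\<And>i. lineholo (\<lambda>z. f z $ i) UNIV" and f0: "f 0 = 0"
    and B: "\<And>z. norm z < R \<Longrightarrow> norm (f z) \<le> B" and BC: "B < C" and R: "R > 0" and z: "norm z < R"
  shows "norm (f z) \<le> C / R * norm z"
proof (cases "f z = 0")
  case True
  have "0 \<le> B" using B[of 0] R f0 by simp
  then show ?thesis using True R BC by simp
next
  case False
  then have z0: "z \<noteq> 0" using f0 by auto
  have C: "C > 0" using B[of 0] R f0 BC by simp
  define u where "u = of_real (R / norm z) *s z"
  have u: "norm u = R" using z0 R unfolding u_def norm_cscale norm_of_real by simp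
  define \<phi> where "\<phi> t = herm (f (0 + t *s u)) (f z) / of_real (C * norm (f z))" for t
  have fz: "norm (f z) > 0" using False by simp
  have "cmod (\<phi> (of_real (norm z / R))) \<le> cmod (of_real (norm z / R))"
  proof (rule Schwarz_Lemma(1))
    show "\<phi> holomorphic_on ball 0 1" unfolding \<phi>_def herm_def
      using fz C by (intro holomorphic_intros lineholo_line[OF H]) auto
    show "\<phi> 0 = 0" by (simp add: \<phi>_def herm_def f0)
    show "cmod (\<phi> t) < 1" if t: "cmod t < 1" for t
    proof -
      have "norm (0 + t *s u) < R" using t R by (simp add: norm_cscale u)
      from B[OF this] have "norm (f (0 + t *s u)) * norm (f z) < C * norm (f z)" using BC fz by simp
      then have "cmod (herm (f (0 + t *s u)) (f z)) < C * norm (f z)" using cmod_herm_le le_less_trans by blast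
      then show ?thesis using C fz by (simp add: \<phi>_def norm_divide norm_mult)
    qed
    show "cmod (of_real (norm z / R)) < 1" using z R by (simp add: norm_divide)
  qed
  moreover have "of_real (norm z / R) *s u = z" using z0 R by (simp add: u_def vec_eq_iff)
  then have "\<phi> (of_real (norm z / R)) = of_real (norm (f z) / C)"
    using fz by (simp add: \<phi>_def herm_self power2_eq_square)
  ultimately have "norm (f z) / C \<le> norm z / R" using C R by (simp add: norm_divide)
  then show ?thesis using C R by (simp add: field_simps)
qed

section \<open>Cocompact properly discontinuous groups on the punctured space\<close>

text \<open>The value at the origin is a convention that makes the maps total, so that composition
  and identity in \<open>G\<close> are those of functions. Continuity at the origin is
  derived.\<close>

locale hopf_group =
  fixes G :: "(complex^'n \<Rightarrow> complex^'n) set"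
  assumes dim: "CARD('n) \<ge> 2"
    and zero: "f \<in> G \<Longrightarrow> f 0 = 0"
    and nonzero: "f \<in> G \<Longrightarrow> z \<noteq> 0 \<Longrightarrow> f z \<noteq> 0"
    and holo: "f \<in> G \<Longrightarrow> holo_on f (- {0})"
    and one: "id \<in> G"
    and comp: "f \<in> G \<Longrightarrow> g \<in> G \<Longrightarrow> f \<circ> g \<in> G"
    and inverse_ex: "f \<in> G \<Longrightarrow> \<exists>g\<in>G. f \<circ> g = id \<and> g \<circ> f = id"
    and discontinuous: "compact K \<Longrightarrow> 0 \<notin> K \<Longrightarrow> finite {f \<in> G. f ` K \<inter> K \<noteq> {}}"
    and cocompact: "\<exists>K. compact K \<and> 0 \<notin> K \<and> (\<forall>z. z \<noteq> 0 \<longrightarrow> (\<exists>f\<in>G. \<exists>k\<in>K. f k = z))"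
begin

lemma inv_in: "inv_into UNIV f \<in> G" and inv_right: "f \<circ> inv_into UNIV f = id" and inv_left: "inv_into UNIV f \<circ> f = id" if f: "f \<in> G"
proof -
  obtain g where g: "g \<in> G" "f \<circ> g = id" "g \<circ> f = id" using inverse_ex[OF f] by blast
  then have "inv_into UNIV f = g" by (simp add: inv_unique_comp)
  with g show "inv_into UNIV f \<in> G" "f \<circ> inv_into UNIV f = id" "inv_into UNIV f \<circ> f = id" by auto
qed

lemma inv_app: "f \<in> G \<Longrightarrow> f (inv_into UNIV f z) = z" "f \<in> G \<Longrightarrow> inv_into UNIV f (f z) = z"
  using inv_right inv_left by (metis comp_apply id_apply)+

lemma cancel_left: "f \<in> G \<Longrightarrow> f \<circ> g = f \<circ> h \<Longrightarrow> g = h"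
  by (metis comp_assoc id_comp inv_left)

lemma funpow_in: "f \<in> G \<Longrightarrow> f ^^ k \<in> G"
  by (induction k) (auto intro: one comp)

lemma continuous: assumes "f \<in> G" shows "continuous_on S f"
proof -
  have "continuous_on UNIV f"
    by (rule automorphism_tendsto_0[OF dim holo[OF assms] holo[OF inv_in[OF assms]]])
      (auto simp: inv_app assms zero nonzero inv_in)
  then show ?thesis using continuous_on_subset by blast
qed

lemma lineholo_G: "f \<in> G \<Longrightarrow> lineholo (\<lambda>z. f z $ i) UNIV"
  by (rule lineholo_across_puncture[OF holo continuous])

lemma has_derivative_G: "f \<in> G \<Longrightarrow> (f has_derivative (*v) (jac f 0)) (at 0)"
  by (rule lineholo_has_derivative_0[OF lineholo_G])

lemma jac_comp: assumes "f \<in> G" "g \<in> G" shows "jac (f \<circ> g) 0 = jac f 0 ** jac g 0"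
proof -
  have "(f \<circ> g has_derivative (*v) (jac f 0) \<circ> (*v) (jac g 0)) (at 0)"
    using has_derivative_G[OF assms(1)] zero[OF assms(2)]
    by (intro diff_chain_at has_derivative_G[OF assms(2)]) simp
  with has_derivative_G[OF comp[OF assms]] have "(*v) (jac (f \<circ> g) 0) = (*v) (jac f 0) \<circ> (*v) (jac g 0)"
    by (rule has_derivative_unique)
  then show ?thesis by (simp add: matrix_eq fun_eq_iff flip: matrix_vector_mul_assoc)
qed

lemma jac_id: "jac id 0 = (mat 1 :: complex^'n^'n)"
proof -
  have "(id has_derivative (*v) (mat 1 :: complex^'n^'n)) (at 0)"
  proof -
    have "(*v) (mat 1 :: complex^'n^'n) = (\<lambda>v. v)" by (simp add: fun_eq_iff)
    then show ?thesis by (simp add: id_def)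
  qed
  with has_derivative_G[OF one] have "(*v) (jac id 0 :: complex^'n^'n) = (*v) (mat 1)" by (rule has_derivative_unique)
  then show ?thesis by (simp add: matrix_eq fun_eq_iff)
qed

lemma jac_inv: "f \<in> G \<Longrightarrow> jac f 0 ** jac (inv_into UNIV f) 0 = mat 1"
  using jac_comp[of f "inv_into UNIV f"] inv_in inv_right jac_id by metis

lemma det_nonzero: "f \<in> G \<Longrightarrow> det (jac f 0) \<noteq> 0"
  using jac_inv by (metis det_I det_mul mult_zero_left zero_neq_one)

lemma jac_funpow: "f \<in> G \<Longrightarrow> jac (f ^^ k) 0 = mpow (jac f 0) k"
  by (induction k) (auto simp: jac_comp funpow_in jac_id simp flip: id_def)

text \<open>The shell is connected, so if the norm of \<open>f\<close> fell below \<open>r\<close>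
  at one point only, it would equal \<open>r\<close> somewhere, and \<open>f\<close> would map a
  point of the shell into the shell.\<close>

lemma shell_dichotomy:
  assumes f: "f \<in> G" and r: "0 < r" and S: "S = {z. r \<le> norm z \<and> norm z \<le> R}" "f ` S \<inter> S = {}"
    and x: "x \<in> S" "norm (f x) < r" and rR: "r \<le> R" and y: "y \<in> S"
  shows "norm (f y) < r"
proof (rule ccontr)
  assume n: "\<not> ?thesis"
  have "connected ((\<lambda>z. norm (f z)) ` S)"
    using connected_shell[OF dim] S continuous[OF f]
    by (intro connected_continuous_image continuous_on_norm) auto
  moreover have "norm (f x) \<in> (\<lambda>z. norm (f z)) ` S" "norm (f y) \<in> (\<lambda>z. norm (f z)) ` S" using x y by auto
  ultimately have "{norm (f x)..norm (f y)} \<subseteq> (\<lambda>z. norm (f z)) ` S" by (rule connected_contains_Icc)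
  then have "r \<in> (\<lambda>z. norm (f z)) ` S" using n x by auto
  then obtain w where "w \<in> S" "norm (f w) = r" by auto
  then show False using S rR by auto
qed

text \<open>The finitely many maps whose image of the shell meets the shell keep that image away
  from 0. A map that carries a point of \<open>K\<close> closer to 0 than this moves the shell off
  itself, hence inside; the maximum principle and Schwarz' lemma then apply.\<close>

lemma contraction_exists:
  obtains \<gamma> R q where "\<gamma> \<in> G" "R > 0" "0 < q" "q < 1" "\<And>z. norm z < R \<Longrightarrow> norm (\<gamma> z) \<le> q * norm z"
proof -
  obtain K where K: "compact K" "0 \<notin> K" "\<And>z. z \<noteq> 0 \<Longrightarrow> \<exists>f\<in>G. \<exists>k\<in>K. f k = z" using cocompact by blast
  obtain r where r: "r > 0" "\<And>k. k \<in> K \<Longrightarrow> r \<le> norm k"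
    using separate_point_closed[OF compact_imp_closed[OF K(1)] K(2)] by auto
  obtain R0 where R0: "\<And>k. k \<in> K \<Longrightarrow> norm k \<le> R0" using compact_imp_bounded[OF K(1)] unfolding bounded_iff by blast
  define R where "R = max R0 (r + 1)"
  have R: "r < R" "\<And>k. k \<in> K \<Longrightarrow> norm k \<le> R" using R0 by (auto simp: R_def intro: max.coboundedI1)
  define S where "S = {z :: complex^'n. r \<le> norm z \<and> norm z \<le> R}"
  have "S = cball 0 R - ball 0 r" by (auto simp: S_def)
  then have cS: "compact S" by (simp add: compact_diff)
  have S0: "0 \<notin> S" using r by (simp add: S_def)
  define Fin where "Fin = {f \<in> G. f ` S \<inter> S \<noteq> {}}"
  have fin: "finite Fin" unfolding Fin_def by (rule discontinuous[OF cS S0])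
  have "compact (\<Union>f\<in>Fin. f ` S)"
    using fin cS continuous by (intro compact_UN compact_continuous_image) (auto simp: Fin_def)
  moreover have "0 \<notin> (\<Union>f\<in>Fin. f ` S)"
  proof
    assume "0 \<in> (\<Union>f\<in>Fin. f ` S)"
    then obtain f s where fs: "f \<in> Fin" "s \<in> S" "0 = f s" by auto
    then have "f \<in> G" "s \<noteq> 0" using S0 by (auto simp: Fin_def)
    then show False using nonzero[of f s] fs by simp
  qed
  ultimately obtain d where d: "d > 0" "\<And>y. y \<in> (\<Union>f\<in>Fin. f ` S) \<Longrightarrow> d \<le> norm y"
    using separate_point_closed[OF compact_imp_closed] by (metis dist_0_norm)
  obtain z :: "complex^'n" where z: "norm z = min d r / 2" using vector_choose_size[of "min d r / 2"] d r by auto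
  then have z0: "z \<noteq> 0" "norm z < d" "norm z < r" using d r by auto
  obtain f k where fk: "f \<in> G" "k \<in> K" "f k = z" using K(3)[OF z0(1)] by blast
  have kS: "k \<in> S" using r R fk by (auto simp: S_def)
  have "f \<notin> Fin" using d(2)[of z] fk kS z0 by force
  then have "f ` S \<inter> S = {}" using fk by (auto simp: Fin_def)
  then have small: "norm (f y) < r" if "y \<in> S" for y
    using shell_dichotomy[OF fk(1) r(1) S_def _ kS _ less_imp_le[OF R(1)] that] z0 fk by simp
  have bound: "norm (f y) \<le> r" if "norm y < R" for y
  proof (cases "y = 0")
    case False
    show ?thesis
    proof (rule slice_maximum[OF dim holo[OF fk(1)] _ False less_imp_le[OF that]])
      fix y :: "complex^'n" assume "norm y = R"
      then have "y \<in> S" using R by (simp add: S_def)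
      then show "norm (f y) \<le> r" using small by (simp add: less_imp_le)
    qed
  qed (use zero[OF fk(1)] r in simp)
  \<comment> \<open>The midpoint of \<open>r\<close> and \<open>R\<close> is strictly above the
    bound \<open>r\<close> and strictly below the radius \<open>R\<close>.\<close>
  have "norm (f y) \<le> ((r + R) / 2) / R * norm y" if "norm y < R" for y
    using R r that by (intro vector_schwarz[OF lineholo_G[OF fk(1)] zero[OF fk(1)] bound]) auto
  then show thesis using R r fk(1) by (intro that[of f R "((r + R) / 2) / R"]) (auto simp: field_simps)
qed

end

section \<open>Powers of a contraction have finite index\<close>

lemma pigeonhole_pair:
  assumes "finite F" "\<And>i. i \<le> card F \<Longrightarrow> \<eta> i \<in> F"
  obtains i j where "i < j" "j \<le> card F" "\<eta> i = \<eta> j"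
proof -
  have "\<not> inj_on \<eta> {..card F}"
  proof
    assume "inj_on \<eta> {..card F}"
    then have "card {..card F} \<le> card F"
      using assms by (metis card_image card_mono image_subset_iff atMost_iff)
    then show False by simp
  qed
  then obtain i j where "i \<le> card F" "j \<le> card F" "i \<noteq> j" "\<eta> i = \<eta> j" unfolding inj_on_def by auto
  then show thesis using that[of i j] that[of j i] by (cases "i < j") auto
qed

context hopf_group
begin

definition d :: "(complex^'n \<Rightarrow> complex^'n) \<Rightarrow> real" where
  "d f = cmod (det (jac f 0))"

lemma d_comp: "f \<in> G \<Longrightarrow> g \<in> G \<Longrightarrow> d (f \<circ> g) = d f * d g"
  by (simp add: d_def jac_comp det_mul norm_mult)

lemma d_pos: "f \<in> G \<Longrightarrow> d f > 0"
  using det_nonzero by (simp add: d_def)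

lemma d_funpow: "f \<in> G \<Longrightarrow> d (f ^^ k) = d f ^ k"
  by (simp add: d_def jac_funpow det_mpow norm_power)

lemma exponents_equal:
  assumes g: "g \<in> G" "d g < 1" and f: "f \<in> G" "h \<in> G" "d f = d h"
    and eq: "(g ^^ u) \<circ> f = (g ^^ v) \<circ> h"
  shows "u = v"
proof -
  have "d g ^ u * d f = d g ^ v * d f"
    using arg_cong[OF eq, of d] f by (simp add: d_comp d_funpow g(1) funpow_in)
  then have "d g ^ u = d g ^ v" using d_pos[OF f(1)] by simp
  then show ?thesis
    using d_pos[OF g(1)] g(2) by (metis linorder_neqE_nat order_less_irrefl power_strict_decreasing)
qed

lemma finite_order_identity:
  assumes f: "f \<in> G" "jac f 0 = mat 1" "m > 0" "f ^^ m = id"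
  shows "f = id"
proof
  fix z
  have "jac (f ^^ k) 0 = mat 1" for k
    using f by (simp add: jac_funpow) (induction k, auto)
  then show "f z = id z"
    using finite_order_tangent_identity[OF lineholo_G[OF funpow_in[OF f(1)]] zero[OF f(1)] _ f(3,4)] by simp
qed

text \<open>Finitely many cosets of the powers of \<open>g\<close> exhaust \<open>G\<close>. Writing
  powers on both sides keeps all exponents natural numbers.\<close>

definition cofinite_power :: "(complex^'n \<Rightarrow> complex^'n) \<Rightarrow> (complex^'n \<Rightarrow> complex^'n) set \<Rightarrow> bool" where
  "cofinite_power g F \<longleftrightarrow> g \<in> G \<and> d g < 1 \<and> finite F \<and> F \<subseteq> G \<and>
     (\<forall>f\<in>G. \<exists>a b. \<exists>h\<in>F. (g ^^ a) \<circ> f = (g ^^ b) \<circ> h)"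

text \<open>Powers of the contraction bring every orbit into one compact shell \<open>K\<close>. If
  \<open>x0\<close> is a fixed point of \<open>K\<close>, then \<open>f x0\<close> is brought back
  to \<open>K\<close>, so \<open>f\<close> differs by powers of \<open>g\<close> from one of the
  finitely many elements that move \<open>K\<close> to meet itself.\<close>

lemma cofinite_power_exists: "\<exists>g F. cofinite_power g F"
proof -
  obtain g R q where g: "g \<in> G" "R > 0" "0 < q" "q < 1" "\<And>z. norm z < R \<Longrightarrow> norm (g z) \<le> q * norm z"
    using contraction_exists by blast
  have iter: "norm ((g ^^ k) z) \<le> q ^ k * norm z" if "norm z < R" for z k
  proof (induction k)
    case (Suc k)
    have "q ^ k * norm z \<le> 1 * norm z" using g by (intro mult_right_mono power_le_one) auto
    then have "norm ((g ^^ k) z) < R" using Suc that by linarith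
    from g(5)[OF this] have "norm ((g ^^ Suc k) z) \<le> q * norm ((g ^^ k) z)" by simp
    also have "\<dots> \<le> q * (q ^ k * norm z)" using Suc g by (intro mult_left_mono) auto
    finally show ?case by simp
  qed simp
  have le: "norm ((g ^^ k) z) \<le> norm z" if "norm z < R" for z k
  proof -
    have "q ^ k * norm z \<le> 1 * norm z" using g by (intro mult_right_mono power_le_one) auto
    then show ?thesis using iter[OF that, of k] by linarith
  qed
  have "norm (jac g 0 *v x) \<le> q * norm x" for x
  proof (cases "x = 0")
    case False
    have "norm (jac g 0 *v x) \<le> q * norm x + e" if e: "e > 0" for e
    proof -
      define e' where "e' = e / norm x"
      have e': "e' > 0" using e False by (simp add: e'_def)
      obtain \<delta> where \<delta>: "\<delta> > 0" "\<And>y. norm y < \<delta> \<Longrightarrow> norm (g y - jac g 0 *v y) \<le> e' * norm y"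
        using has_derivative_G[OF g(1)] e' zero[OF g(1)] unfolding has_derivative_at_alt by auto
      define t where "t = min \<delta> R / (2 * norm x)"
      have t: "t > 0" using \<delta> g False by (simp add: t_def)
      define y where "y = t *\<^sub>R x"
      have ny: "norm y = t * norm x" using t by (simp add: y_def)
      have "norm y < \<delta>" "norm y < R" using \<delta> g False unfolding ny t_def by auto
      have Jy: "jac g 0 *v y = t *\<^sub>R (jac g 0 *v x)" by (simp add: y_def linear_scale[OF matrix_vector_mul_linear])
      have "norm (jac g 0 *v y) \<le> norm (g y) + norm (g y - jac g 0 *v y)"
        by (metis norm_triangle_sub norm_minus_commute)
      also have "\<dots> \<le> q * norm y + e' * norm y"
        using \<delta>(2)[OF \<open>norm y < \<delta>\<close>] g(5)[OF \<open>norm y < R\<close>] by simp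
      finally have "t * norm (jac g 0 *v x) \<le> t * ((q + e') * norm x)"
        using t by (simp add: Jy ny algebra_simps)
      then have "norm (jac g 0 *v x) \<le> (q + e') * norm x" using t by simp
      then show ?thesis using False by (simp add: e'_def algebra_simps)
    qed
    then show ?thesis by (rule field_le_epsilon)
  qed simp
  then have dg: "d g < 1" unfolding d_def using g by (intro det_contraction[of _ q]) auto
  have inj: "g ^^ i \<noteq> g ^^ j" if "i < j" for i j
    using exponents_equal[OF g(1) dg one one refl, of i j] that by auto
  obtain y0 :: "complex^'n" where y0: "norm y0 = R / 2" using vector_choose_size[of "R / 2"] g by auto
  have enter: "\<exists>k. norm ((g ^^ k) z) < R" if z: "z \<noteq> 0" for z
  proof -
    \<comment> \<open>The shell with this inner radius contains both \<open>z\<close> and the test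
      point \<open>y0\<close>. Some power of \<open>g\<close> moves it off itself because the powers
      are pairwise distinct; it does not move \<open>y0\<close> outwards, so the whole shell goes
      inside.\<close>
    define r' where "r' = min (norm z) (R / 2)"
    define S where "S = {y :: complex^'n. r' \<le> norm y \<and> norm y \<le> max (norm z) (R / 2)}"
    have r': "0 < r'" "r' < R" using z g by (auto simp: r'_def)
    have "S = cball 0 (max (norm z) (R / 2)) - ball 0 r'" by (auto simp: S_def)
    then have "compact S" by (simp add: compact_diff)
    moreover have "0 \<notin> S" using r' by (simp add: S_def)
    ultimately have fin: "finite {f \<in> G. f ` S \<inter> S \<noteq> {}}" by (rule discontinuous)
    have "inj (\<lambda>k. g ^^ k)"
    proof (rule injI)
      fix i j assume "g ^^ i = g ^^ j"
      then show "i = j" using inj[of i j] inj[of j i] by (cases i j rule: linorder_cases) auto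
    qed
    then have "infinite (range (\<lambda>k. g ^^ k))" by (rule range_inj_infinite)
    then have "\<not> range (\<lambda>k. g ^^ k) \<subseteq> {f \<in> G. f ` S \<inter> S \<noteq> {}}" using fin finite_subset by blast
    then obtain k where k: "(g ^^ k) ` S \<inter> S = {}" using funpow_in[OF g(1)] by blast
    have y0S: "y0 \<in> S" by (simp add: S_def r'_def y0)
    then have "(g ^^ k) y0 \<notin> S" using k by blast
    moreover have "norm ((g ^^ k) y0) \<le> R / 2" using le[of y0 k] y0 g by simp
    ultimately have "norm ((g ^^ k) y0) < r'" by (auto simp: S_def)
    moreover have "z \<in> S" by (simp add: S_def r'_def)
    ultimately have "norm ((g ^^ k) z) < r'"
      using shell_dichotomy[OF funpow_in[OF g(1)] r'(1) S_def k y0S] by (simp add: r'_def)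
    then show ?thesis using r' by (meson less_trans)
  qed
  define g' where "g' = inv_into UNIV g"
  have g': "g' \<in> G" "\<And>z. g (g' z) = z" "\<And>z. g' (g z) = z"
    by (simp_all add: g'_def inv_in inv_app g(1))
  have gg': "(g ^^ k) ((g' ^^ k) z) = z" "(g' ^^ k) ((g ^^ k) z) = z" for k z
    by (induction k arbitrary: z) (simp_all add: g' funpow_swap1)
  have leave: "\<exists>j. \<not> norm ((g' ^^ j) w) < R" if w: "w \<noteq> 0" for w
  proof (rule ccontr)
    assume "\<not> ?thesis"
    then have all: "norm ((g' ^^ j) w) < R" for j by auto
    have "norm w \<le> q ^ j * R" for j
    proof -
      have "norm w \<le> q ^ j * norm ((g' ^^ j) w)" using iter[OF all[of j], of j] by (simp add: gg')
      also have "\<dots> \<le> q ^ j * R" using all[of j] g by (intro mult_left_mono) auto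
      finally show ?thesis .
    qed
    moreover have "(\<lambda>j. q ^ j * R) \<longlonglongrightarrow> 0 * R"
      using g by (intro tendsto_mult tendsto_const LIMSEQ_realpow_zero) auto
    ultimately have "norm w \<le> 0" by (intro LIMSEQ_le_const[of "\<lambda>j. q ^ j * R"]) auto
    then show False using w by simp
  qed
  have "isCont g' 0" using continuous[OF g'(1), of UNIV] by (simp add: continuous_on_eq_continuous_at)
  \<comment> \<open>Points of norm below \<open>\<epsilon>\<close> do not leave the ball of radius
    \<open>R\<close> under \<open>g'\<close>. So the last backward iterate before the orbit first
    leaves the ball has norm at least \<open>\<epsilon>\<close> and lies in the shell.\<close>
  then obtain \<epsilon> where \<epsilon>: "\<epsilon> > 0" "\<And>y. norm y < \<epsilon> \<Longrightarrow> norm (g' y) < R"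
    using g(2) zero[OF g'(1)] unfolding continuous_at_eps_delta by (metis dist_0_norm dist_commute)
  define K where "K = {y :: complex^'n. \<epsilon> \<le> norm y \<and> norm y \<le> R}"
  have "K = cball 0 R - ball 0 \<epsilon>" by (auto simp: K_def)
  then have "compact K" by (simp add: compact_diff)
  moreover have "0 \<notin> K" using \<epsilon> by (simp add: K_def)
  ultimately have finF: "finite {f \<in> G. f ` K \<inter> K \<noteq> {}}" by (rule discontinuous)
  have reach: "\<exists>a b. \<exists>y\<in>K. (g ^^ a) z = (g ^^ b) y" if z: "z \<noteq> 0" for z
  proof -
    obtain k where k: "norm ((g ^^ k) z) < R" using enter[OF z] by blast
    define w where "w = (g ^^ k) z"
    have w: "w \<noteq> 0" "norm w < R" using k nonzero[OF funpow_in[OF g(1)] z] by (auto simp: w_def)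
    define j where "j = (LEAST j. \<not> norm ((g' ^^ j) w) < R)"
    have j: "\<not> norm ((g' ^^ j) w) < R" "\<And>i. i < j \<Longrightarrow> norm ((g' ^^ i) w) < R"
      using LeastI_ex[OF leave[OF w(1)]] not_less_Least[of _ "\<lambda>j. \<not> norm ((g' ^^ j) w) < R"] by (auto simp: j_def)
    have "j \<noteq> 0"
    proof
      assume "j = 0"
      then show False using j(1) w(2) by simp
    qed
    then obtain i where i: "j = Suc i" by (cases j) auto
    define y where "y = (g' ^^ i) w"
    have "norm y < R" using j(2)[of i] by (simp add: y_def i)
    moreover have "\<not> norm (g' y) < R" using j(1) by (simp add: y_def i)
    then have "\<epsilon> \<le> norm y" using \<epsilon>(2)[of y] by linarith
    ultimately have "y \<in> K" by (simp add: K_def)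
    moreover have "(g ^^ k) z = (g ^^ i) y" by (simp add: y_def gg' w_def)
    ultimately show ?thesis by blast
  qed
  have "y0 \<noteq> 0" using y0 g by auto
  then obtain x0 where x0: "x0 \<in> K" using reach by blast
  have "x0 \<noteq> 0" using x0 \<epsilon> by (auto simp: K_def)
  have "\<exists>a b. \<exists>h\<in>{f \<in> G. f ` K \<inter> K \<noteq> {}}. (g ^^ a) \<circ> f = (g ^^ b) \<circ> h" if f: "f \<in> G" for f
  proof -
    obtain a b y where y: "y \<in> K" "(g ^^ a) (f x0) = (g ^^ b) y"
      using reach[OF nonzero[OF f \<open>x0 \<noteq> 0\<close>]] by blast
    define h where "h = (g' ^^ b) \<circ> ((g ^^ a) \<circ> f)"
    have "h \<in> G" unfolding h_def by (intro comp funpow_in g'(1) g(1) f)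
    moreover have "h x0 = y" by (simp add: h_def y gg')
    moreover have "(g ^^ a) \<circ> f = (g ^^ b) \<circ> h" by (simp add: h_def fun_eq_iff gg')
    ultimately show ?thesis using y(1) x0 by blast
  qed
  then have "cofinite_power g {f \<in> G. f ` K \<inter> K \<noteq> {}}"
    unfolding cofinite_power_def using g(1) dg finF by blast
  then show ?thesis by blast
qed

lemma funpow_cancel: "f \<in> G \<Longrightarrow> (f ^^ k) \<circ> g = (f ^^ k) \<circ> h \<Longrightarrow> g = h"
  using cancel_left[OF funpow_in] .

text \<open>Two of the first \<open>card F + 1\<close> powers of \<open>f\<close> share a
  representative in \<open>F\<close>. The bound by \<open>card F\<close> is uniform in
  \<open>f\<close>, so a single factorial will serve all elements.\<close>

lemma cofinite_power_period:
  assumes c: "cofinite_power g F" and f: "f \<in> G"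
  obtains i j u v where "i < j" "j \<le> card F" "(g ^^ u) \<circ> (f ^^ j) = (g ^^ v) \<circ> (f ^^ i)"
proof -
  have F: "finite F" "g \<in> G" using c by (auto simp: cofinite_power_def)
  have "\<forall>i. \<exists>a b. \<exists>h\<in>F. (g ^^ a) \<circ> (f ^^ i) = (g ^^ b) \<circ> h"
    using c funpow_in[OF f] unfolding cofinite_power_def by blast
  then obtain a b h where h: "\<And>i. h i \<in> F" "\<And>i. (g ^^ a i) \<circ> (f ^^ i) = (g ^^ b i) \<circ> h i" by metis
  obtain i j where ij: "i < j" "j \<le> card F" "h i = h j" using pigeonhole_pair[OF F(1), of h] h by blast
  have h': "(g ^^ a i) ((f ^^ i) z) = (g ^^ b i) (h i z)" for i z
    using fun_cong[OF h(2)[of i], of z] by (simp only: comp_apply)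
  have "(g ^^ (b i + a j)) ((f ^^ j) z) = (g ^^ (b j + a i)) ((f ^^ i) z)" for z
  proof -
    have "(g ^^ (b i + a j)) ((f ^^ j) z) = (g ^^ (b i + b j)) (h j z)" by (simp only: funpow_add comp_apply h')
    also have "\<dots> = (g ^^ (b j + b i)) (h i z)" by (simp only: ij(3) add.commute)
    also have "\<dots> = (g ^^ (b j + a i)) ((f ^^ i) z)" by (simp only: funpow_add comp_apply h')
    finally show ?thesis .
  qed
  then have "(g ^^ (b i + a j)) \<circ> (f ^^ j) = (g ^^ (b j + a i)) \<circ> (f ^^ i)" by (intro ext) (simp only: comp_apply)
  then show thesis using that ij by blast
qed

lemma cofinite_power_normalizes:
  assumes c: "cofinite_power g F" and f: "f \<in> G"
  obtains i j u v where "i < j" "j \<le> card F" "(g ^^ u) \<circ> f \<circ> (g ^^ j) = (g ^^ v) \<circ> f \<circ> (g ^^ i)"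
proof -
  have F: "finite F" "g \<in> G" using c by (auto simp: cofinite_power_def)
  have "\<forall>i. \<exists>a b. \<exists>h\<in>F. (g ^^ a) \<circ> (f \<circ> (g ^^ i)) = (g ^^ b) \<circ> h"
    using c comp[OF f funpow_in[OF F(2)]] unfolding cofinite_power_def by blast
  then obtain a b h where h: "\<And>i. h i \<in> F" "\<And>i. (g ^^ a i) \<circ> (f \<circ> (g ^^ i)) = (g ^^ b i) \<circ> h i" by metis
  obtain i j where ij: "i < j" "j \<le> card F" "h i = h j" using pigeonhole_pair[OF F(1), of h] h by blast
  have h': "(g ^^ a i) (f ((g ^^ i) z)) = (g ^^ b i) (h i z)" for i z
    using fun_cong[OF h(2)[of i], of z] by (simp only: comp_apply)
  have "(g ^^ (b i + a j)) (f ((g ^^ j) z)) = (g ^^ (b j + a i)) (f ((g ^^ i) z))" for z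
  proof -
    have "(g ^^ (b i + a j)) (f ((g ^^ j) z)) = (g ^^ (b i + b j)) (h j z)" by (simp only: funpow_add comp_apply h')
    also have "\<dots> = (g ^^ (b j + b i)) (h i z)" by (simp only: ij(3) add.commute)
    also have "\<dots> = (g ^^ (b j + a i)) (f ((g ^^ i) z))" by (simp only: funpow_add comp_apply h')
    finally show ?thesis .
  qed
  then have "(g ^^ (b i + a j)) \<circ> f \<circ> (g ^^ j) = (g ^^ (b j + a i)) \<circ> f \<circ> (g ^^ i)" by (intro ext) (simp only: comp_apply)
  then show thesis using that ij by blast
qed

text \<open>The determinant of the linear part excludes that conjugation changes the exponent of a power of
  the contraction.\<close>
lemma power_commutes:
  assumes c: "cofinite_power g F" and f: "f \<in> G"
  obtains m where "0 < m" "m \<le> card F" "f \<circ> (g ^^ m) = (g ^^ m) \<circ> f"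
proof -
  have g: "g \<in> G" "d g < 1" using c by (auto simp: cofinite_power_def)
  obtain i j u v where ij: "i < j" "j \<le> card F" and eq: "(g ^^ u) \<circ> f \<circ> (g ^^ j) = (g ^^ v) \<circ> f \<circ> (g ^^ i)"
    using cofinite_power_normalizes[OF c f] by blast
  define m where "m = j - i"
  have j: "j = m + i" using ij by (simp add: m_def)
  have "(g ^^ u) (f ((g ^^ m) ((g ^^ i) z))) = (g ^^ v) (f ((g ^^ i) z))" for z
    using fun_cong[OF eq, of z] by (simp only: j funpow_add comp_apply)
  from this[of "inv_into UNIV (g ^^ i) _"] have eq': "(g ^^ u) \<circ> (f \<circ> (g ^^ m)) = (g ^^ v) \<circ> f"
    by (simp add: fun_eq_iff inv_app(1)[OF funpow_in[OF g(1)]])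
  have "d g ^ (u + m) * d f = d g ^ v * d f"
    using arg_cong[OF eq', of d] by (simp add: d_comp d_funpow comp funpow_in f g(1) power_add mult_ac)
  then have "d g ^ (u + m) = d g ^ v" using d_pos[OF f] by simp
  then have "v = u + m"
    using d_pos[OF g(1)] g(2) by (metis linorder_neqE_nat order_less_irrefl power_strict_decreasing)
  then have "(g ^^ u) \<circ> (f \<circ> (g ^^ m)) = (g ^^ u) \<circ> ((g ^^ m) \<circ> f)"
    using eq' by (simp only: funpow_add o_assoc)
  then have "f \<circ> (g ^^ m) = (g ^^ m) \<circ> f" by (rule funpow_cancel[OF g(1)])
  then show thesis using that[of m] ij by (auto simp: m_def)
qed

lemma central_cofinite_power_exists:
  "\<exists>b F. cofinite_power b F \<and> (\<forall>f\<in>G. f \<circ> b = b \<circ> f)"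
proof -
  obtain g F where c: "cofinite_power g F" using cofinite_power_exists by blast
  then have g: "g \<in> G" "d g < 1" "finite F" "F \<subseteq> G" by (auto simp: cofinite_power_def)
  \<comment> \<open>A common multiple of all exponents that \<open>power_commutes\<close> can
    produce.\<close>
  define M where "M = (fact (card F) :: nat)"
  have M: "M > 0" by (simp add: M_def)
  define b where "b = g ^^ M"
  have bk: "b ^^ k = g ^^ (M * k)" for k by (simp add: b_def funpow_mult)
  have "f \<circ> b = b \<circ> f" if f: "f \<in> G" for f
  proof -
    obtain m where m: "0 < m" "m \<le> card F" "f \<circ> (g ^^ m) = (g ^^ m) \<circ> f" using power_commutes[OF c f] .
    then have "m dvd M" unfolding M_def by (intro dvd_fact) auto
    then obtain k where k: "M = m * k" by (elim dvdE)
    have m': "f ((g ^^ m) z) = (g ^^ m) (f z)" for z using fun_cong[OF m(3), of z] by simp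
    have "f (((g ^^ m) ^^ k) z) = ((g ^^ m) ^^ k) (f z)" for z
      by (induction k) (simp_all add: m')
    then show ?thesis by (simp add: b_def k fun_eq_iff flip: funpow_mult)
  qed
  moreover have "cofinite_power b ((\<lambda>(s, h). (g ^^ s) \<circ> h) ` ({..<M} \<times> F))"
    unfolding cofinite_power_def
  proof (intro conjI ballI)
    show "b \<in> G" by (simp add: b_def funpow_in g)
    show "d b < 1" using d_pos[OF g(1)] g(2) M unfolding b_def d_funpow[OF g(1)] by (simp add: power_less_one_iff)
    show "finite ((\<lambda>(s, h). (g ^^ s) \<circ> h) ` ({..<M} \<times> F))" using g by auto
    show "(\<lambda>(s, h). (g ^^ s) \<circ> h) ` ({..<M} \<times> F) \<subseteq> G" using g by (auto intro!: comp funpow_in)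
    fix f assume "f \<in> G"
    then obtain a e h where h: "h \<in> F" "(g ^^ a) \<circ> f = (g ^^ e) \<circ> h" using c unfolding cofinite_power_def by blast
    \<comment> \<open>Composing with \<open>a * (M - 1)\<close> further copies of \<open>g\<close>
      turns the exponent \<open>a\<close> into the multiple \<open>M * a\<close>. The exponent on
      the other side is divided by \<open>M\<close>, and the remainder goes into the finite
      set.\<close>
    define e' where "e' = e + a * (M - 1)"
    have aM: "M * a = a * (M - 1) + a" using M by (cases M) auto
    have eM: "e' = M * (e' div M) + e' mod M" by simp
    have "(b ^^ a) \<circ> f = (g ^^ (a * (M - 1))) \<circ> ((g ^^ a) \<circ> f)" by (simp only: bk aM funpow_add o_assoc)
    also have "\<dots> = (g ^^ e') \<circ> h" by (simp only: h e'_def add.commute[of e] funpow_add o_assoc)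
    also have "\<dots> = (b ^^ (e' div M)) \<circ> ((g ^^ (e' mod M)) \<circ> h)"
      by (subst eM) (simp only: bk funpow_add o_assoc)
    finally show "\<exists>a b'. \<exists>h\<in>(\<lambda>(s, h). (g ^^ s) \<circ> h) ` ({..<M} \<times> F). (b ^^ a) \<circ> f = (b ^^ b') \<circ> h"
      using h(1) M by (intro exI[of _ a] exI[of _ "e' div M"] bexI[of _ "(g ^^ (e' mod M)) \<circ> h"]) auto
  qed
  ultimately show ?thesis by blast
qed

text \<open>The commutator \<open>c\<close> has trivial derivative, so \<open>d\<close> is 1 on its
  powers. In the relation of \<open>cofinite_power_period\<close> the two powers of the contraction
  must therefore be equal; they cancel, and \<open>c\<close> has finite order.\<close>

lemma commute_if_derivatives_commute:
  assumes f: "f \<in> G" and h: "h \<in> G" and J: "jac f 0 ** jac h 0 = jac h 0 ** jac f 0"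
  shows "f \<circ> h = h \<circ> f"
proof -
  define c where "c = inv_into UNIV (h \<circ> f) \<circ> (f \<circ> h)"
  have hf: "h \<circ> f \<in> G" "f \<circ> h \<in> G" using f h comp by auto
  have c: "c \<in> G" unfolding c_def by (intro comp inv_in hf)
  have "jac (h \<circ> f) 0 ** jac c 0 = jac (f \<circ> h) 0"
  proof -
    have "(h \<circ> f) \<circ> c = f \<circ> h" unfolding c_def by (simp only: o_assoc inv_right[OF hf(1)] id_comp)
    then show ?thesis using jac_comp[OF hf(1) c] by simp
  qed
  also have "\<dots> = jac (h \<circ> f) 0 ** mat 1" using J by (simp add: jac_comp f h)
  finally have "jac (inv_into UNIV (h \<circ> f)) 0 ** jac (h \<circ> f) 0 ** jac c 0 = jac (inv_into UNIV (h \<circ> f)) 0 ** jac (h \<circ> f) 0 ** mat 1"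
    by (simp add: matrix_mul_assoc[symmetric])
  then have Jc: "jac c 0 = mat 1"
    using matrix_left_right_inverse[of "jac (h \<circ> f) 0" "jac (inv_into UNIV (h \<circ> f)) 0"] jac_inv[OF hf(1)] by simp
  obtain g F where gF: "cofinite_power g F" using cofinite_power_exists by blast
  then have g: "g \<in> G" "d g < 1" by (auto simp: cofinite_power_def)
  obtain i j u v where ij: "i < j" "j \<le> card F" "(g ^^ u) \<circ> (c ^^ j) = (g ^^ v) \<circ> (c ^^ i)"
    by (rule cofinite_power_period[OF gF c])
  have dc: "d (c ^^ k) = 1" for k by (simp add: d_funpow c) (simp add: d_def Jc)
  have "u = v" by (rule exponents_equal[OF g funpow_in[OF c] funpow_in[OF c] _ ij(3)]) (simp add: dc)
  then have "(g ^^ u) \<circ> (c ^^ j) = (g ^^ u) \<circ> (c ^^ i)" using ij(3) by (simp only:)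
  then have "c ^^ j = c ^^ i" by (rule funpow_cancel[OF g(1)])
  then have "(c ^^ i) \<circ> (c ^^ (j - i)) = (c ^^ i) \<circ> id" using ij by (simp flip: funpow_add)
  then have "c ^^ (j - i) = id" by (rule funpow_cancel[OF c])
  then have "c = id" using finite_order_identity[OF c Jc, of "j - i"] ij by simp
  then have "(h \<circ> f) \<circ> c = h \<circ> f" by (simp only: comp_id)
  moreover have "(h \<circ> f) \<circ> c = f \<circ> h" unfolding c_def by (simp only: o_assoc inv_right[OF hf(1)] id_comp)
  ultimately show ?thesis by simp
qed

end

section \<open>Passage to a finite matrix group\<close>

context hopf_group
begin

text \<open>A homomorphism from \<open>G\<close> to the additive reals sends the central contraction \<open>b\<close> to 1 and has image
  in the multiples of \<open>1 / N\<close>. Multiplying the linear part by the corresponding power of an \<open>N\<close>-th root of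
  the linear part of \<open>b\<close> kills \<open>b\<close>, so that a finite matrix group remains.\<close>
theorem jordan_set:
  "\<exists>S. S \<subseteq> G \<and> id \<in> S \<and> (\<forall>f\<in>S. \<forall>h\<in>S. f \<circ> h = h \<circ> f) \<and>
    (\<forall>F. F \<subseteq> G \<longrightarrow> (\<forall>f\<in>F. \<forall>h\<in>F. f \<noteq> h \<longrightarrow> inv_into UNIV f \<circ> h \<notin> S)
      \<longrightarrow> card F \<le> 16 ^ DIM(complex^'n^'n))"
proof -
  obtain b F where c: "cofinite_power b F" and central: "\<And>f. f \<in> G \<Longrightarrow> f \<circ> b = b \<circ> f"
    using central_cofinite_power_exists by blast
  then have b: "b \<in> G" "d b < 1" "finite F" "F \<subseteq> G"
    and cof: "\<And>f. f \<in> G \<Longrightarrow> \<exists>a e. \<exists>h\<in>F. (b ^^ a) \<circ> f = (b ^^ e) \<circ> h"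
    by (auto simp: cofinite_power_def)
  define \<tau> where "\<tau> f = ln (d f) / ln (d b)" for f
  have lnb: "ln (d b) \<noteq> 0" using b d_pos[OF b(1)] by simp
  have \<tau>_comp: "\<tau> (f \<circ> h) = \<tau> f + \<tau> h" if "f \<in> G" "h \<in> G" for f h
    using d_pos[OF that(1)] d_pos[OF that(2)]
    by (simp add: \<tau>_def d_comp[OF that] ln_mult add_divide_distrib)
  have \<tau>_funpow: "\<tau> (f ^^ k) = real k * \<tau> f" if "f \<in> G" for f k
    using d_pos[OF that] by (simp add: \<tau>_def d_funpow[OF that] ln_realpow)
  have \<tau>_b: "\<tau> b = 1" using lnb by (simp add: \<tau>_def)
  \<comment> \<open>Clears every denominator \<open>j - i\<close> that a period relation can
    produce.\<close>
  define N where "N = (fact (card F) :: nat)"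
  have N: "N > 0" by (simp add: N_def)
  have int_ex: "\<exists>k::int. real N * \<tau> f = of_int k" if f: "f \<in> G" for f
  proof -
    obtain i j u v where ij: "i < j" "j \<le> card F" "(b ^^ u) \<circ> (f ^^ j) = (b ^^ v) \<circ> (f ^^ i)"
      by (rule cofinite_power_period[OF c f])
    have "real u + real j * \<tau> f = real v + real i * \<tau> f"
      using arg_cong[OF ij(3), of \<tau>] by (simp add: \<tau>_comp funpow_in b f \<tau>_funpow \<tau>_b)
    then have 1: "real (j - i) * \<tau> f = of_int (int v - int u)" using ij by (simp add: of_nat_diff algebra_simps)
    have "(j - i) dvd N" unfolding N_def using ij by (intro dvd_fact) auto
    then obtain m where "N = (j - i) * m" by (elim dvdE)
    then have "real N * \<tau> f = of_int (int m * (int v - int u))" using 1 by (simp add: mult_ac)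
    then show ?thesis by blast
  qed
  \<comment> \<open>On \<open>G\<close> the floor is exact, since its argument is an integer by
    \<open>int_ex\<close>.\<close>
  define n where "n f = \<lfloor>real N * \<tau> f\<rfloor>" for f
  have n: "real N * \<tau> f = of_int (n f)" if "f \<in> G" for f using int_ex[OF that] by (auto simp: n_def)
  have n_comp: "n (f \<circ> h) = n f + n h" if "f \<in> G" "h \<in> G" for f h
  proof -
    have "of_int (n (f \<circ> h)) = (of_int (n f + n h) :: real)"
      using that by (simp add: n[symmetric] comp \<tau>_comp distrib_left)
    then show ?thesis by (simp only: of_int_eq_iff)
  qed
  have n_b: "n b = int N" by (simp add: n_def \<tau>_b)
  define A where "A = jac b 0"
  have "invertible A" using det_nonzero[OF b(1)] by (simp add: A_def invertible_det_nz)
  then obtain R where R: "mpow R N = A" "\<And>B. A ** B = B ** A \<Longrightarrow> R ** B = B ** R"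
    using matrix_root[OF N] by blast
  have "det R ^ N = det A" using R(1) det_mpow by metis
  then have "det R \<noteq> 0" using det_nonzero[OF b(1)] N by (cases "det R = 0") (auto simp: A_def power_0_left)
  then obtain R' where "R ** R' = mat 1" using invertible_det_nz[of R] by (auto simp: invertible_def)
  then obtain E where E: "E 0 = mat 1" "\<And>k l. E (k + l) = E k ** E l" "\<And>n. E (int n) = mpow R n"
    "\<And>X k. R ** X = X ** R \<Longrightarrow> E k ** X = X ** E k" using integer_matrix_powers by blast
  have E_com: "E k ** jac f 0 = jac f 0 ** E k" if f: "f \<in> G" for f k
  proof -
    have "A ** jac f 0 = jac f 0 ** A"
      using arg_cong[OF central[OF f], of "\<lambda>f. jac f 0"] by (simp add: A_def jac_comp f b)
    then show ?thesis by (intro E(4) R(2))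
  qed
  have E_E: "E k ** E l = E l ** E k" for k l by (metis E(2) add.commute)
  have E_inv: "E k ** E (- k) = mat 1" for k using E(2)[of k "- k"] by (simp add: E(1))
  \<comment> \<open>Multiplicative because the powers of \<open>R\<close> commute with every
    derivative from \<open>G\<close>: \<open>b\<close> is central, and \<open>R\<close> commutes
    with the commutant of its derivative.\<close>
  define \<rho> where "\<rho> f = jac f 0 ** E (- n f)" for f
  have \<rho>_comp: "\<rho> (f \<circ> h) = \<rho> f ** \<rho> h" if f: "f \<in> G" and h: "h \<in> G" for f h
  proof -
    have "E (- n (f \<circ> h)) = E (- n f) ** E (- n h)" using E(2)[of "- n f" "- n h"] by (simp add: n_comp f h)
    then have "\<rho> (f \<circ> h) = jac f 0 ** (jac h 0 ** E (- n f)) ** E (- n h)"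
      by (simp only: \<rho>_def jac_comp[OF f h] matrix_mul_assoc)
    also have "\<dots> = \<rho> f ** \<rho> h" by (simp only: E_com[OF h, of "- n f", symmetric] \<rho>_def matrix_mul_assoc)
    finally show ?thesis .
  qed
  have \<rho>_id: "\<rho> id = mat 1" using \<tau>_funpow[OF one, of 0] by (simp add: \<rho>_def n_def jac_id E(1))
  have \<rho>_b: "\<rho> b = mat 1" using E_inv[of "int N"] E(3)[of N] by (simp add: \<rho>_def n_b R(1) flip: A_def)
  have \<rho>_bk: "\<rho> (b ^^ k) = mat 1" for k
  proof (induction k)
    case (Suc k)
    then show ?case by (simp only: funpow.simps(2) \<rho>_comp[OF b(1) funpow_in[OF b(1)]] \<rho>_b matrix_mul_lid)
  qed (simp only: funpow_0 funpow.simps(1) \<rho>_id)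
  have \<rho>_F: "\<rho> ` G \<subseteq> \<rho> ` F"
  proof safe
    fix f assume f: "f \<in> G"
    obtain a e h where h: "h \<in> F" "(b ^^ a) \<circ> f = (b ^^ e) \<circ> h" using cof[OF f] by blast
    then have "\<rho> ((b ^^ a) \<circ> f) = \<rho> ((b ^^ e) \<circ> h)" by simp
    moreover have "h \<in> G" using h b by blast
    ultimately have "\<rho> f = \<rho> h"
      using \<rho>_comp[OF funpow_in[OF b(1)] f] \<rho>_comp[OF funpow_in[OF b(1)], of h] by (simp add: \<rho>_bk)
    then show "\<rho> f \<in> \<rho> ` F" using h by blast
  qed
  have \<rho>_inv: "\<rho> f ** \<rho> (inv_into UNIV f) = mat 1" if "f \<in> G" for f
    using \<rho>_comp[OF that inv_in[OF that]] by (simp add: inv_right that \<rho>_id)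
  interpret Q: finite_matrix_group "\<rho> ` G"
  proof
    show "finite (\<rho> ` G)" using \<rho>_F b by (meson finite_imageI finite_subset)
    show "mat 1 \<in> \<rho> ` G" using imageI[OF one, of \<rho>] by (simp add: \<rho>_id)
    show "A ** B \<in> \<rho> ` G" if "A \<in> \<rho> ` G" "B \<in> \<rho> ` G" for A B
    proof -
      obtain f h where "f \<in> G" "h \<in> G" "A = \<rho> f" "B = \<rho> h" using \<open>A \<in> \<rho> ` G\<close> \<open>B \<in> \<rho> ` G\<close> by blast
      then show ?thesis using imageI[OF comp, of f h \<rho>] by (simp add: \<rho>_comp)
    qed
    show "\<exists>B\<in>\<rho> ` G. A ** B = mat 1" if "A \<in> \<rho> ` G" for A
      using \<rho>_inv inv_in \<open>A \<in> \<rho> ` G\<close> by blast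
  qed
  obtain S where S: "S \<subseteq> \<rho> ` G" "\<And>A B. A \<in> S \<Longrightarrow> B \<in> S \<Longrightarrow> A ** B = B ** A" "mat 1 \<in> S"
    "\<And>F. F \<subseteq> \<rho> ` G \<Longrightarrow> (\<And>A B. A \<in> F \<Longrightarrow> B \<in> F \<Longrightarrow> A \<noteq> B \<Longrightarrow> matrix_inv A ** B \<notin> S)
      \<Longrightarrow> card F \<le> 16 ^ DIM(complex^'n^'n)"
    using Q.jordan by blast
  define T where "T = {f \<in> G. \<rho> f \<in> S}"
  show ?thesis
  proof (intro exI[of _ T] conjI ballI allI impI)
    show "T \<subseteq> G" by (auto simp: T_def)
    show "id \<in> T" by (simp add: T_def one \<rho>_id S(3))
    show "f \<circ> h = h \<circ> f" if fh: "f \<in> T" "h \<in> T" for f h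
    proof (rule commute_if_derivatives_commute)
      show f: "f \<in> G" and h: "h \<in> G" using fh by (auto simp: T_def)
      \<comment> \<open>The twisting factors commute with each other and with all the matrices
        involved, so derivatives commute as soon as their twisted versions do.\<close>
      have jac_eq: "jac f 0 = \<rho> f ** E (n f)" if "f \<in> G" for f
        using E_inv[of "- n f"] by (simp add: \<rho>_def flip: matrix_mul_assoc)
      have E\<rho>: "E k ** \<rho> f = \<rho> f ** E k" if "f \<in> G" for f k
        unfolding \<rho>_def matrix_mul_assoc E_com[OF that] by (simp only: matrix_mul_assoc[symmetric] E_E)
      have "jac f 0 ** jac h 0 = \<rho> f ** (E (n f) ** \<rho> h) ** E (n h)" by (simp add: jac_eq f h matrix_mul_assoc)
      also have "\<dots> = (\<rho> f ** \<rho> h) ** (E (n f) ** E (n h))" by (simp only: E\<rho>[OF h] matrix_mul_assoc)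
      also have "\<dots> = (\<rho> h ** \<rho> f) ** (E (n h) ** E (n f))"
        using S(2) fh by (simp add: T_def E_E[of "n f"])
      also have "\<dots> = \<rho> h ** (E (n h) ** \<rho> f) ** E (n f)" by (simp only: E\<rho>[OF f] matrix_mul_assoc)
      also have "\<dots> = jac h 0 ** jac f 0" by (simp add: jac_eq f h matrix_mul_assoc)
      finally show "jac f 0 ** jac h 0 = jac h 0 ** jac f 0" .
    qed
    fix X assume X: "X \<subseteq> G" and sep': "\<forall>f\<in>X. \<forall>h\<in>X. f \<noteq> h \<longrightarrow> inv_into UNIV f \<circ> h \<notin> T"
    have sep: "inv_into UNIV f \<circ> h \<notin> T" if "f \<in> X" "h \<in> X" "f \<noteq> h" for f h using sep' that by blast
    have key: "matrix_inv (\<rho> f) ** \<rho> h \<notin> S" if "f \<in> X" "h \<in> X" "f \<noteq> h" for f h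
    proof -
      have G: "f \<in> G" "h \<in> G" using that X by auto
      have "matrix_inv (\<rho> f) = \<rho> (inv_into UNIV f)" using \<rho>_inv[OF G(1)] by (rule matrix_inv_eq)
      then have "matrix_inv (\<rho> f) ** \<rho> h = \<rho> (inv_into UNIV f \<circ> h)" using G by (simp add: \<rho>_comp inv_in)
      then show ?thesis using sep[OF that] G by (simp add: T_def comp inv_in)
    qed
    have "inj_on \<rho> X"
    proof (rule inj_onI, rule ccontr)
      fix f h assume fh: "f \<in> X" "h \<in> X" "\<rho> f = \<rho> h" "f \<noteq> h"
      then have "matrix_inv (\<rho> f) ** \<rho> h = mat 1" using Q.inv_left[of "\<rho> f"] X by auto
      then show False using key[OF fh(1,2,4)] S(3) by simp
    qed
    then have "card X = card (\<rho> ` X)" by (simp add: card_image)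
    also have "\<dots> \<le> 16 ^ DIM(complex^'n^'n)"
    proof (rule S(4))
      show "\<rho> ` X \<subseteq> \<rho> ` G" using X by blast
      fix A B assume "A \<in> \<rho> ` X" "B \<in> \<rho> ` X" "A \<noteq> B"
      then obtain f h where "f \<in> X" "h \<in> X" "f \<noteq> h" "A = \<rho> f" "B = \<rho> h" by blast
      then show "matrix_inv A ** B \<notin> S" using key by simp
    qed
    finally show "card X \<le> 16 ^ DIM(complex^'n^'n)" .
  qed
qed

end

section \<open>Lifting self-maps of a quotient of the punctured space\<close>

locale punctured_cover =
  fixes Y :: "'a topology" and p :: "complex^'n \<Rightarrow> 'a"
  assumes dim: "CARD('n) \<ge> 2" and hausdorff: "Hausdorff_space Y"
    and cov: "covering_map (top_of_set (- {0})) Y p"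
begin

lemma cont_p: "continuous_map (top_of_set (- {0})) Y p"
  using cov by (simp add: covering_map_def)

lemma surj_p: "p ` (- {0}) = topspace Y"
  using cov by (simp add: covering_map_def)

lemma p_in: "z \<noteq> 0 \<Longrightarrow> p z \<in> topspace Y"
  using surj_p by blast

lemma openin_punctured: "openin (top_of_set (- {0 :: complex^'n})) U \<longleftrightarrow> open U \<and> U \<subseteq> - {0}"
  by (simp add: openin_open_eq open_Compl)

lemma open_preimage:
  assumes "continuous_map Y Y g" "openin Y T" shows "open {z. z \<noteq> 0 \<and> g (p z) \<in> T}"
proof -
  have "openin (top_of_set (- {0})) {z \<in> topspace (top_of_set (- {0})). (g \<circ> p) z \<in> T}"
    by (rule openin_continuous_map_preimage[OF continuous_map_compose[OF cont_p assms(1)] assms(2)])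
  then show ?thesis unfolding openin_punctured by (simp add: Collect_conj_eq Compl_eq)
qed

text \<open>The sheets are described by continuous sections \<open>q\<close> of \<open>p\<close>
  over \<open>T\<close>, which can be composed directly with \<open>g \<circ> p\<close>.\<close>

definition evenly :: "'a set \<Rightarrow> (complex^'n) set set \<Rightarrow> bool" where
  "evenly T v \<longleftrightarrow> openin Y T \<and> \<Union>v = {z. z \<noteq> 0 \<and> p z \<in> T} \<and> pairwise disjnt v \<and>
    (\<forall>u\<in>v. open u \<and> (\<exists>q. continuous_map (subtopology Y T) euclidean q \<and>
        (\<forall>t\<in>T. q t \<in> u \<and> p (q t) = t) \<and> (\<forall>w\<in>u. q (p w) = w)))"

lemma evenly_covered:
  assumes "y \<in> topspace Y"
  shows "\<exists>T v. y \<in> T \<and> evenly T v"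
proof -
  have "\<forall>x\<in>topspace Y. \<exists>T. x \<in> T \<and> openin Y T \<and> (\<exists>v. \<Union>v = {z \<in> - {0}. p z \<in> T} \<and>
      (\<forall>u\<in>v. openin (top_of_set (- {0})) u) \<and> pairwise disjnt v \<and>
      (\<forall>u\<in>v. homeomorphic_map (subtopology (top_of_set (- {0})) u) (subtopology Y T) p))"
    using cov unfolding covering_map_def topspace_euclidean_subtopology by (elim conjE)
  from bspec[OF this assms] obtain T v where T: "y \<in> T" "openin Y T" "\<Union>v = {z \<in> - {0}. p z \<in> T}"
    "\<forall>u\<in>v. openin (top_of_set (- {0})) u" "pairwise disjnt v"
    "\<forall>u\<in>v. homeomorphic_map (subtopology (top_of_set (- {0})) u) (subtopology Y T) p"
    by (elim exE conjE)
  have "\<exists>q. continuous_map (subtopology Y T) euclidean q \<and>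
        (\<forall>t\<in>T. q t \<in> u \<and> p (q t) = t) \<and> (\<forall>w\<in>u. q (p w) = w)" if u: "u \<in> v" for u
  proof -
    obtain q where q: "homeomorphic_maps (subtopology (top_of_set (- {0})) u) (subtopology Y T) p q"
      using bspec[OF T(6) u] homeomorphic_map_maps by blast
    have uW: "u \<subseteq> - {0}" using bspec[OF T(4) u] openin_punctured by blast
    have TY: "T \<subseteq> topspace Y" using T(2) by (rule openin_subset)
    have tops: "topspace (subtopology (top_of_set (- {0})) u) = u" "topspace (subtopology Y T) = T"
      using uW TY by auto
    have c: "continuous_map (subtopology Y T) (subtopology (top_of_set (- {0})) u) q"
      "\<And>w. w \<in> u \<Longrightarrow> q (p w) = w" "\<And>t. t \<in> T \<Longrightarrow> p (q t) = t"
      using q unfolding homeomorphic_maps_def tops by auto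
    then have "q t \<in> u" if "t \<in> T" for t using that continuous_map_image_subset_topspace[OF c(1)] unfolding tops by blast
    moreover have "continuous_map (subtopology Y T) euclidean q"
      using c(1) continuous_map_into_fulltopology by blast
    ultimately show ?thesis using c by blast
  qed
  moreover have "\<Union>v = {z. z \<noteq> 0 \<and> p z \<in> T}" using T(3) by auto
  moreover have "open u" if "u \<in> v" for u using bspec[OF T(4) that] openin_punctured by blast
  ultimately have "evenly T v" using T(2,5) unfolding evenly_def by simp
  then show ?thesis using T(1) by blast
qed

definition pullback :: "('a \<Rightarrow> 'a) \<Rightarrow> ((complex^'n) \<times> (complex^'n)) set" where
  "pullback g = {(z, w). z \<noteq> 0 \<and> w \<noteq> 0 \<and> p w = g (p z)}"

lemma g_in: "continuous_map Y Y g \<Longrightarrow> z \<noteq> 0 \<Longrightarrow> g (p z) \<in> topspace Y"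
  using p_in continuous_map_image_subset_topspace by blast

text \<open>Passing to the pullback of the covering along \<open>g \<circ> p\<close> makes the lifting theorems for subsets of
  normed spaces applicable, although \<open>Y\<close> is an abstract space.\<close>
lemma covering_space_pullback:
  assumes g: "continuous_map Y Y g" shows "covering_space (pullback g) fst (- {0})"
  unfolding covering_space_def
proof (intro conjI ballI)
  show "continuous_on (pullback g) fst" by (intro continuous_intros)
  show "fst ` pullback g = - {0}"
  proof
    show "- {0} \<subseteq> fst ` pullback g"
    proof
      fix z :: "complex^'n" assume z: "z \<in> - {0}"
      then have "g (p z) \<in> p ` (- {0})" using g_in[OF g] surj_p by simp
      then obtain w where "w \<in> - {0}" "p w = g (p z)" by force
      then have "(z, w) \<in> pullback g" using z by (auto simp: pullback_def)
      then show "z \<in> fst ` pullback g" by force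
    qed
  qed (auto simp: pullback_def)
  fix z0 :: "complex^'n" assume "z0 \<in> - {0}"
  then have z0: "z0 \<noteq> 0" by simp
  obtain T v where "g (p z0) \<in> T" "evenly T v" using evenly_covered[OF g_in[OF g z0]] by blast
  then have T: "g (p z0) \<in> T" "openin Y T" "\<Union>v = {z. z \<noteq> 0 \<and> p z \<in> T}" "pairwise disjnt v"
    "\<And>u. u \<in> v \<Longrightarrow> open u"
    "\<And>u. u \<in> v \<Longrightarrow> \<exists>q. continuous_map (subtopology Y T) euclidean q \<and>
        (\<forall>t\<in>T. q t \<in> u \<and> p (q t) = t) \<and> (\<forall>w\<in>u. q (p w) = w)"
    unfolding evenly_def by blast+
  define M where "M = {z. z \<noteq> 0 \<and> g (p z) \<in> T}"
  have oM: "open M" unfolding M_def by (rule open_preimage[OF g T(2)])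
  define V where "V = (\<lambda>u. (M \<times> u) \<inter> pullback g) ` v"
  have "\<Union>V = pullback g \<inter> fst -` M"
  proof
    show "pullback g \<inter> fst -` M \<subseteq> \<Union>V"
    proof
      fix x assume x: "x \<in> pullback g \<inter> fst -` M"
      then have "snd x \<in> \<Union>v" unfolding T(3) by (auto simp: pullback_def M_def)
      then show "x \<in> \<Union>V" using x by (auto simp: V_def) (metis IntI SigmaI UnionI prod.collapse)
    qed
  qed (auto simp: V_def)
  moreover have "openin (top_of_set (pullback g)) U" if "U \<in> V" for U
    using that oM T(5) by (auto simp: V_def Int_commute openin_open_Int open_Times)
  moreover have "pairwise disjnt V"
  proof (rule pairwiseI)
    fix A B assume "A \<in> V" "B \<in> V" "A \<noteq> B"
    then obtain u u' where "u \<in> v" "u' \<in> v" "u \<noteq> u'" "A = (M \<times> u) \<inter> pullback g" "B = (M \<times> u') \<inter> pullback g"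
      unfolding V_def by blast
    then show "disjnt A B" using T(4) by (auto simp: pairwise_def disjnt_def)
  qed
  moreover have "\<exists>q. homeomorphism U M fst q" if U: "U \<in> V" for U
  proof -
    obtain u where u: "u \<in> v" "U = (M \<times> u) \<inter> pullback g" using U unfolding V_def by blast
    obtain q where q: "continuous_map (subtopology Y T) euclidean q"
      "\<And>t. t \<in> T \<Longrightarrow> q t \<in> u \<and> p (q t) = t" "\<And>w. w \<in> u \<Longrightarrow> q (p w) = w" using T(6)[OF u(1)] by blast
    have "continuous_map (top_of_set M) (subtopology Y T) (g \<circ> p)"
    proof (rule continuous_map_into_subtopology)
      have "continuous_map (subtopology (top_of_set (- {0})) M) Y (g \<circ> p)"
        by (intro continuous_map_from_subtopology continuous_map_compose[OF cont_p g])
      moreover have "- {0} \<inter> M = M" by (auto simp: M_def)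
      ultimately show "continuous_map (top_of_set M) Y (g \<circ> p)" by (simp add: subtopology_subtopology)
    qed (auto simp: M_def)
    from continuous_map_compose[OF this q(1)] have "continuous_on M (\<lambda>z. q (g (p z)))"
      by (simp add: o_def)
    then have c: "continuous_on M (\<lambda>z. (z, q (g (p z))))" by (intro continuous_intros)
    have uW: "w \<noteq> 0" if "w \<in> u" for w using T(3) u(1) that by blast
    have "homeomorphism U M fst (\<lambda>z. (z, q (g (p z))))"
    proof (rule homeomorphismI)
      show "continuous_on U fst" by (intro continuous_intros)
      show "fst ` U \<subseteq> M" using u by auto
      show "(\<lambda>z. (z, q (g (p z)))) ` M \<subseteq> U"
      proof
        fix x assume "x \<in> (\<lambda>z. (z, q (g (p z)))) ` M"
        then obtain z where z: "z \<in> M" "x = (z, q (g (p z)))" by blast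
        then have "q (g (p z)) \<in> u" "p (q (g (p z))) = g (p z)" using q(2)[of "g (p z)"] by (auto simp: M_def)
        then show "x \<in> U" using z uW by (simp add: u(2) pullback_def M_def)
      qed
      show "(fst x, q (g (p (fst x)))) = x" if "x \<in> U" for x
      proof -
        have "snd x \<in> u" "p (snd x) = g (p (fst x))" using that by (auto simp: u(2) pullback_def)
        then have "q (g (p (fst x))) = snd x" using q(3)[of "snd x"] by simp
        then show ?thesis by simp
      qed
    qed (use c in auto)
    then show ?thesis by blast
  qed
  ultimately have "\<exists>v. \<Union>v = pullback g \<inter> fst -` M \<and> (\<forall>u\<in>v. openin (top_of_set (pullback g)) u) \<and>
      pairwise disjnt v \<and> (\<forall>u\<in>v. \<exists>q. homeomorphism u M fst q)"
    by (intro exI[of _ V]) simp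
  moreover have "z0 \<in> M" using z0 T by (simp add: M_def)
  moreover have "openin (top_of_set (- {0})) M" unfolding openin_punctured using oM by (auto simp: M_def)
  ultimately show "\<exists>T. z0 \<in> T \<and> openin (top_of_set (- {0})) T \<and>
      (\<exists>v. \<Union>v = pullback g \<inter> fst -` T \<and> (\<forall>u\<in>v. openin (top_of_set (pullback g)) u) \<and>
      pairwise disjnt v \<and> (\<forall>u\<in>v. \<exists>q. homeomorphism u T fst q))"
    by (intro exI[of _ M] conjI)
qed

section \<open>Existence and uniqueness of lifts\<close>

definition lifts :: "('a \<Rightarrow> 'a) \<Rightarrow> (complex^'n \<Rightarrow> complex^'n) set" where
  "lifts g = {f. f 0 = 0 \<and> continuous_on (- {0}) f \<and> (\<forall>z. z \<noteq> 0 \<longrightarrow> f z \<noteq> 0 \<and> p (f z) = g (p z))}"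

lemma dim_complex_vec: "DIM(complex^'n) \<ge> 4"
  using dim by simp

lemma lift_exists:
  assumes g: "continuous_map Y Y g" and zw: "z \<noteq> 0" "w \<noteq> 0" "p w = g (p z)"
  obtains f where "f \<in> lifts g" "f z = w"
proof -
  have zw': "(z, w) \<in> pullback g" "z \<in> - {0}" using zw by (auto simp: pullback_def)
  \<comment> \<open>The real dimension is at least 4, so removing a point does not create
    loops.\<close>
  have "simply_connected (- {0 :: complex^'n})"
    using dim_complex_vec by (intro simply_connected_punctured_universe) linarith
  moreover have "locally path_connected (- {0 :: complex^'n})"
    by (rule open_imp_locally_path_connected) (simp add: open_Compl)
  ultimately obtain s where s: "continuous_on (- {0}) s" "s \<in> (- {0}) \<rightarrow> pullback g" "s z = (z, w)"
    "\<And>y. y \<in> - {0} \<Longrightarrow> fst (s y) = y"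
    using covering_space_lift_strong[OF covering_space_pullback[OF g] zw', of id] by (auto simp: continuous_on_id)
  define f where "f y = (if y = 0 then 0 else snd (s y))" for y
  have "continuous_on (- {0}) (\<lambda>y. snd (s y))" by (intro continuous_intros s(1))
  then have "continuous_on (- {0}) f" by (rule continuous_on_eq) (simp add: f_def)
  moreover have "f y \<noteq> 0 \<and> p (f y) = g (p y)" if "y \<noteq> 0" for y
    using s(2) s(4)[of y] that by (auto simp: f_def pullback_def Pi_iff case_prod_unfold)
  ultimately have "f \<in> lifts g" by (simp add: lifts_def f_def)
  then show thesis using that s(3) zw by (simp add: f_def)
qed

lemma lift_unique:
  assumes g: "continuous_map Y Y g" and f: "f1 \<in> lifts g" "f2 \<in> lifts g" and z: "z \<noteq> 0" "f1 z = f2 z"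
  shows "f1 = f2"
proof
  fix x
  have con: "connected (- {0 :: complex^'n})"
    using dim_complex_vec by (intro connected_punctured_universe) simp
  have "(x, f1 x) = (x, f2 x)" if x: "x \<noteq> 0"
  proof (rule covering_space_lift_unique[OF covering_space_pullback[OF g], where T = "- {0}" and f = id and a = z
        and ?g1.0 = "\<lambda>y. (y, f1 y)" and ?g2.0 = "\<lambda>y. (y, f2 y)"])
    show "continuous_on (- {0}) (\<lambda>y. (y, f1 y))" "continuous_on (- {0}) (\<lambda>y. (y, f2 y))"
      using f by (auto simp: lifts_def intro!: continuous_intros)
    show "(\<lambda>y. (y, f1 y)) \<in> - {0} \<rightarrow> pullback g" "(\<lambda>y. (y, f2 y)) \<in> - {0} \<rightarrow> pullback g"
      using f by (auto simp: lifts_def pullback_def)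
  qed (use con x z in \<open>auto intro: continuous_on_id\<close>)
  then show "f1 x = f2 x" using f by (cases "x = 0") (auto simp: lifts_def)
qed

lemma lifts_id: "id \<in> lifts id"
  by (simp add: lifts_def continuous_on_id)

lemma liftsD:
  assumes "f \<in> lifts g"
  shows "f 0 = 0" "continuous_on (- {0}) f" "z \<noteq> 0 \<Longrightarrow> f z \<noteq> 0" "z \<noteq> 0 \<Longrightarrow> p (f z) = g (p z)"
  using assms unfolding lifts_def by blast+

lemma lifts_comp:
  assumes f: "f \<in> lifts g" and f': "f' \<in> lifts g'" shows "f \<circ> f' \<in> lifts (g \<circ> g')"
proof -
  have "f' ` (- {0}) \<subseteq> - {0}"
  proof (rule image_subsetI)
    fix z :: "complex^'n" assume "z \<in> - {0}"
    then have "z \<noteq> 0" by simp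
    from liftsD(3)[OF f' this] show "f' z \<in> - {0}" by simp
  qed
  then have "continuous_on (- {0}) (f \<circ> f')"
    by (intro continuous_on_compose liftsD(2)[OF f'] continuous_on_subset[OF liftsD(2)[OF f]])
  moreover have "(f \<circ> f') z \<noteq> 0 \<and> p ((f \<circ> f') z) = (g \<circ> g') (p z)" if "z \<noteq> 0" for z
    using liftsD(3)[OF f liftsD(3)[OF f' that]] liftsD(4)[OF f liftsD(3)[OF f' that]] liftsD(4)[OF f' that]
    by (simp only: comp_apply simp_thms)
  moreover have "(f \<circ> f') 0 = 0" using liftsD(1)[OF f] liftsD(1)[OF f'] by simp
  ultimately show ?thesis unfolding lifts_def by blast
qed

text \<open>The lift of \<open>g'\<close> is chosen to send \<open>f z\<close> back to
  \<open>z\<close>; both compositions are then lifts of the identity that fix a point.\<close>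

lemma lift_inverse:
  assumes g: "continuous_map Y Y g" "continuous_map Y Y g'" "g \<circ> g' = id" "g' \<circ> g = id" and f: "f \<in> lifts g"
  obtains f' where "f' \<in> lifts g'" "f \<circ> f' = id" "f' \<circ> f = id"
proof -
  define z :: "complex^'n" where "z = axis undefined 1"
  have z: "z \<noteq> 0" by (simp add: z_def axis_eq_0_iff)
  have fz: "f z \<noteq> 0" "p (f z) = g (p z)" using liftsD(3,4)[OF f z] .
  have "p z = g' (p (f z))" using fz fun_cong[OF g(4), of "p z"] by simp
  then obtain f' where f': "f' \<in> lifts g'" "f' (f z) = z" using lift_exists[OF g(2) fz(1) z] by blast
  have "continuous_map Y Y id" by (simp add: id_def)
  note unique = lift_unique[OF this _ lifts_id]
  have "f' \<circ> f = id" using lifts_comp[OF f'(1) f] f'(2) z unfolding g(4) by (intro unique) auto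
  moreover have "f \<circ> f' = id" using lifts_comp[OF f f'(1)] f'(2) fz unfolding g(3) by (intro unique[of _ "f z"]) auto
  ultimately show thesis using that f'(1) by blast
qed

lemma lifts_determine:
  assumes "f \<in> lifts g" "f \<in> lifts g'" "y \<in> topspace Y" shows "g y = g' y"
proof -
  obtain z where "z \<noteq> 0" "y = p z" using assms(3) surj_p by force
  then show ?thesis using liftsD(4)[OF assms(1)] liftsD(4)[OF assms(2)] by metis
qed

text \<open>The last clause retains that \<open>u\<close> is one of several disjoint open sheets
  over \<open>T\<close>: a connected set over \<open>T\<close> cannot cross from one sheet to
  another.\<close>

definition sheet :: "'a set \<Rightarrow> (complex^'n) set \<Rightarrow> bool" where
  "sheet T u \<longleftrightarrow> openin Y T \<and> open u \<and> u \<subseteq> - {0} \<and> inj_on p u \<and> p ` u = T \<and>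
    (\<forall>O'. open O' \<longrightarrow> openin Y (p ` (u \<inter> O'))) \<and>
    (\<forall>C. connected C \<longrightarrow> C \<subseteq> {z. z \<noteq> 0 \<and> p z \<in> T} \<longrightarrow> C \<inter> u \<noteq> {} \<longrightarrow> C \<subseteq> u)"

lemma sheet_exists:
  assumes "w \<noteq> 0"
  shows "\<exists>T u. w \<in> u \<and> sheet T u"
proof -
  obtain T v where "p w \<in> T" "evenly T v" using evenly_covered[OF p_in[OF assms]] by blast
  then have T: "p w \<in> T" "openin Y T" "\<Union>v = {z. z \<noteq> 0 \<and> p z \<in> T}" "pairwise disjnt v"
    "\<And>u. u \<in> v \<Longrightarrow> open u"
    "\<And>u. u \<in> v \<Longrightarrow> \<exists>q. continuous_map (subtopology Y T) euclidean q \<and>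
        (\<forall>t\<in>T. q t \<in> u \<and> p (q t) = t) \<and> (\<forall>w\<in>u. q (p w) = w)"
    unfolding evenly_def by blast+
  have "w \<in> \<Union>v" using T assms by simp
  then obtain u where u: "u \<in> v" "w \<in> u" by blast
  have uT: "u \<subseteq> {z. z \<noteq> 0 \<and> p z \<in> T}" using T(3) u by blast
  obtain q where q: "continuous_map (subtopology Y T) euclidean q"
      "\<And>t. t \<in> T \<Longrightarrow> q t \<in> u \<and> p (q t) = t" "\<And>w. w \<in> u \<Longrightarrow> q (p w) = w" using T(6)[OF u(1)] by blast
  have "inj_on p u" using q(3) by (rule inj_on_inverseI)
  moreover have "p ` u = T"
  proof
    show "T \<subseteq> p ` u" using q(2) by (metis image_eqI subsetI)
  qed (use uT in auto)
  moreover have "openin Y (p ` (u \<inter> O'))" if O': "open O'" for O'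
  proof -
    have tT: "topspace (subtopology Y T) = T" using openin_subset[OF T(2)] by auto
    have "openin (subtopology Y T) {t \<in> topspace (subtopology Y T). q t \<in> O'}"
      by (rule openin_continuous_map_preimage[OF q(1)]) (use O' in simp)
    moreover have "{t \<in> topspace (subtopology Y T). q t \<in> O'} = p ` (u \<inter> O')"
    proof
      show "{t \<in> topspace (subtopology Y T). q t \<in> O'} \<subseteq> p ` (u \<inter> O')"
        unfolding tT using q(2) by (auto intro!: image_eqI[of _ p "q _"])
      show "p ` (u \<inter> O') \<subseteq> {t \<in> topspace (subtopology Y T). q t \<in> O'}"
        unfolding tT using q(3) uT by auto
    qed
    ultimately show ?thesis using openin_trans_full[OF _ T(2)] by simp
  qed
  moreover have "C \<subseteq> u" if C: "connected C" "C \<subseteq> {z. z \<noteq> 0 \<and> p z \<in> T}" "C \<inter> u \<noteq> {}" for C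
  proof (rule ccontr)
    assume n: "\<not> C \<subseteq> u"
    have "open (\<Union>(v - {u}))" using T(5) by auto
    moreover have "C \<subseteq> u \<union> \<Union>(v - {u})" using C(2) T(3) by blast
    moreover have "u \<inter> \<Union>(v - {u}) = {}" using T(4) u(1) by (auto simp: pairwise_def disjnt_def)
    moreover have "\<Union>(v - {u}) \<inter> C \<noteq> {}" using n C(2) T(3) by blast
    ultimately show False using connectedD[OF C(1) T(5)[OF u(1)]] C(3) by blast
  qed
  moreover have "u \<subseteq> - {0}" using uT by auto
  ultimately have "sheet T u" using T(2) T(5)[OF u(1)] unfolding sheet_def by simp
  then show ?thesis using u(2) by blast
qed

text \<open>Finiteness is local in the pair of a source and a target point, and
  \<open>K \<times> K\<close> is compact. If the target does not lie over the image of the source,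
  Hausdorff separation leaves no lift; otherwise neighbourhoods can be chosen that admit at most
  one.\<close>

lemma lifts_discontinuous:
  assumes g: "continuous_map Y Y g" and K: "compact K" "0 \<notin> K"
  shows "finite {f \<in> lifts g. f ` K \<inter> K \<noteq> {}}"
proof -
  have local: "\<exists>C D. open C \<and> open D \<and> a \<in> C \<and> b \<in> D \<and> finite {f \<in> lifts g. f ` (C - {0}) \<inter> D \<noteq> {}}"
    if ab: "a \<noteq> 0" "b \<noteq> 0" for a b
  proof (cases "p b = g (p a)")
    case False
    then obtain U V where UV: "openin Y U" "openin Y V" "g (p a) \<in> U" "p b \<in> V" "disjnt U V"
      using hausdorff g_in[OF g ab(1)] p_in[OF ab(2)] unfolding Hausdorff_space_def by metis
    define C where "C = {z. z \<noteq> 0 \<and> g (p z) \<in> U}"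
    define D where "D = {z. z \<noteq> 0 \<and> id (p z) \<in> V}"
    have op: "open C" "open D" unfolding C_def D_def using UV g by (auto intro!: open_preimage simp: id_def)
    have "{f \<in> lifts g. f ` (C - {0}) \<inter> D \<noteq> {}} = {}"
    proof (rule ccontr)
      assume "\<not> ?thesis"
      then obtain f z where f: "f \<in> lifts g" "z \<in> C - {0}" "f z \<in> D" by auto
      then have "p (f z) = g (p z)" by (simp add: lifts_def)
      then have "p (f z) \<in> U \<inter> V" using f(2,3) by (simp add: C_def D_def)
      then show False using UV(5) by (auto simp: disjnt_def)
    qed
    then have "finite {f \<in> lifts g. f ` (C - {0}) \<inter> D \<noteq> {}}" by (simp only: finite.emptyI)
    moreover have "a \<in> C" "b \<in> D" using UV ab by (auto simp: C_def D_def)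
    ultimately show ?thesis using op by - (rule exI[of _ C], rule exI[of _ D], simp)
  next
    case True
    obtain T u where "b \<in> u" "sheet T u" using sheet_exists[OF ab(2)] by blast
    then have T: "p b \<in> T" "openin Y T" "open u" "b \<in> u" "u \<subseteq> - {0}" "inj_on p u"
      "\<And>C. connected C \<Longrightarrow> C \<subseteq> {z. z \<noteq> 0 \<and> p z \<in> T} \<Longrightarrow> C \<inter> u \<noteq> {} \<Longrightarrow> C \<subseteq> u"
      by (auto simp: sheet_def)
    have "open {z. z \<noteq> 0 \<and> g (p z) \<in> T}" by (rule open_preimage[OF g T(2)])
    moreover have "a \<in> {z. z \<noteq> 0 \<and> g (p z) \<in> T}" using ab T True by simp
    ultimately obtain r where r: "r > 0" "ball a r \<subseteq> {z. z \<noteq> 0 \<and> g (p z) \<in> T}" using open_contains_ball by blast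
    \<comment> \<open>A lift that carries some point of the ball into the sheet carries the whole
      ball, in particular its centre, into it; on the sheet \<open>p\<close> is injective, so the
      value at the centre is determined.\<close>
    have in_u: "f a \<in> u" if f: "f \<in> lifts g" "f ` (ball a r - {0}) \<inter> u \<noteq> {}" for f
    proof -
      have "0 \<notin> ball a r" using r(2) by blast
      then have b0: "ball a r - {0} = ball a r" by (rule Diff_insert0[of _ _ "{}", simplified])
      have "continuous_on (ball a r) f"
          by (rule continuous_on_subset[OF liftsD(2)[OF f(1)]]) (use r in blast)
      then have "connected (f ` ball a r)" by (intro connected_continuous_image) auto
      moreover have "f ` ball a r \<subseteq> {z. z \<noteq> 0 \<and> p z \<in> T}"
      proof (rule image_subsetI)
        fix z assume "z \<in> ball a r"
        from subsetD[OF r(2) this] have z: "z \<noteq> 0" "g (p z) \<in> T" by simp_all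
        then show "f z \<in> {z. z \<noteq> 0 \<and> p z \<in> T}" using liftsD(3,4)[OF f(1) z(1)] by simp
      qed
      ultimately have "f ` ball a r \<subseteq> u" using T(7) f(2) b0 by metis
      then show ?thesis using r by auto
    qed
    have "f1 = f2" if f: "f1 \<in> {f \<in> lifts g. f ` (ball a r - {0}) \<inter> u \<noteq> {}}" "f2 \<in> {f \<in> lifts g. f ` (ball a r - {0}) \<inter> u \<noteq> {}}" for f1 f2
    proof (rule lift_unique[OF g _ _ ab(1)])
      show "f1 \<in> lifts g" "f2 \<in> lifts g" using f by auto
      have "p (f1 a) = g (p a)" "p (f2 a) = g (p a)" using f liftsD(4) ab(1) by simp_all
      then have "p (f1 a) = p (f2 a)" by simp
      then show "f1 a = f2 a" using in_u f inj_onD[OF T(6)] by blast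
    qed
    then have at_most_one: "f1 = f2" if "f1 \<in> X" "f2 \<in> X" "X = {f \<in> lifts g. f ` (ball a r - {0}) \<inter> u \<noteq> {}}" for f1 f2 X
      using that by simp
    have "finite {f \<in> lifts g. f ` (ball a r - {0}) \<inter> u \<noteq> {}}" (is "finite ?X")
    proof (cases "?X = {}")
      case False
      then obtain f0 where "f0 \<in> ?X" by blast
      then have "?X \<subseteq> {f0}" using at_most_one[OF _ _ refl] by blast
      then show ?thesis by (rule finite_subset) simp
    qed (simp only: finite.emptyI)
    then show ?thesis using T(3,4) r(1) by - (rule exI[of _ "ball a r"], rule exI[of _ u], simp)
  qed
  have "\<exists>O'. open O' \<and> c \<in> O' \<and> finite {f \<in> lifts g. \<exists>k\<in>K. (k, f k) \<in> O'}" if c: "c \<in> K \<times> K" for c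
  proof -
    obtain a b where ab: "c = (a, b)" "a \<noteq> 0" "b \<noteq> 0" using c K(2) by force
    obtain C D where CD: "open C" "open D" "a \<in> C" "b \<in> D" "finite {f \<in> lifts g. f ` (C - {0}) \<inter> D \<noteq> {}}"
      using local[OF ab(2,3)] by blast
    have "{f \<in> lifts g. \<exists>k\<in>K. (k, f k) \<in> C \<times> D} \<subseteq> {f \<in> lifts g. f ` (C - {0}) \<inter> D \<noteq> {}}"
      using K(2) by blast
    then have "finite {f \<in> lifts g. \<exists>k\<in>K. (k, f k) \<in> C \<times> D}" using CD(5) by (rule finite_subset)
    then show ?thesis using CD(1-4) ab(1) by - (rule exI[of _ "C \<times> D"], simp add: open_Times)
  qed
  then have "\<forall>c\<in>K \<times> K. \<exists>O'. open O' \<and> c \<in> O' \<and> finite {f \<in> lifts g. \<exists>k\<in>K. (k, f k) \<in> O'}" by blast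
  from bchoice[OF this] obtain W where W: "\<forall>c\<in>K \<times> K. open (W c) \<and> c \<in> W c \<and> finite {f \<in> lifts g. \<exists>k\<in>K. (k, f k) \<in> W c}" ..
  have "compact (K \<times> K)" using K(1) by (rule compact_Times[OF _ K(1)])
  moreover have "\<And>c. c \<in> K \<times> K \<Longrightarrow> open (W c)" using W by blast
  moreover have "K \<times> K \<subseteq> (\<Union>c\<in>K \<times> K. W c)" using W by blast
  ultimately obtain X where X: "X \<subseteq> K \<times> K" "finite X" "K \<times> K \<subseteq> (\<Union>c\<in>X. W c)"
    by (rule compactE_image)
  have "{f \<in> lifts g. f ` K \<inter> K \<noteq> {}} \<subseteq> (\<Union>c\<in>X. {f \<in> lifts g. \<exists>k\<in>K. (k, f k) \<in> W c})"
  proof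
    fix f assume "f \<in> {f \<in> lifts g. f ` K \<inter> K \<noteq> {}}"
    then obtain k where f: "f \<in> lifts g" "f k \<in> K" "k \<in> K" by auto
    then have "(k, f k) \<in> (\<Union>c\<in>X. W c)" using X(3) by blast
    then show "f \<in> (\<Union>c\<in>X. {f \<in> lifts g. \<exists>k\<in>K. (k, f k) \<in> W c})" using f by blast
  qed
  moreover have "finite (\<Union>c\<in>X. {f \<in> lifts g. \<exists>k\<in>K. (k, f k) \<in> W c})"
    using X(1,2) W by (intro finite_UN_I) blast+
  ultimately show ?thesis by (rule finite_subset)
qed

text \<open>Small balls in sheets have open images; finitely many images cover, and the
  corresponding closed balls still avoid the puncture.\<close>

lemma compact_fundamental_set:
  assumes "compact_space Y"
  obtains K where "compact K" "0 \<notin> K" "p ` K = topspace Y"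
proof -
  have "\<exists>z r. z \<noteq> 0 \<and> r > 0 \<and> cball z r \<subseteq> - {0} \<and> openin Y (p ` ball z r) \<and> y \<in> p ` ball z r" if y: "y \<in> topspace Y" for y
  proof -
    obtain z where z: "z \<noteq> 0" "p z = y" using y surj_p by force
    obtain T u where "z \<in> u" "sheet T u" using sheet_exists[OF z(1)] by blast
    then have u: "open u" "z \<in> u" "u \<subseteq> - {0}" "\<And>O'. open O' \<Longrightarrow> openin Y (p ` (u \<inter> O'))"
      unfolding sheet_def by blast+
    obtain r where r: "r > 0" "cball z r \<subseteq> u" using u open_contains_cball by blast
    have "u \<inter> ball z r = ball z r" using r by force
    then have "openin Y (p ` ball z r)" using u(4)[of "ball z r"] by simp
    moreover have "cball z r \<subseteq> - {0}" using r u by blast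
    ultimately show ?thesis using z r centre_in_ball[of z r] by blast
  qed
  then obtain Z R where ZR: "\<And>y. y \<in> topspace Y \<Longrightarrow> R y > 0 \<and> cball (Z y) (R y) \<subseteq> - {0} \<and>
      openin Y (p ` ball (Z y) (R y)) \<and> y \<in> p ` ball (Z y) (R y)" by metis
  define \<U> where "\<U> = (\<lambda>y. p ` ball (Z y) (R y)) ` topspace Y"
  have "compactin Y (topspace Y)" using assms by (simp add: compact_space_def)
  moreover have "\<forall>U\<in>\<U>. openin Y U" "topspace Y \<subseteq> \<Union>\<U>" using ZR by (auto simp: \<U>_def)
  ultimately obtain \<F> where F: "finite \<F>" "\<F> \<subseteq> \<U>" "topspace Y \<subseteq> \<Union>\<F>" unfolding compactin_def by meson
  obtain X where X: "X \<subseteq> topspace Y" "finite X" "\<F> = (\<lambda>y. p ` ball (Z y) (R y)) ` X"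
    using finite_subset_image[OF F(1) F(2)[unfolded \<U>_def]] by blast
  define K where "K = (\<Union>y\<in>X. cball (Z y) (R y))"
  have "compact K" unfolding K_def using X by (intro compact_UN) auto
  moreover have K0: "K \<subseteq> - {0}" using ZR X unfolding K_def by blast
  moreover have "p ` K = topspace Y"
  proof
    show "p ` K \<subseteq> topspace Y" using K0 surj_p by blast
    show "topspace Y \<subseteq> p ` K"
    proof
      fix y assume "y \<in> topspace Y"
      then obtain x where "x \<in> X" "y \<in> p ` ball (Z x) (R x)" using F(3) X(3) by auto
      then show "y \<in> p ` K" unfolding K_def using ball_subset_cball by blast
    qed
  qed
  ultimately show thesis using that by blast
qed

end

section \<open>Automorphism groups of Hopf manifolds\<close>

lemma holo_on_cong:
  assumes "holo_on F U" "\<And>z. z \<in> U \<Longrightarrow> F z = F' z" shows "holo_on F' U"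
  unfolding holo_on_def
proof (intro conjI ballI)
  show oU: "open U" using assms(1) by (simp add: holo_on_def)
  fix z assume z: "z \<in> U"
  obtain L where L: "(F has_derivative L) (at z)" "\<forall>c v. L (c *s v) = c *s L v"
    using assms(1) z unfolding holo_on_def by blast
  have "(F' has_derivative L) (at z)"
    using assms(2) by (rule has_derivative_transform_within_open[OF L(1) oU z])
  then show "\<exists>L. (F' has_derivative L) (at z) \<and> (\<forall>c v. L (c *s v) = c *s L v)" using L(2) by blast
qed

lemma holo_on_locally:
  assumes "open U" "\<And>z. z \<in> U \<Longrightarrow> \<exists>V. z \<in> V \<and> holo_on F V" shows "holo_on F U"
  using assms unfolding holo_on_def by blast

context punctured_cover
begin

text \<open>In charts a lift is \<open>(\<psi> \<circ> p)\<inverse> \<circ> (\<psi> \<circ> g \<circ> \<phi>\<inverse>) \<circ> (\<phi> \<circ> p)\<close>, where the local inverse of the injective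
  holomorphic map \<open>\<psi> \<circ> p\<close> is holomorphic.\<close>
lemma lifts_holo:
  fixes A :: "(('a \<Rightarrow> complex^'n) \<times> 'a set) set"
  assumes Y: "complex_manifold Y A" and hp: "holo_map (top_of_set (- {0})) punctured_atlas Y A p"
    and hg: "holo_map Y A Y A g" and f: "f \<in> lifts g"
  shows "holo_on f (- {0})"
proof (rule holo_on_locally)
  show "open (- {0 :: complex^'n})" by (simp add: open_Compl)
  fix z :: "complex^'n" assume "z \<in> - {0}"
  then have z: "z \<noteq> 0" by simp
  note fz = liftsD(3,4)[OF f z]
  have chart_ex: "\<exists>\<phi> U. (\<phi>, U) \<in> A \<and> y \<in> U" if "y \<in> topspace Y" for y
  proof -
    have "\<Union> (snd ` A) = topspace Y" using Y unfolding complex_manifold_def by blast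
    then have "y \<in> \<Union> (snd ` A)" using that by simp
    then obtain c where "c \<in> A" "y \<in> snd c" by (elim UnionE imageE) simp
    then show ?thesis by - (rule exI[of _ "fst c"], rule exI[of _ "snd c"], simp)
  qed
  have chart: "openin Y U" "inj_on \<phi> U" if "(\<phi>, U) \<in> A" for \<phi> U
  proof -
    have "\<forall>(\<phi>,U)\<in>A. complex_chart Y \<phi> U" using Y unfolding complex_manifold_def by (elim conjE)
    from bspec[OF this that] have c: "complex_chart Y \<phi> U" by simp
    show op: "openin Y U" using c unfolding complex_chart_def by blast
    have "topspace (subtopology Y U) = U" using openin_subset[OF op] by auto
    then show "inj_on \<phi> U"
      using c homeomorphic_imp_injective_map[of "subtopology Y U" "top_of_set (\<phi> ` U)" \<phi>]
      unfolding complex_chart_def by simp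
  qed
  have chart_p: "holo_on (\<phi> \<circ> p) {z. z \<noteq> 0 \<and> p z \<in> U}" if "(\<phi>, U) \<in> A" for \<phi> U
  proof -
    have "\<forall>(\<phi>,U)\<in>A. holo_on (\<phi> \<circ> p \<circ> inv_into (- {0}) id) (id ` {x \<in> - {0}. p x \<in> U})"
      using hp unfolding holo_map_def punctured_atlas_def by simp
    from bspec[OF this that] have h: "holo_on (\<phi> \<circ> p \<circ> inv_into (- {0}) id) {z. z \<noteq> 0 \<and> p z \<in> U}"
      by (simp add: Collect_conj_eq Compl_eq)
    show ?thesis
    proof (rule holo_on_cong[OF h])
      fix z assume "z \<in> {z. z \<noteq> 0 \<and> p z \<in> U}"
      then have "inv_into (- {0}) id z = z" using inv_into_f_f[of id "- {0}" z] by simp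
      then show "(\<phi> \<circ> p \<circ> inv_into (- {0}) id) z = (\<phi> \<circ> p) z" by simp
    qed
  qed
  obtain \<phi> U where \<phi>: "(\<phi>, U) \<in> A" "p z \<in> U" using chart_ex[OF p_in[OF z]] by blast
  obtain \<psi> V where \<psi>: "(\<psi>, V) \<in> A" "p (f z) \<in> V" using chart_ex[OF p_in[OF fz(1)]] by blast
  obtain T u where "f z \<in> u" "sheet T u" using sheet_exists[OF fz(1)] by blast
  then have u: "open u" "f z \<in> u" "u \<subseteq> - {0}" "inj_on p u" unfolding sheet_def by blast+
  define N where "N = u \<inter> {w. w \<noteq> 0 \<and> p w \<in> V}"
  define F where "F = \<psi> \<circ> p"
  have oN: "open N" using u(1) chart_p[OF \<psi>(1)] unfolding N_def holo_on_def by (intro open_Int) blast+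
  have hF: "holo_on F N" unfolding F_def by (rule holo_on_subset[OF chart_p[OF \<psi>(1)] oN]) (auto simp: N_def)
  have "inj_on F N" unfolding F_def
    using u(4) chart(2)[OF \<psi>(1)] by (intro comp_inj_on) (auto simp: N_def intro: inj_on_subset)
  \<comment> \<open>The covering is known to be holomorphic in charts but not to be immersive there;
    regularity is drawn from injectivity on the sheet.\<close>
  note inv = holo_inverse[OF hF this injective_holo_regular[OF hF this]]
  have fN: "f z \<in> N" using u \<psi> fz by (simp add: N_def)
  define M where "M = {y \<in> - {0}. f y \<in> N} \<inter> {y. y \<noteq> 0 \<and> p y \<in> U}"
  have "open (- {0} \<inter> f -` N)"
    by (rule continuous_open_preimage[OF liftsD(2)[OF f] _ oN]) (simp add: open_Compl)
  then have "open {y \<in> - {0}. f y \<in> N}" by (simp add: vimage_def Int_def)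
  then have oM: "open M" using chart_p[OF \<phi>(1)] unfolding M_def holo_on_def by (intro open_Int) blast+
  have zM: "z \<in> M" using z fN \<phi> by (simp add: M_def)
  have M: "y \<noteq> 0" "f y \<in> N" "p y \<in> U" "p (f y) = g (p y)" "g (p y) \<in> V" if "y \<in> M" for y
  proof -
    show "y \<noteq> 0" "f y \<in> N" "p y \<in> U" using that by (auto simp: M_def)
    then show "p (f y) = g (p y)" using liftsD(4)[OF f] by blast
    then show "g (p y) \<in> V" using \<open>f y \<in> N\<close> by (simp add: N_def)
  qed
  define R where "R = (\<psi> \<circ> g \<circ> inv_into U \<phi>) \<circ> (\<phi> \<circ> p)"
  have hR: "holo_on R M" unfolding R_def
  proof (rule holo_compose)
    show "holo_on (\<phi> \<circ> p) M" by (rule holo_on_subset[OF chart_p[OF \<phi>(1)] oM]) (auto simp: M_def)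
    have "\<forall>(\<phi>,U)\<in>A. \<forall>(\<psi>,V)\<in>A. holo_on (\<psi> \<circ> g \<circ> inv_into U \<phi>) (\<phi> ` {x\<in>U. g x \<in> V})"
      using hg unfolding holo_map_def by (elim conjE)
    from bspec[OF this \<phi>(1)] have "\<forall>(\<psi>,V)\<in>A. holo_on (\<psi> \<circ> g \<circ> inv_into U \<phi>) (\<phi> ` {x\<in>U. g x \<in> V})"
      by simp
    from bspec[OF this \<psi>(1)] show "holo_on (\<psi> \<circ> g \<circ> inv_into U \<phi>) (\<phi> ` {x\<in>U. g x \<in> V})" by simp
    show "(\<phi> \<circ> p) ` M \<subseteq> \<phi> ` {x\<in>U. g x \<in> V}" using M(3,5) by auto
  qed
  have RF: "R y = F (f y)" if "y \<in> M" for y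
    using M(3,4)[OF that] inv_into_f_f[OF chart(2)[OF \<phi>(1)]] by (simp add: R_def F_def)
  have "holo_on (inv_into N F \<circ> R) M"
    by (rule holo_compose[OF hR inv(2)]) (use RF M(2) in auto)
  then have "holo_on f M"
  proof (rule holo_on_cong)
    fix y assume y: "y \<in> M"
    then show "(inv_into N F \<circ> R) y = f y" using RF M(2) \<open>inj_on F N\<close> by simp
  qed
  then show "\<exists>V. z \<in> V \<and> holo_on f V" using zM by blast
qed

end

text \<open>By pigeonhole two powers of \<open>g\<close> coincide, and injectivity cancels the
  common part, so a power of \<open>g\<close> is its inverse. This yields inverses under composition
  without first making the automorphisms a group.\<close>

lemma finite_composition_inverse:
  assumes H: "finite H" "id \<in> H" "\<And>f g. f \<in> H \<Longrightarrow> g \<in> H \<Longrightarrow> f \<circ> g \<in> H" and g: "g \<in> H" "inj g"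
  obtains h where "h \<in> H" "g \<circ> h = id" "h \<circ> g = id"
proof -
  have pow: "g ^^ k \<in> H" for k
  proof (induction k)
    case (Suc k)
    from H(3)[OF g(1) this] show ?case by (simp only: funpow.simps)
  qed (simp only: funpow.simps H(2))
  obtain i j where ij: "i < j" "g ^^ i = g ^^ j"
    using pigeonhole_pair[OF H(1), of "\<lambda>k. g ^^ k", OF pow] by blast
  define m where "m = j - i - 1"
  have j: "j = i + Suc m" using ij by (simp add: m_def)
  have "g ^^ Suc m = id"
  proof
    fix x
    have "(g ^^ i) x = (g ^^ i) ((g ^^ Suc m) x)"
      using fun_cong[OF ij(2), of x] unfolding j funpow_add by (simp only: comp_apply)
    then show "(g ^^ Suc m) x = id x" using inj_fn[OF g(2), of i] by (simp add: inj_eq del: funpow.simps)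
  qed
  note gm = this
  have "g \<circ> (g ^^ m) = id" using gm by (simp only: funpow.simps)
  moreover have "(g ^^ m) \<circ> g = id" using gm by (simp only: funpow_Suc_right)
  ultimately show thesis using that pow by blast
qed

text \<open>The centralizer of an element is closed under products and inverses; this is used twice,
  once for each of the two generated elements.\<close>

lemma (in group) generate_commute:
  assumes S: "S \<subseteq> carrier G" "\<And>a b. a \<in> S \<Longrightarrow> b \<in> S \<Longrightarrow> a \<otimes> b = b \<otimes> a"
    and ab: "a \<in> generate G S" "b \<in> generate G S"
  shows "a \<otimes> b = b \<otimes> a"
proof -
  have gen: "a \<otimes> x = x \<otimes> a" if x: "x \<in> carrier G" "\<And>s. s \<in> S \<Longrightarrow> s \<otimes> x = x \<otimes> s" and a: "a \<in> generate G S" for a x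
    using a
  proof (induction a rule: generate.induct)
    case (inv s)
    then have s: "s \<in> carrier G" using S by blast
    have "inv s \<otimes> x = inv s \<otimes> (x \<otimes> s) \<otimes> inv s" using s x(1) by (simp add: m_assoc)
    also have "\<dots> = inv s \<otimes> (s \<otimes> x) \<otimes> inv s" using x(2)[OF inv] by simp
    also have "\<dots> = x \<otimes> inv s" using s x(1) by (simp add: m_assoc[symmetric])
    finally show ?case .
  next
    case (eng a b)
    have "a \<in> carrier G" "b \<in> carrier G" using eng generate_in_carrier[OF S(1)] by auto
    then show ?case using eng x(1) by (metis m_assoc)
  qed (use x in auto)
  have "b \<otimes> s = s \<otimes> b" if "s \<in> S" for s using that S gen[of s b] ab by blast
  moreover have "b \<in> carrier G" using ab generate_in_carrier[OF S(1)] by auto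
  ultimately show ?thesis using gen[of b a] ab by metis
qed

text \<open>The lifts of the elements of a finite group \<open>H\<close> of automorphisms form a \<open>hopf_group\<close>, an extension of
  \<open>H\<close> by the deck transformations.\<close>
theorem theorem1p4:
  fixes Y :: "'a topology" and A :: "(('a \<Rightarrow> complex^'n) \<times> 'a set) set"
  assumes "hopf_manifold Y A"
  shows "jordan_group (aut_group Y A)"
  unfolding jordan_group_def
\<comment> \<open>The successor turns the bound into the strict inequality of the
  definition.\<close>
proof (intro exI[of _ "Suc (16 ^ DIM(complex^'n^'n))"] allI impI)
  fix H assume "subgroup H (aut_group Y A) \<and> finite H"
  then have sub: "subgroup H (aut_group Y A)" and finH: "finite H" by auto
  obtain p :: "complex^'n \<Rightarrow> 'a" where n: "CARD('n) \<ge> 2" and Y: "complex_manifold Y A" "compact_space Y"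
    and p: "covering_map (top_of_set (- {0})) Y p" "holo_map (top_of_set (- {0})) punctured_atlas Y A p"
    using assms unfolding hopf_manifold_def punctured_space_def by blast
  have "Hausdorff_space Y" using Y by (simp add: complex_manifold_def)
  with n p interpret C: punctured_cover Y p by unfold_locales
  let ?G = "aut_group Y A"
  have ops: "x \<otimes>\<^bsub>?G\<^esub> y = x \<circ> y" "\<one>\<^bsub>?G\<^esub> = id" for x y by (simp_all add: aut_group_def)
  have HG: "H \<subseteq> carrier ?G" using sub by (rule subgroup.subset)
  have idH: "id \<in> H" using subgroup.one_closed[OF sub] by (simp add: ops)
  have compH: "f \<circ> g \<in> H" if "f \<in> H" "g \<in> H" for f g using subgroup.m_closed[OF sub that] by (simp add: ops)
  have auto: "biholo_auto Y A g" "\<And>x. x \<notin> topspace Y \<Longrightarrow> g x = x" if "g \<in> H" for g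
    using HG that unfolding aut_group_def by auto
  have holoH: "holo_map Y A Y A g" and contH: "continuous_map Y Y g" if "g \<in> H" for g
    using auto(1)[OF that] unfolding biholo_auto_def holo_map_def by blast+
  \<comment> \<open>Being the identity outside \<open>Y\<close>, an automorphism is injective on the
    whole type, as the inverse by powers requires.\<close>
  have injH: "inj g" if g: "g \<in> H" for g
  proof (rule injI)
    fix x y assume eq: "g x = g y"
    have bij: "bij_betw g (topspace Y) (topspace Y)" using auto(1)[OF g] by (simp add: biholo_auto_def)
    have "x \<in> topspace Y \<longleftrightarrow> g x \<in> topspace Y" for x
      using bij_betwE[OF bij] auto(2)[OF g] by metis
    then show "x = y" using eq bij_betw_imp_inj_on[OF bij] auto(2)[OF g] by (metis inj_onD)
  qed
  have inverse: "\<exists>h\<in>H. g \<circ> h = id \<and> h \<circ> g = id" if "g \<in> H" for g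
    using finite_composition_inverse[OF finH idH compH that injH[OF that]] by blast
  have ext: "g = g'" if "g \<in> H" "g' \<in> H" "f \<in> C.lifts g" "f \<in> C.lifts g'" for g g' f
  \<comment> \<open>A lift determines the automorphism on \<open>Y\<close>, and the normalization
    determines it elsewhere.\<close>
  proof
    fix x
    show "g x = g' x" using C.lifts_determine[OF that(3,4)] auto(2)[OF that(1)] auto(2)[OF that(2)] by (cases "x \<in> topspace Y") auto
  qed
  define L where "L = (\<Union>g\<in>H. C.lifts g)"
  have L_I: "f \<in> L" if "g \<in> H" "f \<in> C.lifts g" for f g using that unfolding L_def by blast
  interpret L: hopf_group L
  proof
    show "CARD('n) \<ge> 2" by (rule n)
    show "f 0 = 0" if "f \<in> L" for f using that C.liftsD(1) by (auto simp: L_def)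
    show "f z \<noteq> 0" if "f \<in> L" "z \<noteq> 0" for f z using that C.liftsD(3) unfolding L_def by blast
    show "holo_on f (- {0})" if "f \<in> L" for f
      using that C.lifts_holo[OF Y(1) p(2) holoH] unfolding L_def by blast
    show "id \<in> L" using C.lifts_id idH unfolding L_def by blast
    show "f \<circ> f' \<in> L" if "f \<in> L" "f' \<in> L" for f f'
    proof -
      obtain g g' where g: "g \<in> H" "g' \<in> H" "f \<in> C.lifts g" "f' \<in> C.lifts g'" using \<open>f \<in> L\<close> \<open>f' \<in> L\<close> unfolding L_def by blast
      show ?thesis by (rule L_I[OF compH[OF g(1,2)] C.lifts_comp[OF g(3,4)]])
    qed
    show "\<exists>f'\<in>L. f \<circ> f' = id \<and> f' \<circ> f = id" if "f \<in> L" for f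
    proof -

      obtain g where g: "g \<in> H" "f \<in> C.lifts g" using \<open>f \<in> L\<close> unfolding L_def by blast
      obtain h where h: "h \<in> H" "g \<circ> h = id" "h \<circ> g = id" using inverse[OF g(1)] by blast
      obtain f' where f': "f' \<in> C.lifts h" "f \<circ> f' = id" "f' \<circ> f = id"
        by (rule C.lift_inverse[OF contH[OF g(1)] contH[OF h(1)] h(2,3) g(2)])
      show ?thesis using f'(2,3) by (intro bexI[of _ f'] conjI L_I[OF h(1) f'(1)])
    qed
    show "finite {f \<in> L. f ` K \<inter> K \<noteq> {}}" if K: "compact K" "0 \<notin> K" for K
    proof -
      have "finite (\<Union>g\<in>H. {f \<in> C.lifts g. f ` K \<inter> K \<noteq> {}})"
        using finH C.lifts_discontinuous[OF contH K] by (rule finite_UN_I)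
      moreover have "{f \<in> L. f ` K \<inter> K \<noteq> {}} \<subseteq> (\<Union>g\<in>H. {f \<in> C.lifts g. f ` K \<inter> K \<noteq> {}})"
        unfolding L_def by blast
      ultimately show ?thesis by (rule rev_finite_subset)
    qed
    obtain K where K: "compact K" "0 \<notin> K" "p ` K = topspace Y" by (rule C.compact_fundamental_set[OF Y(2)])
    have "\<exists>f\<in>L. \<exists>k\<in>K. f k = z" if z: "z \<noteq> 0" for z
    proof -
      have "p z \<in> p ` K" using C.p_in[OF z] K(3) by simp
      then obtain k where k: "k \<in> K" "p z = id (p k)" by auto
      then have "k \<noteq> 0" using K(2) by blast
      obtain f where "f \<in> C.lifts id" "f k = z" by (rule C.lift_exists[OF contH[OF idH] \<open>k \<noteq> 0\<close> z k(2)])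
      then show ?thesis using k(1) idH unfolding L_def by blast
    qed
    then show "\<exists>K. compact K \<and> 0 \<notin> K \<and> (\<forall>z. z \<noteq> 0 \<longrightarrow> (\<exists>f\<in>L. \<exists>k\<in>K. f k = z))"
      using K(1,2) by - (rule exI[of _ K], simp)
  qed
  obtain S where S: "S \<subseteq> L" "id \<in> S" "\<forall>f\<in>S. \<forall>h\<in>S. f \<circ> h = h \<circ> f"
    "\<forall>F. F \<subseteq> L \<longrightarrow> (\<forall>f\<in>F. \<forall>h\<in>F. f \<noteq> h \<longrightarrow> inv_into UNIV f \<circ> h \<notin> S)
      \<longrightarrow> card F \<le> 16 ^ DIM(complex^'n^'n)"
    using L.jordan_set by (elim exE conjE)
  let ?H = "?G\<lparr>carrier := H\<rparr>"
  have opsH: "x \<otimes>\<^bsub>?H\<^esub> y = x \<circ> y" "\<one>\<^bsub>?H\<^esub> = id" "carrier ?H = H" for x y by (simp_all add: ops)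
  interpret H: group ?H
  proof (rule groupI)
    show "\<exists>y\<in>carrier ?H. y \<otimes>\<^bsub>?H\<^esub> x = \<one>\<^bsub>?H\<^esub>" if "x \<in> carrier ?H" for x
      using inverse that unfolding opsH by blast
  qed (simp_all add: ops idH compH comp_assoc)
  \<comment> \<open>The automorphisms with a lift in \<open>S\<close>; they commute because their
    lifts do, although they need not form a subgroup.\<close>
  define SH where "SH = {g \<in> H. \<exists>f\<in>S. f \<in> C.lifts g}"
  define B where "B = generate ?H SH"
  have SHc: "SH \<subseteq> carrier ?H" by (auto simp: SH_def)
  have subB: "subgroup B ?H" unfolding B_def by (rule H.generate_is_subgroup[OF SHc])
  have BH: "B \<subseteq> H" using subgroup.subset[OF subB] by simp
  have commSH: "a \<otimes>\<^bsub>?H\<^esub> b = b \<otimes>\<^bsub>?H\<^esub> a" if ab: "a \<in> SH" "b \<in> SH" for a b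
  proof -
    have H: "a \<in> H" "b \<in> H" using ab by (auto simp: SH_def)
    obtain f where f: "f \<in> S" "f \<in> C.lifts a" using ab(1) unfolding SH_def by blast
    obtain h where h: "h \<in> S" "h \<in> C.lifts b" using ab(2) unfolding SH_def by blast
    have "f \<circ> h \<in> C.lifts (b \<circ> a)" using C.lifts_comp[OF h(2) f(2)] bspec[OF bspec[OF S(3) f(1)] h(1)] by simp
    then have "a \<circ> b = b \<circ> a" using ext[OF compH[OF H] compH[OF H(2,1)] C.lifts_comp[OF f(2) h(2)]] by blast
    then show ?thesis by (simp only: opsH)
  qed
  have commB: "\<forall>a\<in>B. \<forall>b\<in>B. a \<otimes>\<^bsub>?G\<^esub> b = b \<otimes>\<^bsub>?G\<^esub> a"
    using H.generate_commute[OF SHc commSH] unfolding B_def by (simp add: ops)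
  have invG: "inv\<^bsub>?G\<^esub> g = h" if "g \<in> H" "h \<in> H" "g \<circ> h = id" "h \<circ> g = id" for g h
    unfolding m_inv_def
  proof (rule the_equality)
    show "h \<in> carrier ?G \<and> g \<otimes>\<^bsub>?G\<^esub> h = \<one>\<^bsub>?G\<^esub> \<and> h \<otimes>\<^bsub>?G\<^esub> g = \<one>\<^bsub>?G\<^esub>"
      using that HG by (auto simp: ops)
    fix k assume "k \<in> carrier ?G \<and> g \<otimes>\<^bsub>?G\<^esub> k = \<one>\<^bsub>?G\<^esub> \<and> k \<otimes>\<^bsub>?G\<^esub> g = \<one>\<^bsub>?G\<^esub>"
    then have "g \<circ> k = id" by (simp add: ops)
    then have "(h \<circ> g) \<circ> k = h" by (simp only: comp_assoc comp_id)
    then show "k = h" by (simp add: that(4))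
  qed
  have "subgroup B ?G"
  proof (rule subgroup.intro)
    show "B \<subseteq> carrier ?G" using BH HG by blast
    show "x \<otimes>\<^bsub>?G\<^esub> y \<in> B" if "x \<in> B" "y \<in> B" for x y
      using subgroup.m_closed[OF subB that] by simp
    show "\<one>\<^bsub>?G\<^esub> \<in> B" using subgroup.one_closed[OF subB] by simp
    show "inv\<^bsub>?G\<^esub> x \<in> B" if x: "x \<in> B" for x
    proof -
      have i: "inv\<^bsub>?H\<^esub> x \<in> B" using subgroup.m_inv_closed[OF subB x] .
      have "x \<in> carrier ?H" using x BH by auto
      then have "x \<circ> inv\<^bsub>?H\<^esub> x = id" "inv\<^bsub>?H\<^esub> x \<circ> x = id"
        using H.r_inv[of x] H.l_inv[of x] unfolding opsH by auto
      moreover have "x \<in> H" "inv\<^bsub>?H\<^esub> x \<in> H" using i x BH by blast+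
      ultimately have "inv\<^bsub>?G\<^esub> x = inv\<^bsub>?H\<^esub> x" using invG by blast
      then show ?thesis using i by (simp only:)
    qed
  qed
  moreover have "card (rcosets\<^bsub>?H\<^esub> B) \<le> 16 ^ DIM(complex^'n^'n)"
  proof -
    have "\<forall>c\<in>rcosets\<^bsub>?H\<^esub> B. \<exists>a. a \<in> H \<and> c = B #>\<^bsub>?H\<^esub> a" unfolding RCOSETS_def by auto
    from bchoice[OF this] obtain a where a: "\<And>c. c \<in> rcosets\<^bsub>?H\<^esub> B \<Longrightarrow> a c \<in> H \<and> c = B #>\<^bsub>?H\<^esub> a c" by blast
    have "\<forall>c\<in>rcosets\<^bsub>?H\<^esub> B. \<exists>f. f \<in> C.lifts (inv\<^bsub>?H\<^esub> (a c))"
    proof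
      fix c assume "c \<in> rcosets\<^bsub>?H\<^esub> B"
      then have "inv\<^bsub>?H\<^esub> (a c) \<in> H" using a H.inv_closed[of "a c"] unfolding opsH by blast
      note cont = contH[OF this]
      define z :: "complex^'n" where "z = axis undefined 1"
      have z: "z \<noteq> 0" by (simp add: z_def axis_eq_0_iff)
      have "(inv\<^bsub>?H\<^esub> (a c)) (p z) \<in> p ` (- {0})" unfolding C.surj_p by (rule C.g_in[OF cont z])
      then obtain w where w: "w \<noteq> 0" "p w = (inv\<^bsub>?H\<^esub> (a c)) (p z)" by force
      show "\<exists>f. f \<in> C.lifts (inv\<^bsub>?H\<^esub> (a c))" using C.lift_exists[OF cont z w] by blast
    qed
    from bchoice[OF this] obtain l where l: "\<And>c. c \<in> rcosets\<^bsub>?H\<^esub> B \<Longrightarrow> l c \<in> C.lifts (inv\<^bsub>?H\<^esub> (a c))" by blast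
    have invH: "inv\<^bsub>?H\<^esub> (a c) \<in> H" "a c \<circ> inv\<^bsub>?H\<^esub> (a c) = id" "inv\<^bsub>?H\<^esub> (a c) \<circ> a c = id" if "c \<in> rcosets\<^bsub>?H\<^esub> B" for c
      using a[OF that] H.inv_closed[of "a c"] H.r_inv[of "a c"] H.l_inv[of "a c"] unfolding opsH by auto
    have lL: "l c \<in> L" if "c \<in> rcosets\<^bsub>?H\<^esub> B" for c
      using l[OF that] invH(1)[OF that] unfolding L_def by blast
    \<comment> \<open>Right cosets compare \<open>a c\<close> with \<open>a e\<close> through
      \<open>a c\<close> times the inverse of \<open>a e\<close>, whereas incongruence modulo
      \<open>S\<close> involves the inverse of the first lift. Lifting the inverses of the
      representatives makes the two agree, so distinct cosets yield incongruent lifts.\<close>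
    have same: "c = e" if ce: "c \<in> rcosets\<^bsub>?H\<^esub> B" "e \<in> rcosets\<^bsub>?H\<^esub> B" and s: "inv_into UNIV (l c) \<circ> l e \<in> S" for c e
    proof -
      obtain f' where f': "f' \<in> C.lifts (a c)" "l c \<circ> f' = id" "f' \<circ> l c = id"
        using C.lift_inverse[OF contH[OF invH(1)[OF ce(1)]] contH[of "a c"] invH(3,2)[OF ce(1)] l[OF ce(1)]] a[OF ce(1)] by blast
      then have "inv_into UNIV (l c) = f'" by (simp add: inv_unique_comp)
      then have "inv_into UNIV (l c) \<circ> l e \<in> C.lifts (a c \<circ> inv\<^bsub>?H\<^esub> (a e))" using C.lifts_comp[OF f'(1) l[OF ce(2)]] by simp
      moreover have aa: "a c \<circ> inv\<^bsub>?H\<^esub> (a e) \<in> H" using a[OF ce(1)] invH(1)[OF ce(2)] compH by blast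
      ultimately have "a c \<circ> inv\<^bsub>?H\<^esub> (a e) \<in> SH" using s unfolding SH_def by blast
      then have b: "a c \<circ> inv\<^bsub>?H\<^esub> (a e) \<in> B" unfolding B_def by (rule generate.incl)
      have "(a c \<circ> inv\<^bsub>?H\<^esub> (a e)) \<otimes>\<^bsub>?H\<^esub> a e = a c"
        using invH(3)[OF ce(2)] by (simp only: opsH comp_assoc comp_id)
      then have "a c \<in> B #>\<^bsub>?H\<^esub> a e" using b unfolding r_coset_def by (metis UN_I singletonI)
      moreover have "a e \<in> carrier ?H" using a[OF ce(2)] unfolding opsH by (elim conjE)
      ultimately have "B #>\<^bsub>?H\<^esub> a e = B #>\<^bsub>?H\<^esub> a c" using subB by (rule H.repr_independence)
      moreover have "c = B #>\<^bsub>?H\<^esub> a c" "e = B #>\<^bsub>?H\<^esub> a e" using a ce by blast+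
      ultimately show ?thesis by (simp only:)
    qed
    have "inj_on l (rcosets\<^bsub>?H\<^esub> B)"
    proof (rule inj_onI)
      fix c e assume ce: "c \<in> rcosets\<^bsub>?H\<^esub> B" "e \<in> rcosets\<^bsub>?H\<^esub> B" "l c = l e"
      have "inv_into UNIV (l c) \<circ> l e = id" using L.inv_left[OF lL[OF ce(1)]] ce(3) by simp
      then show "c = e" using same[OF ce(1,2)] S(2) by simp
    qed
    then have "card (rcosets\<^bsub>?H\<^esub> B) = card (l ` (rcosets\<^bsub>?H\<^esub> B))" by (simp add: card_image)
    also have "\<dots> \<le> 16 ^ DIM(complex^'n^'n)"
    proof (rule S(4)[rule_format])
      show "l ` (rcosets\<^bsub>?H\<^esub> B) \<subseteq> L" using lL by blast
      fix f h assume "f \<in> l ` (rcosets\<^bsub>?H\<^esub> B)" "h \<in> l ` (rcosets\<^bsub>?H\<^esub> B)" "f \<noteq> h"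
      then show "inv_into UNIV f \<circ> h \<notin> S" using same by blast
    qed
    finally show ?thesis .
  qed
  ultimately show "\<exists>B. subgroup B ?G \<and> B \<subseteq> H \<and> (\<forall>a\<in>B. \<forall>b\<in>B. a \<otimes>\<^bsub>?G\<^esub> b = b \<otimes>\<^bsub>?G\<^esub> a) \<and>
      card (rcosets\<^bsub>?H\<^esub> B) < Suc (16 ^ DIM(complex^'n^'n))"
    using BH commB by (intro exI[of _ B] conjI) simp_all
qed

end
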